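(* Let $X$ and $Y$ be bounded context-free languages as described in the context, with associated interleaving set $\Pi$, direction set $D_X$ and linear programs $\mathrm{LP}_{\vec a,\pi}$ with optimal values $\mathrm{OPT}_{\vec a,\pi}$. Then \[ \overrightarrow{\mathrm{AH}}_{\mathrm{ned}}(X,Y)=\sup_{\vec a\in D_X}\ \min_{\pi\in\Pi}\ \mathrm{OPT}_{\vec a,\pi}=\sup_{\vec a\in D_X}F(\vec a),\qquad F(\vec a):=\min_{\pi\in\Pi}\mathrm{OPT}_{\vec a,\pi}. \]
   Context: Distances. An edit path from $x$ to $y$ is a sequence $p=(a_1,b_1)\cdots(a_N,b_N)$ with $(a_i,b_i)\in(\Sigma\cup\{\varepsilon\})^2\setminus\{(\varepsilon,\varepsilon)\}$, $a_1\cdots a_N=x$, $b_1\cdots b_N=y$; $|p|=N$, $\mathrm{wgt}(p)=|\{i:a_i\ne b_i\}|$; $\mathrm{ned}(x,y)=\min_p\mathrm{wgt}(p)/|p|$ ($\mathrm{ned}(\varepsilon,\varepsilon)=0$); $\overrightarrow{\mathrm{AH}}_{\mathrm{ned}}(X,Y)=\lim_{k\to\infty}\sup_{x\in X,|x|\ge k}\inf_{y\in Y}\mathrm{ned}(x,y)$ (empty sup $=0$). Languages. Fix nonempty words $x_1,\dots,x_n$ and $y_1,\dots,y_m$ over $\Sigma$, with $X\subseteq x_1^*\cdots x_n^*$ and $Y\subseteq y_1^*\cdots y_m^*$ context-free. For $\vec\nu\in\mathbb{N}^n$ let $w^X_{\vec\nu}=x_1^{\nu_1}\cdots x_n^{\nu_n}$,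 and similarly $w^Y_{\vec\mu}$ for $\vec\mu\in\mathbb{N}^m$. Let $S_X=\{\vec\nu: w^X_{\vec\nu}\in X\}$ and $S_Y=\{\vec\mu:w^Y_{\vec\mu}\in Y\}$. Assume $S_X=\{\sum_{q=1}^k t_q\vec u_q: t\in\mathbb{N}^k\}$ and $S_Y=\{\sum_{s=1}^r t_s\vec v_s:t\in\mathbb{N}^r\}$ for period vectors $\vec u_q\in\mathbb{N}^n$, $\vec v_s\in\mathbb{N}^m$ (stratified linear sets with zero constant vector). Directions. For $\vec\nu\in\mathbb{N}^n\setminus\{0\}$, $\mathrm{dir}(\vec\nu)=\vec\nu/\sum_i\nu_i|x_i|$. $D_X$ is the topological closure in $\mathbb{R}^n$ of $\{\mathrm{dir}(\vec\nu):\vec\nu\in S_X\setminus\{0\}\}$; it lies in $\{\vec d\in\mathbb{R}^n_{\ge0}:\sum_i d_i|x_i|=1\}$. Interleavings. $\Pi$ is the set of monotone lattice paths in the grid $\{1..n\}\times\{1..m\}$ from $(1,1)$ to $(n,m)$ using steps $(i,j)\to(i+1,j)$ and $(i,j)\to(i,j+1)$, each identified with its set of cells. Cyclic edit graphs. For $x_i=c_1\cdots c_{|x_i|}$, $y_j=e_1\cdots e_{|y_j|}$, the graph $G^{i,j}$ has vertex set the quotient of $\{0..|x_i|\}\times\{0..|y_j|\}$ identifying $(0,k)\sim(|x_i|,k)$ and $(l,0)\sim(l,|y_j|)$, and (multi)edges: $(l,k)\to(l+1,k)$ (deletion of $c_{l+1}$, weight 1), $(l,k)\to(l,k+1)$ (insertion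 of $e_{k+1}$, weight 1), $(l,k)\to(l+1,k+1)$ (weight $0$ if $c_{l+1}=e_{k+1}$, else 1), for all $l<|x_i|$, $k\le|y_j|$ resp. $l\le|x_i|$, $k<|y_j|$ resp. $l<|x_i|,k<|y_j|$. Write $c(e)$ for the weight; $\mathbb{1}_{x_i}(e)=1$ iff $e$ is a deletion or diagonal edge, $\mathbb{1}_{y_j}(e)=1$ iff $e$ is an insertion or diagonal edge (else $0$). Linear program $\mathrm{LP}_{\vec a,\pi}$ for $\vec a\in D_X$, $\pi\in\Pi$: variables $f^{i,j}_e\ge0$ for $(i,j)\in\pi$, $e\in E(G^{i,j})$; $\tau_s\ge0$ for $1\le s\le r$; $\lambda\in(0,1]$. With $b_j=\sum_{s=1}^r\tau_s\,(\vec v_s)_j$, constraints: (1) $\sum_{(i,j)\in\pi}\sum_e f^{i,j}_e=1$; (2) for each $(i,j)\in\pi$ and vertex $v$ of $G^{i,j}$, $\sum_{e\text{ out of }v}f^{i,j}_e=\sum_{e\text{ into }v}f^{i,j}_e$; (3) for each $i\le n$, $\sum_{j:(i,j)\in\pi}\sum_e f^{i,j}_e\mathbb{1}_{x_i}(e)=|x_i|\,a_i\,\lambda$; (4) for each $j\le m$, $\sum_{i:(i,j)\in\pi}\sum_e f^{i,j}_e\mathbb{1}_{y_j}(e)=|y_j|\,b_j$. Objective: minimize $\sum_{(i,j)\in\pi}\sum_e f^{i,j}_e c(e)$; $\mathrm{OPT}_{\vec a,\pi}$ is its optimal value. *)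

theory Defs
  imports "HOL-Analysis.Analysis"
begin

datatype ('n, 't) sym = NT 'n | Tm 't

inductive cfg_step :: "('n \<times> ('n, 't) sym list) set \<Rightarrow> ('n, 't) sym list \<Rightarrow> ('n, 't) sym list \<Rightarrow> bool"
  for P where
  "(A, w) \<in> P \<Longrightarrow> cfg_step P (u @ [NT A] @ v) (u @ w @ v)"

definition is_cfl :: "'a list set \<Rightarrow> bool" where
  "is_cfl L \<longleftrightarrow> (\<exists>(P :: (nat \<times> (nat, 'a) sym list) set) S.
      finite P \<and> L = {w. (cfg_step P)\<^sup>*\<^sup>* [NT S] (map Tm w)})"

fun ostr :: "'a option \<Rightarrow> 'a list" where
  "ostr None = []" | "ostr (Some a) = [a]"

definition edit_path :: "('a option \<times> 'a option) list \<Rightarrow> 'a list \<Rightarrow> 'a list \<Rightarrow> bool" where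
  "edit_path p x y \<longleftrightarrow> (\<forall>e\<in>set p. e \<noteq> (None, None))
     \<and> concat (map (ostr \<circ> fst) p) = x \<and> concat (map (ostr \<circ> snd) p) = y"

definition wgt :: "('a option \<times> 'a option) list \<Rightarrow> nat" where
  "wgt p = length (filter (\<lambda>(a, b). a \<noteq> b) p)"

definition ned :: "'a list \<Rightarrow> 'a list \<Rightarrow> real" where
  "ned x y = (if x = [] \<and> y = [] then 0
     else Inf {real (wgt p) / real (length p) | p. edit_path p x y})"

definition sup0 :: "real set \<Rightarrow> real" where
  "sup0 S = (if S = {} then 0 else Sup S)"

definition AH_ned :: "'a list set \<Rightarrow> 'a list set \<Rightarrow> real" where
  "AH_ned X Y = lim (\<lambda>k. sup0 ((\<lambda>x. INF y\<in>Y. ned x y) ` {x \<in> X. k \<le> length x}))"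

text \<open>Vectors in N^n / R^n are functions on nat, indices 0..n-1 (0-based), zero elsewhere.\<close>

definition wordof :: "'a list list \<Rightarrow> (nat \<Rightarrow> nat) \<Rightarrow> 'a list" where
  "wordof xs \<nu> = concat (map (\<lambda>i. concat (replicate (\<nu> i) (xs ! i))) [0..<length xs])"

definition Svec :: "'a list list \<Rightarrow> 'a list set \<Rightarrow> (nat \<Rightarrow> nat) set" where
  "Svec xs X = {\<nu>. (\<forall>i\<ge>length xs. \<nu> i = 0) \<and> wordof xs \<nu> \<in> X}"

definition linset :: "nat \<Rightarrow> (nat \<Rightarrow> nat \<Rightarrow> nat) \<Rightarrow> (nat \<Rightarrow> nat) set" where
  "linset k us = {(\<lambda>i. \<Sum>q<k. t q * us q i) | t :: nat \<Rightarrow> nat. True}"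

definition dirv :: "'a list list \<Rightarrow> (nat \<Rightarrow> nat) \<Rightarrow> (nat \<Rightarrow> real)" where
  "dirv xs \<nu> = (\<lambda>i. real (\<nu> i) / (\<Sum>i'<length xs. real (\<nu> i') * real (length (xs ! i'))))"

text \<open>Closure taken in the product topology on nat => real; all points involved vanish
  outside {0..<n}, so this is the closure in R^n.\<close>
definition Dset :: "'a list list \<Rightarrow> 'a list set \<Rightarrow> (nat \<Rightarrow> real) set" where
  "Dset xs X = closure (dirv xs ` (Svec xs X - {\<lambda>_. 0}))"

definition lpath :: "nat \<Rightarrow> nat \<Rightarrow> (nat \<times> nat) list \<Rightarrow> bool" where
  "lpath n m p \<longleftrightarrow> p \<noteq> [] \<and> hd p = (0, 0) \<and> last p = (n - 1, m - 1) \<and>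
     (\<forall>t. Suc t < length p \<longrightarrow>
        p ! Suc t = (Suc (fst (p ! t)), snd (p ! t)) \<or> p ! Suc t = (fst (p ! t), Suc (snd (p ! t))))"

definition Interl :: "nat \<Rightarrow> nat \<Rightarrow> (nat \<times> nat) set set" where
  "Interl n m = {set p | p. lpath n m p}"

datatype ekind = Del | Ins | Dia

type_synonym edge = "ekind \<times> nat \<times> nat"

definition cedges :: "'a list \<Rightarrow> 'a list \<Rightarrow> edge set" where
  "cedges u v = {(Del, l, k) | l k. l < length u \<and> k \<le> length v}
              \<union> {(Ins, l, k) | l k. l \<le> length u \<and> k < length v}
              \<union> {(Dia, l, k) | l k. l < length u \<and> k < length v}"

text \<open>Vertices of the quotient are represented by {0..<|u|} x {0..<|v|}.\<close>
definition cverts :: "'a list \<Rightarrow> 'a list \<Rightarrow> (nat \<times> nat) set" where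
  "cverts u v = {0..<length u} \<times> {0..<length v}"

definition cvert :: "'a list \<Rightarrow> 'a list \<Rightarrow> nat \<Rightarrow> nat \<Rightarrow> nat \<times> nat" where
  "cvert u v l k = (l mod length u, k mod length v)"

fun esrc :: "'a list \<Rightarrow> 'a list \<Rightarrow> edge \<Rightarrow> nat \<times> nat" where
  "esrc u v (_, l, k) = cvert u v l k"

fun etgt :: "'a list \<Rightarrow> 'a list \<Rightarrow> edge \<Rightarrow> nat \<times> nat" where
  "etgt u v (Del, l, k) = cvert u v (Suc l) k"
| "etgt u v (Ins, l, k) = cvert u v l (Suc k)"
| "etgt u v (Dia, l, k) = cvert u v (Suc l) (Suc k)"

fun ecost :: "'a list \<Rightarrow> 'a list \<Rightarrow> edge \<Rightarrow> real" where
  "ecost u v (Dia, l, k) = (if u ! l = v ! k then 0 else 1)"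
| "ecost u v (Del, l, k) = 1"
| "ecost u v (Ins, l, k) = 1"

definition indx :: "edge \<Rightarrow> real" where
  "indx e = (if fst e = Ins then 0 else 1)"

definition indy :: "edge \<Rightarrow> real" where
  "indy e = (if fst e = Del then 0 else 1)"

definition lp_feasible ::
  "'a list list \<Rightarrow> 'a list list \<Rightarrow> nat \<Rightarrow> (nat \<Rightarrow> nat \<Rightarrow> nat) \<Rightarrow> (nat \<Rightarrow> real) \<Rightarrow>
   (nat \<times> nat) set \<Rightarrow> (nat \<times> nat \<Rightarrow> edge \<Rightarrow> real) \<Rightarrow> (nat \<Rightarrow> real) \<Rightarrow> real \<Rightarrow> bool" where
  "lp_feasible xs ys r vs a \<pi> f \<tau> lam \<longleftrightarrow>
     (\<forall>(i, j)\<in>\<pi>. \<forall>e\<in>cedges (xs ! i) (ys ! j). 0 \<le> f (i, j) e)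
   \<and> (\<forall>s<r. 0 \<le> \<tau> s) \<and> 0 < lam \<and> lam \<le> 1
   \<and> (\<Sum>(i, j)\<in>\<pi>. \<Sum>e\<in>cedges (xs ! i) (ys ! j). f (i, j) e) = 1
   \<and> (\<forall>(i, j)\<in>\<pi>. \<forall>w\<in>cverts (xs ! i) (ys ! j).
        (\<Sum>e\<in>{e\<in>cedges (xs ! i) (ys ! j). esrc (xs ! i) (ys ! j) e = w}. f (i, j) e)
      = (\<Sum>e\<in>{e\<in>cedges (xs ! i) (ys ! j). etgt (xs ! i) (ys ! j) e = w}. f (i, j) e))
   \<and> (\<forall>i<length xs. (\<Sum>j\<in>{j. (i, j) \<in> \<pi>}. \<Sum>e\<in>cedges (xs ! i) (ys ! j). f (i, j) e * indx e)
        = real (length (xs ! i)) * a i * lam)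
   \<and> (\<forall>j<length ys. (\<Sum>i\<in>{i. (i, j) \<in> \<pi>}. \<Sum>e\<in>cedges (xs ! i) (ys ! j). f (i, j) e * indy e)
        = real (length (ys ! j)) * (\<Sum>s<r. \<tau> s * real (vs s j)))"

definition lp_obj :: "'a list list \<Rightarrow> 'a list list \<Rightarrow> (nat \<times> nat) set \<Rightarrow> (nat \<times> nat \<Rightarrow> edge \<Rightarrow> real) \<Rightarrow> real" where
  "lp_obj xs ys \<pi> f = (\<Sum>(i, j)\<in>\<pi>. \<Sum>e\<in>cedges (xs ! i) (ys ! j). f (i, j) e * ecost (xs ! i) (ys ! j) e)"

definition OPT :: "'a list list \<Rightarrow> 'a list list \<Rightarrow> nat \<Rightarrow> (nat \<Rightarrow> nat \<Rightarrow> nat) \<Rightarrow> (nat \<Rightarrow> real) \<Rightarrow>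
   (nat \<times> nat) set \<Rightarrow> real" where
  "OPT xs ys r vs a \<pi> = Inf {lp_obj xs ys \<pi> f | f \<tau> lam. lp_feasible xs ys r vs a \<pi> f \<tau> lam}"

definition Ffun :: "'a list list \<Rightarrow> 'a list list \<Rightarrow> nat \<Rightarrow> (nat \<Rightarrow> nat \<Rightarrow> nat) \<Rightarrow> (nat \<Rightarrow> real) \<Rightarrow> real" where
  "Ffun xs ys r vs a = Min ((\<lambda>\<pi>. OPT xs ys r vs a \<pi>) ` Interl (length xs) (length ys))"

end

theory Submission
  imports Defs "HOL-Library.Sublist" "HOL-Complex_Analysis.Great_Picard"
begin

text \<open>
  Walks in the cyclic edit graph of \<open>u\<close> and \<open>v\<close> are edit paths between factors of powers of \<open>u\<close> and
  of \<open>v\<close>, so counting edges turns long edit paths into circulations, up to a bounded error per cell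
  of the interleaving.

  For the upper bound, a feasible solution is scaled to the length of \<open>x\<close> and decomposed into simple
  cycles; each cycle is repeated a whole number of times, and the deficit is filled with deletions and
  insertions. The additive error does not depend on \<open>x\<close>, so it vanishes relative to \<open>|x|\<close>.

  For the lower bound, a direction in \<open>D\<^sub>X\<close> is approached by words of \<open>X\<close> of increasing length (multiples
  of a vector of a linear set with zero constant stay in the set). Near-optimal edit paths from these
  words split along a lattice path into cells, and a limit of the normalised flows is feasible. Only the
  constraint \<open>\<lambda> > 0\<close> can get lost in the limit, but then all of the limit flow consists of insertions and
  costs \<open>1\<close>, which is never below the optimum.
\<close>

subsection \<open>Edit paths\<close>

text \<open>In the linear program, \<open>lam\<close> is the fraction of the path length that
  \<open>x\<close> accounts for, and the objective is weight per unit of length; this is why the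
  flow is scaled by the length of \<open>x\<close> divided by \<open>lam\<close>. The obstacle in
  the upper bound is that conservation of flow does not make the support connected, so a solution
  need not be one closed walk. Each closed piece has to be entered from the corner of the grid on
  its own, which is affordable because the number of pieces depends only on the two words of the
  cell. The exponents of \<open>x\<close> are prescribed, while the periods of \<open>Y\<close> may
  be combined freely. Cell paths are therefore rounded down and period coefficients up: what is
  missing can then always be filled in, and filler raises weight and length by the same amount. No
  continuity of \<open>F\<close> is needed for the closure in \<open>Dset\<close>: the upper bound
  meets only directions of words, and in the lower bound flows and directions converge together. Nor
  are the optima of the linear program shown to be attained; near-optimal solutions and near-optimal
  edit paths leave a slack that tends to 0.\<close>

abbreviation pw :: "'a list \<Rightarrow> nat \<Rightarrow> 'a list" where
  "pw u n \<equiv> concat (replicate n u)"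

lemma pw_add: "pw u (m + n) = pw u m @ pw u n"
  by (simp add: replicate_add)

lemma length_pw: "length (pw u n) = n * length u"
  by (induction n) auto

lemma wgt_Nil [simp]: "wgt [] = 0"
  and wgt_Cons [simp]: "wgt (e # p) = (if fst e = snd e then 0 else 1) + wgt p"
  and wgt_append [simp]: "wgt (p @ q) = wgt p + wgt q"
  by (auto simp: wgt_def split: prod.splits)

lemma wgt_le_length: "wgt p \<le> length p"
  by (auto simp: wgt_def)

lemma edit_path_Nil [simp]: "edit_path [] x y \<longleftrightarrow> x = [] \<and> y = []"
  by (auto simp: edit_path_def)

lemma edit_path_Cons:
  "edit_path (e # p) x y \<longleftrightarrow> e \<noteq> (None, None) \<and>
     (\<exists>x' y'. x = ostr (fst e) @ x' \<and> y = ostr (snd e) @ y' \<and> edit_path p x' y')"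
  by (auto simp: edit_path_def)

lemma edit_path_append:
  "edit_path p x y \<Longrightarrow> edit_path q x' y' \<Longrightarrow> edit_path (p @ q) (x @ x') (y @ y')"
  by (auto simp: edit_path_def)

lemma edit_path_swap: "edit_path (map prod.swap p) y x \<longleftrightarrow> edit_path p x y"
proof (induction p arbitrary: x y)
  case (Cons e p)
  then show ?case by (cases e) (auto simp: edit_path_Cons)
qed auto

lemma wgt_swap: "wgt (map prod.swap p) = wgt p"
  by (induction p) auto

definition dels :: "'a list \<Rightarrow> ('a option \<times> 'a option) list" where
  "dels = map (\<lambda>a. (Some a, None))"
definition inss :: "'a list \<Rightarrow> ('a option \<times> 'a option) list" where
  "inss = map (\<lambda>a. (None, Some a))"

lemma dels: "edit_path (dels x) x []" "wgt (dels x) = length x" "length (dels x) = length x"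
  by (induction x) (auto simp: dels_def edit_path_Cons)

lemma inss: "edit_path (inss x) [] x" "wgt (inss x) = length x" "length (inss x) = length x"
  by (induction x) (auto simp: inss_def edit_path_Cons)

lemma edit_path_exists: "\<exists>p. edit_path p x y"
  using edit_path_append[OF dels(1) inss(1)] by auto

lemma edit_path_length_bounds:
  assumes "edit_path p x y"
  shows "length x \<le> length p" "length y \<le> length p"
  using assms
proof (induction p arbitrary: x y)
  case (Cons e p)
  have "length (ostr a) \<le> 1" for a :: "'a option" by (cases a) auto
  note this[of "fst e"] this[of "snd e"]
  moreover case 1
  ultimately show ?case using Cons.IH(1) by (fastforce simp: edit_path_Cons)
next
  case (Cons e p)
  have "length (ostr a) \<le> 1" for a :: "'a option" by (cases a) auto
  note this[of "fst e"] this[of "snd e"]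
  moreover case 2
  ultimately show ?case using Cons.IH(2) by (fastforce simp: edit_path_Cons)
qed auto

text \<open>The cut falls as soon as \<open>A\<close> is used up, so insertions at the border go to
  \<open>p2\<close>; where this cuts \<open>Y\<close> is dictated by the path.\<close>

lemma edit_path_split_left:
  assumes "edit_path p (A @ B) Y"
  shows "\<exists>p1 p2 Y1 Y2. p = p1 @ p2 \<and> Y = Y1 @ Y2 \<and> edit_path p1 A Y1 \<and> edit_path p2 B Y2"
  using assms
proof (induction p arbitrary: A Y)
  case (Cons e p)
  show ?case
  proof (cases "A = []")
    case True
    have "edit_path [] A []" "edit_path (e # p) B Y" using True Cons.prems by auto
    then show ?thesis by (metis append_Nil)
  next
    case False
    obtain x' y' where e: "e \<noteq> (None, None)" "A @ B = ostr (fst e) @ x'" "Y = ostr (snd e) @ y'"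
      "edit_path p x' y'" using Cons.prems by (auto simp: edit_path_Cons)
    obtain A' where A': "A = ostr (fst e) @ A'" "x' = A' @ B"
      using e(2) False by (cases "fst e"; cases A) auto
    obtain p1 p2 Y1 Y2 where *: "p = p1 @ p2" "y' = Y1 @ Y2" "edit_path p1 A' Y1" "edit_path p2 B Y2"
      using Cons.IH[of A' y'] e(4) A' by auto
    have "edit_path (e # p1) A (ostr (snd e) @ Y1)" using * A' e by (auto simp: edit_path_Cons)
    moreover have "e # p = (e # p1) @ p2" "Y = (ostr (snd e) @ Y1) @ Y2" using * e by auto
    ultimately show ?thesis using *(4) by blast
  qed
qed auto

lemma edit_path_split_right:
  assumes "edit_path p X (A @ B)"
  shows "\<exists>p1 p2 X1 X2. p = p1 @ p2 \<and> X = X1 @ X2 \<and> edit_path p1 X1 A \<and> edit_path p2 X2 B"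
proof -
  from edit_path_split_left[of "map prod.swap p" A B X] assms
  obtain q1 q2 X1 X2 where q: "map prod.swap p = q1 @ q2" "X = X1 @ X2" "edit_path q1 A X1" "edit_path q2 B X2"
    by (auto simp: edit_path_swap)
  have "p = map prod.swap (map prod.swap p)" by (simp add: map_idI)
  then have "p = map prod.swap q1 @ map prod.swap q2" by (simp only: q(1) map_append)
  with q show ?thesis by (metis edit_path_swap)
qed

text \<open>Each letter of \<open>x\<close> outside the embedded \<open>x'\<close> becomes one
  deletion spliced into the path, which raises weight and length alike. The equations are additive
  to avoid truncated subtraction.\<close>

lemma edit_path_subseq_left:
  assumes "subseq x' x" "edit_path p x' y"
  shows "\<exists>q. edit_path q x y \<and> wgt q + length x' = wgt p + length x \<and> length q + length x' = length p + length x"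
proof -
  \<comment> \<open>The prefix \<open>z\<close> collects the letters already matched by the
    embedding, so that deletions can be spliced into the middle of the path.\<close>
  have "\<exists>q. edit_path q (z @ x) y \<and> wgt q + length x' = wgt p + length x \<and> length q + length x' = length p + length x"
    if "edit_path p (z @ x') y" for z
    using assms(1) that
  proof (induction x' x arbitrary: z p)
    case (list_emb_Nil ys)
    obtain p1 p2 Y1 Y2 where *: "p = p1 @ p2" "y = Y1 @ Y2" "edit_path p1 z Y1" "edit_path p2 [] Y2"
      using edit_path_split_left[OF list_emb_Nil] by blast
    then have "edit_path (p1 @ dels ys @ p2) (z @ ys) y"
      using edit_path_append[OF *(3) edit_path_append[OF dels(1) *(4)]] by (auto simp: *)
    then show ?case using * dels[of ys] by (intro exI[of _ "p1 @ dels ys @ p2"]) auto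
  next
    case (list_emb_Cons xs ys c)
    obtain q where q: "edit_path q (z @ ys) y" "wgt q + length xs = wgt p + length ys"
      "length q + length xs = length p + length ys" using list_emb_Cons.IH[OF list_emb_Cons.prems] by blast
    obtain p1 p2 Y1 Y2 where *: "q = p1 @ p2" "y = Y1 @ Y2" "edit_path p1 z Y1" "edit_path p2 ys Y2"
      using edit_path_split_left[OF q(1)] by blast
    then have "edit_path (p1 @ dels [c] @ p2) (z @ c # ys) y"
      using edit_path_append[OF *(3) edit_path_append[OF dels(1)[of "[c]"] *(4)]] by (auto simp: *)
    then show ?case using * q dels[of "[c]"] by (intro exI[of _ "p1 @ dels [c] @ p2"]) auto
  next
    case (list_emb_Cons2 a b xs ys)
    then show ?case using list_emb_Cons2.IH[of p "z @ [a]"] by auto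
  qed
  from this[of "[]"] show ?thesis using assms(2) by simp
qed

lemma edit_path_subseq:
  assumes "subseq x' x" "subseq y' y" "edit_path p x' y'"
  shows "\<exists>q. edit_path q x y \<and> wgt q + length x' + length y' = wgt p + length x + length y
      \<and> length q + length x' + length y' = length p + length x + length y"
proof -
  obtain q where q: "edit_path q x y'" "wgt q + length x' = wgt p + length x" "length q + length x' = length p + length x"
    using edit_path_subseq_left[OF assms(1,3)] by blast
  have "edit_path (map prod.swap q) y' x" using q by (simp add: edit_path_swap)
  from edit_path_subseq_left[OF assms(2) this]
  obtain q' where "edit_path q' y x" "wgt q' + length y' = wgt q + length y" "length q' + length y' = length q + length y"
    by (auto simp: wgt_swap)
  then show ?thesis using q
    by (intro exI[of _ "map prod.swap q'"]) (auto simp: edit_path_swap wgt_swap)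
qed

section \<open>The normalised edit distance as an infimum\<close>

lemma ned_le:
  assumes "edit_path p x y"
  shows "ned x y \<le> real (wgt p) / real (length p)"
proof (cases "x = [] \<and> y = []")
  case False
  have "bdd_below {real (wgt p) / real (length p) | p. edit_path p x y}"
    by (rule bdd_belowI[of _ 0]) auto
  then show ?thesis using False assms unfolding ned_def by (auto intro!: cInf_lower)
qed (auto simp: ned_def)

lemma ned_nonneg: "0 \<le> ned x y"
  unfolding ned_def using edit_path_exists[of x y] by (auto intro!: cInf_greatest)

lemma ned_le_1: "ned x y \<le> 1"
proof -
  obtain p where p: "edit_path p x y" using edit_path_exists by blast
  have "real (wgt p) / real (length p) \<le> 1"
    using wgt_le_length[of p] by (simp add: divide_le_eq_1)
  then show ?thesis using ned_le[OF p] by simp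
qed

lemma ned_approx:
  assumes "ned x y < c" "x \<noteq> []"
  obtains p where "edit_path p x y" "real (wgt p) / real (length p) < c"
proof -
  have "Inf {real (wgt p) / real (length p) | p. edit_path p x y} < c"
    using assms by (simp add: ned_def)
  moreover have "{real (wgt p) / real (length p) | p. edit_path p x y} \<noteq> {}"
    using edit_path_exists by blast
  ultimately show ?thesis using that cInf_lessD[of _ c] by (smt (verit) mem_Collect_eq)
qed

subsection \<open>Circulations in finite multigraphs\<close>

text \<open>Edges are abstract, with endpoint maps, because the quotient of the grid has parallel
  edges: \<open>(Del, l, 0)\<close> and \<open>(Del, l, length v)\<close> join the same
  vertices.\<close>

fun gwalk :: "('e \<Rightarrow> 'v) \<Rightarrow> ('e \<Rightarrow> 'v) \<Rightarrow> 'e set \<Rightarrow> 'v \<Rightarrow> 'e list \<Rightarrow> 'v \<Rightarrow> bool" where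
  "gwalk src tgt E s [] t \<longleftrightarrow> s = t"
| "gwalk src tgt E s (e # C) t \<longleftrightarrow> e \<in> E \<and> src e = s \<and> gwalk src tgt E (tgt e) C t"

lemma gwalk_append:
  "gwalk src tgt E s C t \<Longrightarrow> gwalk src tgt E t D v \<Longrightarrow> gwalk src tgt E s (C @ D) v"
  by (induction C arbitrary: s) auto

lemma gwalk_set: "gwalk src tgt E s C t \<Longrightarrow> set C \<subseteq> E"
  by (induction C arbitrary: s) auto

lemma sum_count_list:
  assumes "finite E" "set C \<subseteq> E"
  shows "(\<Sum>e\<in>E. real (count_list C e) * h e) = sum_list (map h C)"
  using assms(2)
proof (induction C)
  case (Cons c C)
  have "(\<Sum>e\<in>E. real (count_list (c # C) e) * h e) = (\<Sum>e\<in>E. real (count_list C e) * h e + (if e = c then h e else 0))"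
    by (intro sum.cong) (auto simp: algebra_simps)
  also have "\<dots> = (\<Sum>e\<in>E. real (count_list C e) * h e) + h c"
    using Cons.prems assms(1) by (simp add: sum.distrib)
  finally show ?case using Cons by simp
qed simp

lemma sum_count_list_filter:
  assumes "finite E" "set C \<subseteq> E"
  shows "(\<Sum>e\<in>{e\<in>E. P e}. real (count_list C e)) = real (length (filter P C))"
proof -
  have "(\<Sum>e\<in>{e\<in>E. P e}. real (count_list C e)) = (\<Sum>e\<in>E. real (count_list C e) * (if P e then 1 else 0))"
    using assms(1) by (intro sum.mono_neutral_cong_left) auto
  also have "\<dots> = sum_list (map (\<lambda>e. if P e then 1 else 0) C)"
    by (rule sum_count_list[OF assms])
  also have "\<dots> = real (length (filter P C))"
    by (induction C) auto
  finally show ?thesis .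
qed

lemma gwalk_degree:
  assumes "gwalk src tgt E s C t"
  shows "length (filter (\<lambda>e. src e = w) C) + (if t = w then 1 else 0)
       = length (filter (\<lambda>e. tgt e = w) C) + (if s = w then 1 else 0)"
  using assms by (induction C arbitrary: s) fastforce+

lemma gwalk_closed_balanced:
  assumes "gwalk src tgt E s C s" "finite E"
  shows "(\<Sum>e\<in>{e\<in>E. src e = w}. real (count_list C e)) = (\<Sum>e\<in>{e\<in>E. tgt e = w}. real (count_list C e))"
  using gwalk_degree[OF assms(1), of w] gwalk_set[OF assms(1)] assms(2)
  by (simp add: sum_count_list_filter)

text \<open>Closed trails rather than vertex-simple cycles: distinct edges already bound the length
  by \<open>card E\<close> and so give finiteness. The empty list is included.\<close>

definition cycles :: "('e \<Rightarrow> 'v) \<Rightarrow> ('e \<Rightarrow> 'v) \<Rightarrow> 'e set \<Rightarrow> 'e list set" where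
  "cycles src tgt E = {C. distinct C \<and> (\<exists>s. gwalk src tgt E s C s)}"

lemma finite_cycles:
  assumes "finite E"
  shows "finite (cycles src tgt E)"
proof (rule finite_subset)
  show "cycles src tgt E \<subseteq> {C. set C \<subseteq> E \<and> length C \<le> card E}"
    using assms unfolding cycles_def by (auto dest: gwalk_set) (metis card_mono distinct_card gwalk_set)
qed (rule finite_lists_length_le[OF assms])

text \<open>Following a fixed choice of successors must repeat an edge; the stretch up to the
  earliest repetition is the cycle.\<close>

lemma cycle_exists:
  assumes "finite E" "e0 \<in> E" "\<And>e. e \<in> E \<Longrightarrow> \<exists>e'\<in>E. src e' = tgt e"
  obtains s C where "distinct C" "C \<noteq> []" "gwalk src tgt E s C s"
proof -
  obtain nx where nx: "\<And>e. e \<in> E \<Longrightarrow> nx e \<in> E \<and> src (nx e) = tgt e"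
    using assms(3) by metis
  define f where "f k = (nx ^^ k) e0" for k
  have fE: "f k \<in> E" for k by (induction k) (auto simp: f_def assms nx)
  have fs: "src (f (Suc k)) = tgt (f k)" for k using nx[OF fE[of k]] by (simp add: f_def)
  have "\<not> inj f"
    using assms(1) fE finite_subset[of "range f" E] finite_imageD[of f UNIV] by auto
  then have ex: "\<exists>j. \<exists>i<j. f i = f j"
    unfolding inj_def by (metis linorder_neqE_nat)
  \<comment> \<open>At the least index where an edge recurs, all earlier edges are pairwise
    distinct.\<close>
  define j where "j = (LEAST j. \<exists>i<j. f i = f j)"
  obtain i where i: "i < j" "f i = f j" using LeastI_ex[OF ex] by (auto simp: j_def)
  have inj: "inj_on f {..<j}"
  proof (rule inj_onI)
    fix a b assume "a \<in> {..<j}" "b \<in> {..<j}" "f a = f b"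
    then show "a = b"
      using not_less_Least[of a "\<lambda>j. \<exists>i<j. f i = f j"] not_less_Least[of b "\<lambda>j. \<exists>i<j. f i = f j"]
      unfolding j_def[symmetric] by (metis lessThan_iff linorder_neqE_nat)
  qed
  have w: "gwalk src tgt E (src (f a)) (map f [a..<a + d]) (src (f (a + d)))" for a d
  proof (induction d arbitrary: a)
    case (Suc d)
    have "[a..<a + Suc d] = a # [Suc a..<Suc a + d]" by (simp add: upt_conv_Cons del: upt_Suc)
    then show ?case using Suc[of "Suc a"] fE[of a] fs[of a] by simp
  qed auto
  show ?thesis
  proof (rule that)
    show "distinct (map f [i..<j])" using inj by (auto simp: distinct_map intro: inj_on_subset)
    show "map f [i..<j] \<noteq> []" using i by auto
    show "gwalk src tgt E (src (f i)) (map f [i..<j]) (src (f i))"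
      using w[of i "j - i"] i by simp
  qed
qed

lemma gwalk_mono: "gwalk src tgt E s C t \<Longrightarrow> E \<subseteq> E' \<Longrightarrow> gwalk src tgt E' s C t"
  by (induction C arbitrary: s) auto

text \<open>Induction on the size of the support: subtracting a closed trail of the support, with
  the smallest value on it as coefficient, keeps nonnegativity and balance and makes at least one
  edge vanish.\<close>

lemma circulation_decomposition:
  fixes g :: "'e \<Rightarrow> real"
  assumes "finite E" "\<And>e. e \<in> E \<Longrightarrow> 0 \<le> g e"
    and "\<And>v. (\<Sum>e\<in>{e\<in>E. src e = v}. g e) = (\<Sum>e\<in>{e\<in>E. tgt e = v}. g e)"
  shows "\<exists>w. (\<forall>C. 0 \<le> w C) \<and> (\<forall>e\<in>E. g e = (\<Sum>C\<in>cycles src tgt E. w C * real (count_list C e)))"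
  using assms(2,3)
proof (induction "card {e\<in>E. 0 < g e}" arbitrary: g rule: less_induct)
  case less
  define E' where "E' = {e\<in>E. 0 < g e}"
  show ?case
  proof (cases "E' = {}")
    case True
    then have "\<forall>e\<in>E. g e = 0" using less.prems(1) by (force simp: E'_def)
    then show ?thesis by (intro exI[of _ "\<lambda>_. 0"]) auto
  next
    case False
    \<comment> \<open>A positive edge gives its target positive inflow, hence by balance positive
      outflow: the support has no dead ends.\<close>
    have nx: "\<exists>e'\<in>E'. src e' = tgt e" if "e \<in> E'" for e
    proof (rule ccontr)
      assume "\<not> ?thesis"
      then have "\<forall>e'\<in>{e'\<in>E. src e' = tgt e}. g e' = 0" using less.prems(1) by (force simp: E'_def)
      then have "(\<Sum>e'\<in>{e'\<in>E. tgt e' = tgt e}. g e') = 0" using less.prems(2)[of "tgt e"] by simp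
      then have "g e = 0"
        using that assms(1) less.prems(1) by (subst (asm) sum_nonneg_eq_0_iff) (auto simp: E'_def)
      then show False using that by (auto simp: E'_def)
    qed
    obtain s C where C: "distinct C" "C \<noteq> []" "gwalk src tgt E' s C s"
    proof -
      have "finite E'" using assms(1) by (simp add: E'_def)
      moreover obtain e0 where "e0 \<in> E'" using False by blast
      ultimately show ?thesis using cycle_exists[of E' e0 src tgt] nx that by blast
    qed
    have CE': "set C \<subseteq> E'" using gwalk_set[OF C(3)] .
    have CE: "gwalk src tgt E s C s" using gwalk_mono[OF C(3)] by (auto simp: E'_def)
    have cyc: "C \<in> cycles src tgt E" using C CE by (auto simp: cycles_def)
    define m where "m = Min (g ` set C)"
    have "m \<in> g ` set C" unfolding m_def using C by (intro Min_in) auto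
    then obtain e1 where e1: "e1 \<in> set C" "g e1 = m" by auto
    have mle: "m \<le> g e" if "e \<in> set C" for e unfolding m_def using that by auto
    have m0: "0 < m" using e1 CE' by (auto simp: E'_def)
    define g' where "g' e = g e - m * real (count_list C e)" for e
    have cnt: "count_list C e = (if e \<in> set C then 1 else 0)" for e
      using C(1) by (induction C) auto
    have g'0: "0 \<le> g' e" if "e \<in> E" for e
      using less.prems(1)[OF that] mle[of e] by (auto simp: g'_def cnt)
    have bal: "(\<Sum>e\<in>{e\<in>E. src e = v}. g' e) = (\<Sum>e\<in>{e\<in>E. tgt e = v}. g' e)" for v
      using less.prems(2)[of v] gwalk_closed_balanced[OF CE assms(1), of v]
      by (simp add: g'_def sum_subtractf flip: sum_distrib_left)
    have "{e\<in>E. 0 < g' e} \<subset> E'"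
    proof
      show "{e\<in>E. 0 < g' e} \<subseteq> E'"
        using m0 by (auto simp: g'_def E'_def cnt split: if_splits)
      have "g' e1 = 0" using e1 by (simp add: g'_def cnt)
      then show "{e\<in>E. 0 < g' e} \<noteq> E'" using e1 CE' by auto
    qed
    then have "card {e\<in>E. 0 < g' e} < card {e\<in>E. 0 < g e}"
      unfolding E'_def using assms(1) by (intro psubset_card_mono) auto
    from less.hyps[OF this g'0 bal] obtain w where
      w: "\<forall>C. 0 \<le> w C" "\<forall>e\<in>E. g' e = (\<Sum>C\<in>cycles src tgt E. w C * real (count_list C e))" by blast
    show ?thesis
    \<comment> \<open>Adding to \<open>w C\<close> instead of setting it spares an argument about
      the weight that the induction hypothesis gives to \<open>C\<close>.\<close>
    proof (intro exI[of _ "w(C := w C + m)"] conjI allI ballI)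
      fix e assume e: "e \<in> E"
      have "(\<Sum>D\<in>cycles src tgt E. (w(C := w C + m)) D * real (count_list D e))
         = (\<Sum>D\<in>cycles src tgt E. w D * real (count_list D e) + (if D = C then m * real (count_list C e) else 0))"
        by (intro sum.cong) (auto simp: algebra_simps)
      also have "\<dots> = g' e + m * real (count_list C e)"
        using w(2) e cyc finite_cycles[OF assms(1), of src tgt] by (simp add: sum.distrib)
      finally show "g e = (\<Sum>D\<in>cycles src tgt E. (w(C := w C + m)) D * real (count_list D e))"
        by (simp add: g'_def)
    qed (use w m0 in \<open>auto intro: add_nonneg_nonneg less_imp_le\<close>)
  qed
qed

subsection \<open>The cyclic edit graph\<close>

abbreviation twalk :: "'a list \<Rightarrow> 'a list \<Rightarrow> nat \<times> nat \<Rightarrow> edge list \<Rightarrow> nat \<times> nat \<Rightarrow> bool" where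
  "twalk u v \<equiv> gwalk (esrc u v) (etgt u v) (cedges u v)"

fun eop :: "'a list \<Rightarrow> 'a list \<Rightarrow> edge \<Rightarrow> 'a option \<times> 'a option" where
  "eop u v (Del, l, k) = (Some (u ! l), None)"
| "eop u v (Ins, l, k) = (None, Some (v ! k))"
| "eop u v (Dia, l, k) = (Some (u ! l), Some (v ! k))"

lemma finite_cedges: "finite (cedges u v)"
proof -
  have "cedges u v \<subseteq> {Del, Ins, Dia} \<times> {..length u} \<times> {..length v}"
    by (auto simp: cedges_def)
  then show ?thesis by (rule finite_subset) auto
qed

lemma ekind_cases: "fst e = Del \<or> fst e = Ins \<or> fst e = Dia" for e :: edge
  by (cases "fst e") auto

lemma ecost_bounds: "0 \<le> ecost u v e" "ecost u v e \<le> 1" "1 - indx e \<le> ecost u v e"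
  by (cases "(u, v, e)" rule: ecost.cases; simp add: indx_def)+

lemma ind_bounds: "0 \<le> indx e" "indx e \<le> 1" "0 \<le> indy e" "indy e \<le> 1" "1 \<le> indx e + indy e"
  using ekind_cases[of e] by (auto simp: indx_def indy_def)

text \<open>Every linear functional of the LP is an instance: \<open>h\<close> is the constant 1,
  \<open>indx\<close>, \<open>indy\<close> or \<open>ecost u v\<close>.\<close>

definition wsum :: "'a list \<Rightarrow> 'a list \<Rightarrow> (edge \<Rightarrow> real) \<Rightarrow> (edge \<Rightarrow> real) \<Rightarrow> real" where
  "wsum u v h g = (\<Sum>e\<in>cedges u v. g e * h e)"

definition circ :: "'a list \<Rightarrow> 'a list \<Rightarrow> (edge \<Rightarrow> real) \<Rightarrow> bool" where
  "circ u v g \<longleftrightarrow> (\<forall>e\<in>cedges u v. 0 \<le> g e) \<and> (\<forall>w\<in>cverts u v.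
        (\<Sum>e\<in>{e\<in>cedges u v. esrc u v e = w}. g e) = (\<Sum>e\<in>{e\<in>cedges u v. etgt u v e = w}. g e))"

lemma wsum_count: "set C \<subseteq> cedges u v \<Longrightarrow> wsum u v h (\<lambda>e. real (count_list C e)) = sum_list (map h C)"
  unfolding wsum_def by (rule sum_count_list[OF finite_cedges])

lemma wsum_scale: "wsum u v h (\<lambda>e. c * g e) = c * wsum u v h g"
  by (simp add: wsum_def sum_distrib_left mult.assoc)

lemma wsum_divide: "wsum u v h (\<lambda>e. g e / c) = wsum u v h g / c"
  by (simp add: wsum_def sum_divide_distrib)

lemma wsum_add: "wsum u v h (\<lambda>e. g e + g' e) = wsum u v h g + wsum u v h g'"
  by (simp add: wsum_def algebra_simps sum.distrib)

lemma wsum_zero: "wsum u v h (\<lambda>e. 0) = 0"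
  by (simp add: wsum_def)

lemma wsum_cong: "(\<And>e. e \<in> cedges u v \<Longrightarrow> g e = g' e) \<Longrightarrow> wsum u v h g = wsum u v h g'"
  by (simp add: wsum_def)

lemma circ_scale: "circ u v g \<Longrightarrow> 0 \<le> c \<Longrightarrow> circ u v (\<lambda>e. c * g e)"
  by (auto simp: circ_def simp flip: sum_distrib_left)

lemma circ_closed_walk: "twalk u v s C s \<Longrightarrow> circ u v (\<lambda>e. real (count_list C e))"
  by (auto simp: circ_def gwalk_closed_balanced finite_cedges)

lemma wgt_eop: "set C \<subseteq> cedges u v \<Longrightarrow> real (wgt (map (eop u v) C)) = sum_list (map (ecost u v) C)"
proof (induction C)
  case (Cons e C)
  then show ?case by (cases "(u, v, e)" rule: eop.cases) (auto simp: cedges_def)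
qed simp

section \<open>Words read along walks, and walks that read given words\<close>

definition lword :: "('a option \<times> 'a option) list \<Rightarrow> 'a list" where
  "lword p = concat (map (ostr \<circ> fst) p)"
definition rword :: "('a option \<times> 'a option) list \<Rightarrow> 'a list" where
  "rword p = concat (map (ostr \<circ> snd) p)"

lemma lword_simps [simp]: "lword [] = []" "lword (e # p) = ostr (fst e) @ lword p" "lword (p @ q) = lword p @ lword q"
  and rword_simps [simp]: "rword [] = []" "rword (e # p) = ostr (snd e) @ rword p" "rword (p @ q) = rword p @ rword q"
  by (simp_all add: lword_def rword_def)

lemma edit_path_words_iff:
  "edit_path p x y \<longleftrightarrow> (\<forall>e\<in>set p. e \<noteq> (None, None)) \<and> lword p = x \<and> rword p = y"
  by (simp add: edit_path_def lword_def rword_def)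

lemma eop_nontrivial: "eop u v e \<noteq> (None, None)"
  by (cases "(u, v, e)" rule: eop.cases) auto

lemma length_lword_eop: "real (length (lword (map (eop u v) C))) = sum_list (map indx C)"
proof (induction C)
  case (Cons e C)
  then show ?case by (cases "(u, v, e)" rule: eop.cases) (auto simp: indx_def)
qed simp

lemma length_rword_eop: "real (length (rword (map (eop u v) C))) = sum_list (map indy C)"
proof (induction C)
  case (Cons e C)
  then show ?case by (cases "(u, v, e)" rule: eop.cases) (auto simp: indy_def)
qed simp

text \<open>Either the step stays inside a copy of \<open>u\<close>, or it crosses the seam, where
  the position resets to 0 and one more full copy is counted.\<close>

lemma take_cyclic_step:
  assumes "l < length u" "\<exists>A. take (Suc l mod length u) u @ R = pw u A @ T"
  shows "\<exists>A. take l u @ (u ! l) # R = pw u A @ T"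
proof -
  obtain A where A: "take (Suc l mod length u) u @ R = pw u A @ T" using assms by blast
  have *: "take l u @ (u ! l) # R = take (Suc l) u @ R" using assms(1) by (simp add: take_Suc_conv_app_nth)
  show ?thesis
  proof (cases "Suc l = length u")
    case True
    then have "take l u @ (u ! l) # R = pw u (Suc A) @ T" using A * by simp
    then show ?thesis by blast
  next
    case False
    then show ?thesis using A * assms(1) by (auto simp: less_Suc_eq)
  qed
qed

text \<open>The walk may start inside a copy of \<open>u\<close>; prepending
  \<open>take (fst s) u\<close> aligns the word read with full copies, up to an unfinished one at
  the end. For a closed walk this makes the word a conjugate of a power.\<close>

lemma twalk_words:
  assumes "twalk u v s C t" "s \<in> cverts u v" "u \<noteq> []" "v \<noteq> []"
  shows "\<exists>A. take (fst s) u @ lword (map (eop u v) C) = pw u A @ take (fst t) u"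
    and "\<exists>A. take (snd s) v @ rword (map (eop u v) C) = pw v A @ take (snd t) v"
proof -
  have "(\<exists>A. take (fst s) u @ lword (map (eop u v) C) = pw u A @ take (fst t) u) \<and>
     (\<exists>A. take (snd s) v @ rword (map (eop u v) C) = pw v A @ take (snd t) v)"
    using assms(1,2)
  proof (induction C arbitrary: s)
    case Nil
    then show ?case by (auto intro!: exI[of _ 0])
  next
    case (Cons e C)
    have lens: "0 < length u" "0 < length v" using assms by auto
    have t: "etgt u v e \<in> cverts u v"
      using lens by (cases "(u, v, e)" rule: etgt.cases) (auto simp: cverts_def cvert_def)
    have e: "e \<in> cedges u v" "esrc u v e = s" using Cons.prems by auto
    have IH: "\<exists>A. take (fst (etgt u v e)) u @ lword (map (eop u v) C) = pw u A @ take (fst t) u"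
      "\<exists>A. take (snd (etgt u v e)) v @ rword (map (eop u v) C) = pw v A @ take (snd t) v"
      using Cons.IH[OF _ t] Cons.prems(1) unfolding gwalk.simps by blast+
    consider l k where "e = (Del, l, k)" "l < length u" "k \<le> length v"
      | l k where "e = (Ins, l, k)" "l \<le> length u" "k < length v"
      | l k where "e = (Dia, l, k)" "l < length u" "k < length v"
      using e(1) by (auto simp: cedges_def)
    then show ?case
    proof cases
      case 1
      have "\<exists>A. take (Suc l mod length u) u @ lword (map (eop u v) C) = pw u A @ take (fst t) u"
        using IH(1) 1 by (simp add: cvert_def)
      from take_cyclic_step[OF 1(2) this] IH(2) show ?thesis using 1 e by (auto simp: cvert_def)
    next
      case 2
      have "\<exists>A. take (Suc k mod length v) v @ rword (map (eop u v) C) = pw v A @ take (snd t) v"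
        using IH(2) 2 by (simp add: cvert_def)
      from take_cyclic_step[OF 2(3) this] IH(1) show ?thesis using 2 e by (auto simp: cvert_def)
    next
      case 3
      have "\<exists>A. take (Suc l mod length u) u @ lword (map (eop u v) C) = pw u A @ take (fst t) u"
        "\<exists>A. take (Suc k mod length v) v @ rword (map (eop u v) C) = pw v A @ take (snd t) v"
        using IH 3 by (simp_all add: cvert_def)
      from take_cyclic_step[OF 3(2) this(1)] take_cyclic_step[OF 3(3) this(2)]
      show ?thesis using 3 e by (auto simp: cvert_def)
    qed
  qed
  then show "\<exists>A. take (fst s) u @ lword (map (eop u v) C) = pw u A @ take (fst t) u"
    "\<exists>A. take (snd s) v @ rword (map (eop u v) C) = pw v A @ take (snd t) v" by auto
qed

text \<open>Being a factor of some power of \<open>u\<close>, without naming the exponent: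
  \<open>w\<close> is read cyclically from position \<open>l\<close>.\<close>

definition factor_at :: "'a list \<Rightarrow> nat \<Rightarrow> 'a list \<Rightarrow> bool" where
  "factor_at u l w \<longleftrightarrow> (\<forall>t<length w. w ! t = u ! ((l + t) mod length u))"

lemma factor_at_Cons:
  assumes "factor_at u l (a # w)" "l < length u"
  shows "a = u ! l" "factor_at u (Suc l mod length u) w"
proof -
  show "a = u ! l" using assms unfolding factor_at_def by (metis add_0_right length_greater_0_conv list.distinct(1) mod_less nth_Cons_0)
  show "factor_at u (Suc l mod length u) w"
    unfolding factor_at_def
  proof (intro allI impI)
    fix t assume "t < length w"
    then have "(a # w) ! Suc t = u ! ((l + Suc t) mod length u)"
      using assms(1) unfolding factor_at_def by auto
    then show "w ! t = u ! ((Suc l mod length u + t) mod length u)"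
      by (simp add: mod_add_left_eq)
  qed
qed

text \<open>Converse of \<open>twalk_words\<close>: the entries of \<open>p\<close> dictate the
  edges, since both words agree with the cyclic reading from \<open>s\<close>. Positions are reduced
  after every step, so only edges at canonical representatives are used.\<close>

lemma twalk_exists:
  assumes "edit_path p X Y" "factor_at u (fst s) X" "factor_at v (snd s) Y" "s \<in> cverts u v"
  shows "\<exists>C. twalk u v s C ((fst s + length X) mod length u, (snd s + length Y) mod length v)
     \<and> map (eop u v) C = p"
  using assms
proof (induction p arbitrary: X Y s)
  case Nil
  then show ?case by (auto simp: cverts_def)
next
  case (Cons e p)
  obtain l k where s: "s = (l, k)" "l < length u" "k < length v"
    using Cons.prems(4) by (auto simp: cverts_def)
  obtain X' Y' where XY: "X = ostr (fst e) @ X'" "Y = ostr (snd e) @ Y'" "edit_path p X' Y'"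
    "e \<noteq> (None, None)" using Cons.prems(1) by (auto simp: edit_path_Cons)
  have [simp]: "Suc l mod length u < length u" "Suc k mod length v < length v"
    by (rule mod_less_divisor, use s in linarith)+
  have md: "(Suc l mod length u + c) mod length u = (Suc (l + c)) mod length u"
     "(Suc k mod length v + c) mod length v = (Suc (k + c)) mod length v" for c
    by (simp_all add: mod_add_left_eq)
  consider a where "e = (Some a, None)" | b where "e = (None, Some b)" | a b where "e = (Some a, Some b)"
    using XY(4) by (cases e) (metis not_Some_eq)
  then show ?case
  proof cases
    case 1
    then have "factor_at u l (a # X')" using Cons.prems(2) XY s by auto
    note f = factor_at_Cons[OF this s(2)]
    obtain C where "twalk u v (Suc l mod length u, k)
       C ((Suc l mod length u + length X') mod length u, (k + length Y') mod length v)" "map (eop u v) C = p"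
      using Cons.IH[OF XY(3), of "(Suc l mod length u, k)"] f 1 XY Cons.prems(3) s by (auto simp: cverts_def)
    then show ?thesis using 1 XY s f
      by (intro exI[of _ "(Del, l, k) # C"]) (auto simp: cedges_def cvert_def md)
  next
    case 2
    then have "factor_at v k (b # Y')" using Cons.prems(3) XY s by auto
    note f = factor_at_Cons[OF this s(3)]
    obtain C where "twalk u v (l, Suc k mod length v)
       C ((l + length X') mod length u, (Suc k mod length v + length Y') mod length v)" "map (eop u v) C = p"
      using Cons.IH[OF XY(3), of "(l, Suc k mod length v)"] f 2 XY Cons.prems(2) s by (auto simp: cverts_def)
    then show ?thesis using 2 XY s f
      by (intro exI[of _ "(Ins, l, k) # C"]) (auto simp: cedges_def cvert_def md)
  next
    case 3
    then have "factor_at u l (a # X')" "factor_at v k (b # Y')" using Cons.prems(2,3) XY s by auto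
    note f = factor_at_Cons[OF this(1) s(2)] factor_at_Cons[OF this(2) s(3)]
    obtain C where "twalk u v (Suc l mod length u, Suc k mod length v)
       C ((Suc l mod length u + length X') mod length u, (Suc k mod length v + length Y') mod length v)" "map (eop u v) C = p"
      using Cons.IH[OF XY(3), of "(Suc l mod length u, Suc k mod length v)"] f 3 XY s by (auto simp: cverts_def)
    then show ?thesis using 3 XY s f
      by (intro exI[of _ "(Dia, l, k) # C"]) (auto simp: cedges_def cvert_def md)
  qed
qed

text \<open>Deletions reach the target position in \<open>u\<close>, insertions the one in
  \<open>v\<close>.\<close>

lemma twalk_connect:
  assumes "s \<in> cverts u v" "t \<in> cverts u v"
  shows "\<exists>C. twalk u v s C t \<and> length C \<le> 2 * length u + 2 * length v
    \<and> sum_list (map indx C) \<le> 2 * length u \<and> sum_list (map indy C) \<le> 2 * length v"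
proof -
  \<comment> \<open>Always going through the seam avoids comparing \<open>fst s\<close> with
    \<open>fst t\<close>, and stays within two turns.\<close>
  define X where "X = map (\<lambda>i. u ! ((fst s + i) mod length u)) [0..<length u - fst s + fst t]"
  define Y where "Y = map (\<lambda>i. v ! ((snd s + i) mod length v)) [0..<length v - snd s + snd t]"
  have st: "fst s < length u" "fst t < length u" "snd s < length v" "snd t < length v"
    using assms by (auto simp: cverts_def)
  have "edit_path (dels X @ inss Y) X Y" using edit_path_append[OF dels(1)[of X] inss(1)[of Y]] by simp
  moreover have "factor_at u (fst s) X" "factor_at v (snd s) Y"
    by (auto simp: factor_at_def X_def Y_def)
  ultimately obtain C where C: "twalk u v s C ((fst s + length X) mod length u, (snd s + length Y) mod length v)"
     "map (eop u v) C = dels X @ inss Y" using twalk_exists assms by blast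
  have XYl: "fst s + length X = length u + fst t" "snd s + length Y = length v + snd t"
    using st by (simp_all add: X_def Y_def)
  then have "(fst s + length X) mod length u = fst t" "(snd s + length Y) mod length v = snd t"
    using st by simp_all
  then have "twalk u v s C t" using C by simp
  moreover have "lword (map (eop u v) C) = X" "rword (map (eop u v) C) = Y"
    using C(2) \<open>edit_path (dels X @ inss Y) X Y\<close> by (auto simp: edit_path_words_iff)
  then have "sum_list (map indx C) = length X" "sum_list (map indy C) = length Y"
    using length_lword_eop[of u v C] length_rword_eop[of u v C] by simp_all
  moreover have "length C = length X + length Y"
    using arg_cong[OF C(2), of length] by (simp add: dels inss)
  moreover have "length X \<le> 2 * length u" "length Y \<le> 2 * length v" using XYl st by linarith+
  ultimately show ?thesis by (intro exI[of _ C]) simp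
qed

text \<open>The walk of \<open>p\<close> is closed by a connecting walk, whose length accounts for
  \<open>K\<close>. Closing only adds edges, so the lower bounds carry no error.\<close>

lemma edit_path_circ:
  fixes K :: real
  assumes "edit_path p X Y" "factor_at u l X" "factor_at v k Y" "u \<noteq> []" "v \<noteq> []"
    and K: "K = 2 * real (length u) + 2 * real (length v)"
  shows "\<exists>g. circ u v g \<and> length p \<le> wsum u v (\<lambda>_. 1) g \<and> wsum u v (\<lambda>_. 1) g \<le> length p + K
    \<and> wsum u v (ecost u v) g \<le> wgt p + K
    \<and> length X \<le> wsum u v indx g \<and> wsum u v indx g \<le> length X + K
    \<and> length Y \<le> wsum u v indy g \<and> wsum u v indy g \<le> length Y + K"
proof -
  define s where "s = (l mod length u, k mod length v)"
  have s: "s \<in> cverts u v" using assms by (auto simp: s_def cverts_def)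
  have "factor_at u (fst s) X" "factor_at v (snd s) Y"
    using assms(2,3) by (simp_all add: factor_at_def s_def mod_add_left_eq)
  then obtain C where C: "twalk u v s C ((fst s + length X) mod length u, (snd s + length Y) mod length v)"
     "map (eop u v) C = p" using twalk_exists[OF assms(1) _ _ s] by blast
  let ?t = "((fst s + length X) mod length u, (snd s + length Y) mod length v)"
  have t: "?t \<in> cverts u v" using assms by (auto simp: cverts_def)
  obtain D where D: "twalk u v ?t D s" "length D \<le> 2 * length u + 2 * length v"
     "sum_list (map indx D) \<le> 2 * length u" "sum_list (map indy D) \<le> 2 * length v"
    using twalk_connect[OF t s] by blast
  have CD: "twalk u v s (C @ D) s" using gwalk_append[OF C(1) D(1)] .
  have sets: "set C \<subseteq> cedges u v" "set D \<subseteq> cedges u v" using gwalk_set[OF C(1)] gwalk_set[OF D(1)] by simp_all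
  then have ws: "wsum u v h (\<lambda>e. real (count_list (C @ D) e)) = sum_list (map h C) + sum_list (map h D)" for h
    using wsum_count[of "C @ D" u v h] by simp
  have nn: "0 \<le> sum_list (map indx D)" "0 \<le> sum_list (map indy D)"
    by (auto intro!: sum_list_nonneg simp: ind_bounds)
  have "lword (map (eop u v) C) = X" "rword (map (eop u v) C) = Y"
    using C(2) assms(1) by (simp_all add: edit_path_words_iff)
  then have XY: "sum_list (map indx C) = length X" "sum_list (map indy C) = length Y"
    using length_lword_eop[of u v C] length_rword_eop[of u v C] by simp_all
  have len: "length C = length p" using arg_cong[OF C(2), of length] by simp
  have "sum_list (map (ecost u v) D) \<le> sum_list (map (\<lambda>_. 1) D)"
    by (intro sum_list_mono) (simp add: ecost_bounds)
  then have cD: "sum_list (map (ecost u v) D) \<le> length D" by (simp add: sum_list_triv)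
  have cC: "sum_list (map (ecost u v) C) = wgt p" using wgt_eop[OF sets(1)] C(2) by simp
  have one: "sum_list (map (\<lambda>_. 1::real) C) = length C" "sum_list (map (\<lambda>_. 1::real) D) = length D"
    by (simp_all add: sum_list_triv)
  let ?g = "\<lambda>e. real (count_list (C @ D) e)"
  have "wsum u v (\<lambda>_. 1) ?g = length p + real (length D)" unfolding ws one len ..
  moreover have "wsum u v (ecost u v) ?g = wgt p + sum_list (map (ecost u v) D)" unfolding ws cC ..
  moreover have "wsum u v indx ?g = length X + sum_list (map indx D)"
    "wsum u v indy ?g = length Y + sum_list (map indy D)" unfolding ws XY by (rule refl)+
  moreover have "real (length D) \<le> K" using D(2) unfolding K by linarith
  moreover have "sum_list (map indx D) \<le> K" "sum_list (map indy D) \<le> K" using D(3,4) unfolding K by linarith+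
  ultimately show ?thesis using circ_closed_walk[OF CD] nn cD
    by (intro exI[of _ ?g] conjI) linarith+
qed

subsection \<open>Rounding a circulation to an edit path\<close>

text \<open>The consumption of \<open>u\<close> and \<open>v\<close> that the path does not account for is to be filled with
  deletions and insertions later; it therefore counts towards both weight and length.\<close>

definition approx :: "'a list \<Rightarrow> 'a list \<Rightarrow> real \<Rightarrow> (edge \<Rightarrow> real) \<Rightarrow> bool" where
  "approx u v K g \<longleftrightarrow> (\<exists>\<alpha> \<beta> p. edit_path p (pw u \<alpha>) (pw v \<beta>)
     \<and> real (\<alpha> * length u) \<le> wsum u v indx g \<and> real (\<beta> * length v) \<le> wsum u v indy g
     \<and> wgt p + (wsum u v indx g - real (\<alpha> * length u)) + (wsum u v indy g - real (\<beta> * length v))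
         \<le> wsum u v (ecost u v) g + K
     \<and> wsum u v (\<lambda>_. 1) g \<le> length p + (wsum u v indx g - real (\<alpha> * length u))
         + (wsum u v indy g - real (\<beta> * length v)) + K)"

lemma approx_zero: "approx u v 0 (\<lambda>_. 0)"
  unfolding approx_def wsum_zero by (intro exI[of _ 0] exI[of _ "[]"]) simp

lemma approx_add:
  assumes "approx u v K g" "approx u v K' g'"
  shows "approx u v (K + K') (\<lambda>e. g e + g' e)"
proof -
  obtain \<alpha> \<beta> p where 1: "edit_path p (pw u \<alpha>) (pw v \<beta>)"
     "real (\<alpha> * length u) \<le> wsum u v indx g" "real (\<beta> * length v) \<le> wsum u v indy g"
     "wgt p + (wsum u v indx g - real (\<alpha> * length u)) + (wsum u v indy g - real (\<beta> * length v))
         \<le> wsum u v (ecost u v) g + K"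
     "wsum u v (\<lambda>_. 1) g \<le> length p + (wsum u v indx g - real (\<alpha> * length u))
         + (wsum u v indy g - real (\<beta> * length v)) + K"
    using assms(1) unfolding approx_def by blast
  obtain \<alpha>' \<beta>' p' where 2: "edit_path p' (pw u \<alpha>') (pw v \<beta>')"
     "real (\<alpha>' * length u) \<le> wsum u v indx g'" "real (\<beta>' * length v) \<le> wsum u v indy g'"
     "wgt p' + (wsum u v indx g' - real (\<alpha>' * length u)) + (wsum u v indy g' - real (\<beta>' * length v))
         \<le> wsum u v (ecost u v) g' + K'"
     "wsum u v (\<lambda>_. 1) g' \<le> length p' + (wsum u v indx g' - real (\<alpha>' * length u))
         + (wsum u v indy g' - real (\<beta>' * length v)) + K'"
    using assms(2) unfolding approx_def by blast
  have "edit_path (p @ p') (pw u (\<alpha> + \<alpha>')) (pw v (\<beta> + \<beta>'))"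
    using edit_path_append[OF 1(1) 2(1)] by (simp add: pw_add)
  moreover have "real ((\<alpha> + \<alpha>') * length u) = real (\<alpha> * length u) + real (\<alpha>' * length u)"
    "real ((\<beta> + \<beta>') * length v) = real (\<beta> * length v) + real (\<beta>' * length v)"
    "real (wgt (p @ p')) = wgt p + wgt p'" "real (length (p @ p')) = length p + length p'"
    by (simp_all add: algebra_simps)
  ultimately show ?thesis using 1(2-) 2(2-) unfolding approx_def wsum_add
    by (intro exI[of _ "\<alpha> + \<alpha>'"] exI[of _ "\<beta> + \<beta>'"] exI[of _ "p @ p'"] conjI) linarith+
qed

lemma approx_sum:
  assumes "finite S" "\<And>C. C \<in> S \<Longrightarrow> approx u v (K C) (g C)"
  shows "approx u v (\<Sum>C\<in>S. K C) (\<lambda>e. \<Sum>C\<in>S. g C e)"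
  using assms by (induction S) (auto intro: approx_zero approx_add)

text \<open>The prefix that conjugates the word of a closed walk to a power of \<open>u\<close>
  serves all repetitions of the walk.\<close>

lemma take_power_conjugate:
  assumes "take l u @ X = pw u A @ take l u"
  shows "take l u @ pw X m = pw u (A * m) @ take l u"
proof (induction m)
  case (Suc m)
  have "take l u @ pw X (Suc m) = (take l u @ X) @ pw X m" by simp
  also have "\<dots> = pw u A @ (take l u @ pw X m)" unfolding assms by simp
  also have "\<dots> = pw u (A * Suc m) @ take l u" unfolding Suc by (simp add: pw_add)
  finally show ?case .
qed simp

lemma edit_path_power: "edit_path p x y \<Longrightarrow> edit_path (pw p m) (pw x m) (pw y m)"
  by (induction m) (auto intro: edit_path_append)

lemma wgt_power: "wgt (pw p m) = m * wgt p"
  by (induction m) auto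

text \<open>A cycle through \<open>(l, k)\<close> reads rotated words, so its repetitions are framed
  by the missing pieces of one extra copy of \<open>u\<close> and of \<open>v\<close>. Frame and
  rounding cost at most two repetitions; each is worth \<open>ix + iy\<close>, at most
  \<open>2 * length C\<close>, whence the constant.\<close>

lemma approx_cycle:
  assumes C: "C \<in> cycles (esrc u v) (etgt u v) (cedges u v)" and "u \<noteq> []" "v \<noteq> []" and w: "0 \<le> w"
  shows "approx u v (4 * length C) (\<lambda>e. w * real (count_list C e))"
proof -
  obtain s where s: "twalk u v s C s" using C by (auto simp: cycles_def)
  have sub: "set C \<subseteq> cedges u v" using gwalk_set[OF s] .
  define ix iy co where "ix = sum_list (map indx C)" and "iy = sum_list (map indy C)"
    and "co = sum_list (map (ecost u v) C)"
  have ws: "wsum u v indx (\<lambda>e. w * real (count_list C e)) = w * ix"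
    "wsum u v indy (\<lambda>e. w * real (count_list C e)) = w * iy"
    "wsum u v (ecost u v) (\<lambda>e. w * real (count_list C e)) = w * co"
    "wsum u v (\<lambda>_. 1) (\<lambda>e. w * real (count_list C e)) = w * length C"
    unfolding wsum_scale wsum_count[OF sub] ix_def iy_def co_def by (simp_all add: sum_list_triv)
  \<comment> \<open>The last two bounds hold edge by edge, since an edge that advances on one side
    only costs 1. They make a cycle with \<open>ix = 0\<close> or \<open>iy = 0\<close> cost at
    least as much as the filler that replaces it.\<close>
  have pt: "0 \<le> ix \<and> 0 \<le> iy \<and> 0 \<le> co \<and> ix \<le> length C \<and> iy \<le> length C \<and> length C \<le> ix + iy
     \<and> iy \<le> co + ix \<and> ix \<le> co + iy"
    unfolding ix_def iy_def co_def
  proof (induction C)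
    case (Cons e C)
    have "indx e \<le> ecost u v e + indy e"
      by (cases "(u, v, e)" rule: eop.cases) (auto simp: indx_def indy_def)
    then show ?case using Cons ind_bounds[of e] ecost_bounds[where u = u and v = v and e = e] by (simp; linarith)
  qed simp
  \<comment> \<open>The empty path, with all consumption left to the filler; acceptable as long as
    this overpays by at most the error.\<close>
  have triv: ?thesis if "w * ix + w * iy \<le> w * co + 4 * length C"
  proof -
    have "w * length C \<le> w * (ix + iy)" using pt w by (intro mult_left_mono) auto
    then show ?thesis using that pt w unfolding approx_def ws
      by (intro exI[of _ 0] exI[of _ "[]"]) (simp add: algebra_simps add_increasing2)
  qed
  consider "C = []" | "w < 1" | "ix = 0" | "iy = 0" | "C \<noteq> []" "1 \<le> w" "ix \<noteq> 0" "iy \<noteq> 0" by linarith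
  then show ?thesis
  proof cases
    case 1
    then show ?thesis by (intro triv) (simp add: ix_def iy_def co_def)
  next
    case 2
    have "w * ix \<le> 1 * real (length C)" "w * iy \<le> 1 * real (length C)" using pt 2 w by (intro mult_mono; auto)+
    moreover have "0 \<le> w * co" using pt w by simp
    ultimately show ?thesis by (intro triv) linarith
  next
    case 3
    have "w * iy \<le> w * co" using pt w 3 by (intro mult_left_mono) auto
    then show ?thesis using 3 by (intro triv) simp
  next
    case 4
    have "w * ix \<le> w * co" using pt w 4 by (intro mult_left_mono) auto
    then show ?thesis using 4 by (intro triv) simp
  next
    case 5
    have lens: "0 < length u" "0 < length v" using assms by auto
    obtain e0 C0 where "C = e0 # C0" using 5 by (cases C) auto
    then have "s = esrc u v e0" using s by auto
    then have sv: "s \<in> cverts u v" using lens by (cases e0) (auto simp: cverts_def cvert_def)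
    obtain l k where lk: "s = (l, k)" by (cases s)
    define P where "P = map (eop u v) C"
    obtain A where A: "take l u @ lword P = pw u A @ take l u"
      using twalk_words(1)[OF s sv assms(2,3)] lk by (auto simp: P_def)
    obtain B where B: "take k v @ rword P = pw v B @ take k v"
      using twalk_words(2)[OF s sv assms(2,3)] lk by (auto simp: P_def)
    have P: "edit_path P (lword P) (rword P)"
      unfolding edit_path_words_iff P_def set_map ball_simps using eop_nontrivial[of u v] by blast
    have lX: "real (length (lword P)) = ix" "real (length (rword P)) = iy"
      unfolding P_def ix_def iy_def by (rule length_lword_eop length_rword_eop)+
    have ixA: "ix = A * length u" using arg_cong[OF A, of length] lX by (simp add: length_pw)
    have iyB: "iy = B * length v" using arg_cong[OF B, of length] lX by (simp add: length_pw)
    have "A \<noteq> 0" "B \<noteq> 0" using 5 ixA iyB by auto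
    \<comment> \<open>One less than the floor of \<open>w\<close>: the frame uses a whole copy of
      \<open>u\<close> and of \<open>v\<close>, and as \<open>A\<close> and \<open>B\<close> are
      positive, one repetition provides for it.\<close>
    define m where "m = nat \<lfloor>w\<rfloor> - 1"
    have m: "real m + 1 \<le> w" "w \<le> real m + 2" using 5(2) unfolding m_def by linarith+
    \<comment> \<open>The prefixes lead from the corner to \<open>(l, k)\<close>, where the
      repetitions begin and end; the suffixes complete the open copies.\<close>
    define q where "q = dels (take l u) @ inss (take k v) @ pw P m @ dels (drop l u) @ inss (drop k v)"
    have "edit_path q (take l u @ [] @ pw (lword P) m @ drop l u @ []) ([] @ take k v @ pw (rword P) m @ [] @ drop k v)"
      unfolding q_def by (intro edit_path_append dels(1) inss(1) edit_path_power P)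
    also have "take l u @ [] @ pw (lword P) m @ drop l u @ [] = pw u (A * m + 1)"
      using take_power_conjugate[OF A, of m] unfolding pw_add by simp (metis append.assoc append_take_drop_id)
    also have "[] @ take k v @ pw (rword P) m @ [] @ drop k v = pw v (B * m + 1)"
      using take_power_conjugate[OF B, of m] unfolding pw_add by simp (metis append.assoc append_take_drop_id)
    finally have q: "edit_path q (pw u (A * m + 1)) (pw v (B * m + 1))" .
    have wq: "real (wgt q) = length u + length v + m * co"
      unfolding q_def using wgt_eop[OF sub] lk sv
      by (simp add: dels inss wgt_power P_def co_def cverts_def)
    have lq: "real (length q) = length u + length v + m * length C"
      unfolding q_def using lk sv by (simp add: dels inss length_pw P_def cverts_def)
    have a: "real ((A * m + 1) * length u) = m * ix + length u" "real ((B * m + 1) * length v) = m * iy + length v"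
      by (simp_all add: ixA iyB algebra_simps)
    have "length u \<le> ix" "length v \<le> iy" using \<open>A \<noteq> 0\<close> \<open>B \<noteq> 0\<close> ixA iyB
      by (simp_all flip: of_nat_mult)
    moreover have "(real m + 1) * ix \<le> w * ix" "(real m + 1) * iy \<le> w * iy" "real m * co \<le> w * co"
      using pt m by (auto intro!: mult_right_mono)
    moreover have "w * ix \<le> (real m + 2) * ix" "w * iy \<le> (real m + 2) * iy"
      using pt m by (auto intro!: mult_right_mono)
    moreover have "(w - m) * length C \<le> (w - m) * (ix + iy)" using pt m by (intro mult_left_mono) auto
    ultimately show ?thesis using q pt unfolding approx_def ws
      by (intro exI[of _ "A * m + 1"] exI[of _ "B * m + 1"] exI[of _ q] conjI)
         (simp_all only: wq lq a; simp add: algebra_simps)+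
  qed
qed

text \<open>Summing the error over all closed trails, whether or not the decomposition of
  \<open>g\<close> uses them, makes \<open>K\<close> depend on \<open>u\<close> and \<open>v\<close>
  only.\<close>

lemma circ_approx:
  assumes "u \<noteq> []" "v \<noteq> []"
  shows "\<exists>K\<ge>0. \<forall>g. circ u v g \<longrightarrow> approx u v K g"
proof -
  let ?Cy = "cycles (esrc u v) (etgt u v) (cedges u v)"
  define K :: real where "K = (\<Sum>C\<in>?Cy. 4 * length C)"
  have "approx u v K g" if g: "circ u v g" for g
  proof -
    have lens: "0 < length u" "0 < length v" using assms by auto
    \<comment> \<open>The decomposition asks for balance at every pair of numbers; outside
      \<open>cverts u v\<close> no edge starts or ends.\<close>
    have "(\<Sum>e\<in>{e\<in>cedges u v. esrc u v e = w}. g e) = (\<Sum>e\<in>{e\<in>cedges u v. etgt u v e = w}. g e)" for w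
    proof (cases "w \<in> cverts u v")
      case False
      have "esrc u v e \<in> cverts u v" "etgt u v e \<in> cverts u v" for e
        using lens by (cases "(u, v, e)" rule: etgt.cases; simp add: cverts_def cvert_def)+
      then have "{e\<in>cedges u v. esrc u v e = w} = {}" "{e\<in>cedges u v. etgt u v e = w} = {}" using False by auto
      then show ?thesis by (simp only: sum.empty)
    qed (use g in \<open>auto simp: circ_def\<close>)
    from circulation_decomposition[OF finite_cedges _ this] g obtain w where w: "\<forall>C. 0 \<le> w C"
      "\<forall>e\<in>cedges u v. g e = (\<Sum>C\<in>?Cy. w C * real (count_list C e))"
      unfolding circ_def by blast
    have "approx u v K (\<lambda>e. \<Sum>C\<in>?Cy. w C * real (count_list C e))"
      unfolding K_def of_nat_sum using w(1) assms
      by (intro approx_sum finite_cycles finite_cedges approx_cycle) auto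
    moreover have "wsum u v h g = wsum u v h (\<lambda>e. \<Sum>C\<in>?Cy. w C * real (count_list C e))" for h
      using w(2) by (intro wsum_cong) auto
    ultimately show ?thesis unfolding approx_def by simp
  qed
  moreover have "0 \<le> K" unfolding K_def by (simp add: sum_nonneg)
  ultimately show ?thesis by blast
qed

subsection \<open>Edit paths and lattice paths\<close>

text \<open>The list grows at the front while the end cell is fixed, matching a recursion that cuts
  off one cell at a time; the start is left open and read off with \<open>hd\<close>.\<close>

inductive latt :: "nat \<Rightarrow> nat \<Rightarrow> (nat \<times> nat) list \<Rightarrow> bool" for n m where
  latt_end: "latt n m [(n, m)]"
| latt_row: "latt n m ((Suc i, j) # L) \<Longrightarrow> latt n m ((i, j) # (Suc i, j) # L)"
| latt_col: "latt n m ((i, Suc j) # L) \<Longrightarrow> latt n m ((i, j) # (i, Suc j) # L)"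

lemma latt_iff_steps:
  "latt n m L \<longleftrightarrow> L \<noteq> [] \<and> last L = (n, m) \<and> (\<forall>t. Suc t < length L \<longrightarrow>
        L ! Suc t = (Suc (fst (L ! t)), snd (L ! t)) \<or> L ! Suc t = (fst (L ! t), Suc (snd (L ! t))))"
  (is "_ \<longleftrightarrow> _ \<and> _ \<and> (\<forall>t. ?step L t)")
proof (induction L)
  case Nil
  then show ?case by (auto elim: latt.cases)
next
  case (Cons c L)
  show ?case
  proof (cases L)
    case Nil
    then show ?thesis by (auto elim: latt.cases intro: latt_end)
  next
    case (Cons d L')
    have "(\<forall>t. ?step (c # L) t) \<longleftrightarrow> ?step (c # L) 0 \<and> (\<forall>t. ?step (c # L) (Suc t))"
      by (metis old.nat.exhaust)
    also have "(\<forall>t. ?step (c # L) (Suc t)) \<longleftrightarrow> (\<forall>t. ?step L t)" by simp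
    finally have *: "(\<forall>t. ?step (c # L) t) \<longleftrightarrow>
       (d = (Suc (fst c), snd c) \<or> d = (fst c, Suc (snd c))) \<and> (\<forall>t. ?step L t)"
      using Cons by simp
    have "latt n m (c # L) \<longleftrightarrow> (d = (Suc (fst c), snd c) \<or> d = (fst c, Suc (snd c))) \<and> latt n m L"
    proof
      assume "latt n m (c # L)"
      then show "(d = (Suc (fst c), snd c) \<or> d = (fst c, Suc (snd c))) \<and> latt n m L"
        by cases (use Cons in auto)
    next
      assume "(d = (Suc (fst c), snd c) \<or> d = (fst c, Suc (snd c))) \<and> latt n m L"
      then show "latt n m (c # L)" using Cons latt_row[of n m "fst c" "snd c" L'] latt_col[of n m "fst c" "snd c" L'] by auto
    qed
    moreover have l: "last (c # L) = last L" "L \<noteq> []" using Cons by auto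
    ultimately show ?thesis unfolding Cons.IH * by (simp only: l) blast
  qed
qed

lemma lpath_iff_latt:
  "0 < n \<Longrightarrow> 0 < m \<Longrightarrow> lpath n m L \<longleftrightarrow> latt (n - 1) (m - 1) L \<and> hd L = (0, 0)"
  unfolding lpath_def latt_iff_steps by blast

lemma latt_swap: "latt n m L \<Longrightarrow> latt m n (map prod.swap L)"
  by (induction rule: latt.induct) (auto intro: latt.intros)

lemma latt_bounds:
  assumes "latt n m L" "(i, j) \<in> set L"
  shows "fst (hd L) \<le> i" "i \<le> n" "snd (hd L) \<le> j" "j \<le> m"
proof -
  have "\<forall>c\<in>set L. fst (hd L) \<le> fst c \<and> fst c \<le> n \<and> snd (hd L) \<le> snd c \<and> snd c \<le> m"
    using assms(1) by (induction rule: latt.induct) auto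
  with assms(2) show "fst (hd L) \<le> i" "i \<le> n" "snd (hd L) \<le> j" "j \<le> m" by auto
qed

lemma latt_distinct: "latt n m L \<Longrightarrow> distinct L"
  by (induction rule: latt.induct) (auto dest: latt_bounds)

lemma latt_row_nonempty: "latt n m L \<Longrightarrow> fst (hd L) \<le> i \<Longrightarrow> i \<le> n \<Longrightarrow> \<exists>j. (i, j) \<in> set L"
proof (induction rule: latt.induct)
  case (latt_row i' j L)
  then show ?case by (cases "i = i'") auto
qed auto

lemma finite_row: "finite S \<Longrightarrow> finite {j. (i, j) \<in> S}"
  by (rule finite_subset[of _ "snd ` S"]) force+

lemma latt_row_Cons_row:
  assumes "latt n m ((Suc i, j) # L)"
  shows "{j'. (i, j') \<in> set ((i, j) # (Suc i, j) # L)} = {j}"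
  using latt_bounds[OF assms] by fastforce

lemma latt_row_Cons_col:
  assumes "latt n m ((i, Suc j) # L)"
  shows "{j'. (i, j') \<in> set ((i, j) # (i, Suc j) # L)} = insert j {j'. (i, j') \<in> set ((i, Suc j) # L)}"
    "j \<notin> {j'. (i, j') \<in> set ((i, Suc j) # L)}"
  using latt_bounds[OF assms] by fastforce+

text \<open>A lattice path visits the cells of a row consecutively, so powers of the same word are
  adjacent and their exponents add up.\<close>

lemma latt_concat_rows:
  assumes "latt n m L"
  shows "concat (map (\<lambda>c. pw (x (fst c)) (\<alpha> c)) L)
    = concat (map (\<lambda>i. pw (x i) (\<Sum>j\<in>{j. (i, j) \<in> set L}. \<alpha> (i, j))) [fst (hd L)..<Suc n])"
  using assms
proof (induction rule: latt.induct)
  case latt_end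
  have "{j. (n, j) \<in> set [(n, m)]} = {m}" by auto
  then show ?case by simp
next
  case (latt_row i j L)
  let ?L = "(Suc i, j) # L"
  have "i \<le> n" using latt_bounds(1,2)[OF latt_row.hyps, of "Suc i" j] by simp
  then have up: "[i..<Suc n] = i # [Suc i..<Suc n]" by (simp add: upt_conv_Cons del: upt_Suc)
  have "{j'. (i', j') \<in> set ((i, j) # ?L)} = {j'. (i', j') \<in> set ?L}" if "i' \<in> set [Suc i..<Suc n]" for i'
    using that by auto
  then have "map (\<lambda>i'. pw (x i') (\<Sum>j'\<in>{j'. (i', j') \<in> set ((i, j) # ?L)}. \<alpha> (i', j'))) [Suc i..<Suc n]
    = map (\<lambda>i'. pw (x i') (\<Sum>j'\<in>{j'. (i', j') \<in> set ?L}. \<alpha> (i', j'))) [Suc i..<Suc n]"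
    by (intro map_cong) (auto simp del: upt_Suc)
  moreover have "(\<Sum>j'\<in>{j'. (i, j') \<in> set ((i, j) # ?L)}. \<alpha> (i, j')) = \<alpha> (i, j)"
    unfolding latt_row_Cons_row[OF latt_row.hyps] by simp
  ultimately show ?case using latt_row.IH
    by (simp only: list.map concat.simps list.sel fst_conv up)
next
  case (latt_col i j L)
  let ?L = "(i, Suc j) # L"
  have "i \<le> n" using latt_bounds(1,2)[OF latt_col.hyps, of i "Suc j"] by simp
  then have up: "[i..<Suc n] = i # [Suc i..<Suc n]" by (simp add: upt_conv_Cons del: upt_Suc)
  have "{j'. (i', j') \<in> set ((i, j) # ?L)} = {j'. (i', j') \<in> set ?L}" if "i' \<in> set [Suc i..<Suc n]" for i'
    using that by auto
  then have "map (\<lambda>i'. pw (x i') (\<Sum>j'\<in>{j'. (i', j') \<in> set ((i, j) # ?L)}. \<alpha> (i', j'))) [Suc i..<Suc n]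
    = map (\<lambda>i'. pw (x i') (\<Sum>j'\<in>{j'. (i', j') \<in> set ?L}. \<alpha> (i', j'))) [Suc i..<Suc n]"
    by (intro map_cong) (auto simp del: upt_Suc)
  moreover have "(\<Sum>j'\<in>{j'. (i, j') \<in> set ((i, j) # ?L)}. \<alpha> (i, j'))
     = \<alpha> (i, j) + (\<Sum>j'\<in>{j'. (i, j') \<in> set ?L}. \<alpha> (i, j'))"
    unfolding latt_row_Cons_col(1)[OF latt_col.hyps]
    using latt_row_Cons_col(2)[OF latt_col.hyps] finite_row[of "set ?L" i] by (subst sum.insert) auto
  ultimately show ?case using latt_col.IH
    by (simp only: list.map concat.simps list.sel fst_conv up pw_add append_assoc)
qed

lemma latt_concat_cols:
  assumes "latt n m L"
  shows "concat (map (\<lambda>c. pw (y (snd c)) (\<beta> c)) L)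
    = concat (map (\<lambda>j. pw (y j) (\<Sum>i\<in>{i. (i, j) \<in> set L}. \<beta> (i, j))) [snd (hd L)..<Suc m])"
proof -
  have ne: "L \<noteq> []" using assms by (auto elim: latt.cases)
  have "{i. (j, i) \<in> set (map prod.swap L)} = {i. (i, j) \<in> set L}" for j by force
  then show ?thesis
    using latt_concat_rows[OF latt_swap[OF assms], where x = y and \<alpha> = "\<lambda>c. \<beta> (prod.swap c)"] ne
    by (simp add: comp_def hd_map del: upt_Suc)
qed

section \<open>Cutting an edit path along the grid\<close>

lemma edit_path_concat:
  "(\<And>c. c \<in> set L \<Longrightarrow> edit_path (P c) (X c) (Y c)) \<Longrightarrow>
    edit_path (concat (map P L)) (concat (map X L)) (concat (map Y L))"
  by (induction L) (auto intro: edit_path_append)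

lemma wgt_concat: "wgt (concat ps) = sum_list (map wgt ps)"
  by (induction ps) auto

text \<open>The conditions are those that counting edges relies on: pieces are factors of their
  blocks, hence can be walked in the cyclic graph, and their lengths add up to the blocks.\<close>

definition grid_split :: "nat \<Rightarrow> nat \<Rightarrow> nat \<Rightarrow> nat \<Rightarrow> (nat \<Rightarrow> 'a list) \<Rightarrow> (nat \<Rightarrow> 'a list)
    \<Rightarrow> ('a option \<times> 'a option) list \<Rightarrow> bool" where
  "grid_split n m i j U V p \<longleftrightarrow> (\<exists>L P X Y. latt n m L \<and> hd L = (i, j)
     \<and> (\<forall>c\<in>set L. edit_path (P c) (X c) (Y c) \<and> sublist (X c) (U (fst c)) \<and> sublist (Y c) (V (snd c)))
     \<and> p = concat (map P L)
     \<and> (\<forall>i'\<in>{i..n}. (\<Sum>j'\<in>{j'. (i', j') \<in> set L}. length (X (i', j'))) = length (U i'))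
     \<and> (\<forall>j'\<in>{j..m}. (\<Sum>i'\<in>{i'. (i', j') \<in> set L}. length (Y (i', j'))) = length (V j')))"

lemma grid_split_swap:
  assumes "grid_split n m i j U V p"
  shows "grid_split m n j i V U (map prod.swap p)"
proof -
  obtain L P X Y where L: "latt n m L" "hd L = (i, j)"
     "\<And>c. c\<in>set L \<Longrightarrow> edit_path (P c) (X c) (Y c) \<and> sublist (X c) (U (fst c)) \<and> sublist (Y c) (V (snd c))"
     "p = concat (map P L)"
     "\<forall>i'\<in>{i..n}. (\<Sum>j'\<in>{j'. (i', j') \<in> set L}. length (X (i', j'))) = length (U i')"
     "\<forall>j'\<in>{j..m}. (\<Sum>i'\<in>{i'. (i', j') \<in> set L}. length (Y (i', j'))) = length (V j')"
    using assms unfolding grid_split_def by blast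
  have ne: "L \<noteq> []" using L(1) by (auto elim: latt.cases)
  have rows: "{a. (b, a) \<in> set (map prod.swap L)} = {a. (a, b) \<in> set L}"
     "{a. (a, b) \<in> set (map prod.swap L)} = {a. (b, a) \<in> set L}" for b by force+
  show ?thesis unfolding grid_split_def
  proof (intro exI conjI)
    show "latt m n (map prod.swap L)" using latt_swap[OF L(1)] .
    show "hd (map prod.swap L) = (j, i)" using ne L(2) by (simp add: hd_map)
    show "\<forall>c\<in>set (map prod.swap L). edit_path ((\<lambda>c. map prod.swap (P (prod.swap c))) c)
         ((\<lambda>c. Y (prod.swap c)) c) ((\<lambda>c. X (prod.swap c)) c)
      \<and> sublist ((\<lambda>c. Y (prod.swap c)) c) (V (fst c)) \<and> sublist ((\<lambda>c. X (prod.swap c)) c) (U (snd c))"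
      using L(3) by (auto simp: edit_path_swap)
    show "map prod.swap p = concat (map (\<lambda>c. map prod.swap (P (prod.swap c))) (map prod.swap L))"
      unfolding L(4) by (simp add: map_concat comp_def)
  qed (use L(5,6) in \<open>simp_all only: rows swap_simp\<close>)
qed

lemma concat_map_upd:
  assumes "i \<le> n"
  shows "concat (map (U(i := w)) [i..<Suc n]) = w @ concat (map U [Suc i..<Suc n])"
proof -
  have "[i..<Suc n] = i # [Suc i..<Suc n]" using assms by (simp add: upt_conv_Cons del: upt_Suc)
  moreover have "map (U(i := w)) [Suc i..<Suc n] = map U [Suc i..<Suc n]" by (intro map_cong) auto
  ultimately show ?thesis by (simp del: upt_Suc)
qed

lemma concat_map_upt:
  assumes "i \<le> n"
  shows "concat (map U [i..<Suc n]) = U i @ concat (map U [Suc i..<Suc n])"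
  using concat_map_upd[OF assms, of U "U i"] by simp

text \<open>Cell \<open>(i, j)\<close> takes the whole block \<open>U i\<close> against a prefix of
  \<open>V j\<close>; the rest of \<open>V j\<close> serves as the block of column \<open>j\<close>
  further on, and \<open>Y1\<close> completes the column sum.\<close>

lemma grid_split_row:
  assumes "grid_split n m (Suc i) j U (V(j := V')) p2" "edit_path p1 (U i) Y1" "V j = Y1 @ V'"
  shows "grid_split n m i j U V (p1 @ p2)"
proof -
  obtain L P X Y where L: "latt n m L" "hd L = (Suc i, j)"
     "\<And>c. c\<in>set L \<Longrightarrow> edit_path (P c) (X c) (Y c) \<and> sublist (X c) (U (fst c)) \<and> sublist (Y c) ((V(j := V')) (snd c))"
     "p2 = concat (map P L)"
     "\<And>i'. i'\<in>{Suc i..n} \<Longrightarrow> (\<Sum>j'\<in>{j'. (i', j') \<in> set L}. length (X (i', j'))) = length (U i')"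
     "\<And>j'. j'\<in>{j..m} \<Longrightarrow> (\<Sum>i'\<in>{i'. (i', j') \<in> set L}. length (Y (i', j'))) = length ((V(j := V')) j')"
    using assms(1) unfolding grid_split_def by blast
  obtain L' where L': "L = (Suc i, j) # L'" using L(1,2) by (cases L) (auto elim: latt.cases)
  have gt: "Suc i \<le> i'" "j \<le> j'" if "(i', j') \<in> set L" for i' j' using latt_bounds[OF L(1) that] L(2) by auto
  then have nin: "(i, j') \<notin> set L" for j' by fastforce
  define P' X' Y' where "P' = P((i, j) := p1)" and "X' = X((i, j) := U i)" and "Y' = Y((i, j) := Y1)"
  have old: "P' c = P c" "X' c = X c" "Y' c = Y c" if "c \<in> set L" for c
    using that nin by (auto simp: P'_def X'_def Y'_def)
  have sub: "sublist Y1 (V j)" "sublist V' (V j)" using assms(3) by auto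
  show ?thesis unfolding grid_split_def
  proof (intro exI conjI ballI)
    show "latt n m ((i, j) # L)" using L(1) L' by (auto intro: latt_row)
    show "p1 @ p2 = concat (map P' ((i, j) # L))"
      using old L(4) by (simp add: P'_def cong: map_cong)
    fix c assume c: "c \<in> set ((i, j) # L)"
    show "edit_path (P' c) (X' c) (Y' c)"
      using c old[of c] L(3)[of c] assms(2) by (cases "c = (i, j)") (simp_all add: P'_def X'_def Y'_def)
    show "sublist (X' c) (U (fst c))"
      using c old[of c] L(3)[of c] by (cases "c = (i, j)") (simp_all add: X'_def)
    show "sublist (Y' c) (V (snd c))"
    proof (cases "c = (i, j)")
      case False
      then have "c \<in> set L" using c by auto
      then have "sublist (Y' c) ((V(j := V')) (snd c))" using old L(3) by auto
      then show ?thesis using sub(2) by (cases "snd c = j") (auto intro: sublist_order.order.trans)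
    qed (use sub in \<open>auto simp: Y'_def\<close>)
  next
    fix i' assume i': "i' \<in> {i..n}"
    show "(\<Sum>j'\<in>{j'. (i', j') \<in> set ((i, j) # L)}. length (X' (i', j'))) = length (U i')"
    proof (cases "i' = i")
      case True
      have "{j'. (i, j') \<in> set ((i, j) # L)} = {j}" using nin by auto
      then show ?thesis using True by (simp add: X'_def)
    next
      case False
      have "{j'. (i', j') \<in> set ((i, j) # L)} = {j'. (i', j') \<in> set L}" using False by auto
      then have "(\<Sum>j'\<in>{j'. (i', j') \<in> set ((i, j) # L)}. length (X' (i', j'))) = (\<Sum>j'\<in>{j'. (i', j') \<in> set L}. length (X (i', j')))"
        using old by (intro sum.cong) auto
      then show ?thesis using L(5)[of i'] i' False by auto
    qed
  next
    fix j' assume j': "j' \<in> {j..m}"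
    have *: "(\<Sum>i'\<in>{i'. (i', j') \<in> set L}. length (Y' (i', j'))) = length ((V(j := V')) j')"
      using old L(6)[OF j'] by (auto intro: trans[OF sum.cong])
    show "(\<Sum>i'\<in>{i'. (i', j') \<in> set ((i, j) # L)}. length (Y' (i', j'))) = length (V j')"
    proof (cases "j' = j")
      case True
      have "{i'. (i', j) \<in> set ((i, j) # L)} = insert i {i'. (i', j) \<in> set L}" by auto
      moreover have "finite {i'. (i', j) \<in> set L}" by (rule finite_subset[of _ "fst ` set L"]) force+
      ultimately show ?thesis using True * nin assms(3) by (simp add: Y'_def)
    next
      case False
      have "{i'. (i', j') \<in> set ((i, j) # L)} = {i'. (i', j') \<in> set L}" using False by auto
      then show ?thesis using * False by simp
    qed
  qed auto
qed

lemma grid_split_col: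
  assumes "grid_split n m i (Suc j) (U(i := U')) V p2" "edit_path p1 X1 (V j)" "U i = X1 @ U'"
  shows "grid_split n m i j U V (p1 @ p2)"
proof -
  have "grid_split m n j i V U (map prod.swap p1 @ map prod.swap p2)"
    by (rule grid_split_row[OF grid_split_swap[OF assms(1)] _ assms(3)]) (simp add: edit_path_swap assms(2))
  from grid_split_swap[OF this] show ?thesis by (simp add: comp_def)
qed

text \<open>The block that the edit path finishes earlier decides the next move: a new row if
  \<open>U i\<close> ends within \<open>V j\<close>, otherwise a new column; in the last row only
  columns remain. \<open>U\<close> and \<open>V\<close> are generalised because the interrupted
  block is shortened.\<close>

lemma grid_split_exists:
  assumes "i \<le> n" "j \<le> m" "edit_path p (concat (map U [i..<Suc n])) (concat (map V [j..<Suc m]))"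
  shows "grid_split n m i j U V p"
  using assms
proof (induction "(n - i) + (m - j)" arbitrary: i j U V p rule: less_induct)
  case less
  have row: ?case if "i < n" "p = p1 @ p2" "edit_path p1 (U i) Y1" "V j = Y1 @ V'"
    "edit_path p2 (concat (map U [Suc i..<Suc n])) (V' @ concat (map V [Suc j..<Suc m]))" for p1 p2 Y1 V'
    unfolding that(2)
    by (rule grid_split_row[where U = U and V = V and i = i and j = j, OF _ that(3,4)], rule less.hyps)
       (use that(1,5) less.prems(1,2) in \<open>simp_all add: concat_map_upd del: upt_Suc fun_upd_apply\<close>)
  have col: ?case if "j < m" "p = p1 @ p2" "edit_path p1 X1 (V j)" "U i = X1 @ U'"
    "edit_path p2 (U' @ concat (map U [Suc i..<Suc n])) (concat (map V [Suc j..<Suc m]))" for p1 p2 X1 U'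
    unfolding that(2)
    by (rule grid_split_col[where U = U and V = V and i = i and j = j, OF _ that(3,4)], rule less.hyps)
       (use that(1,5) less.prems(1,2) in \<open>simp_all add: concat_map_upd del: upt_Suc fun_upd_apply\<close>)
  have ep: "edit_path p (U i @ concat (map U [Suc i..<Suc n])) (V j @ concat (map V [Suc j..<Suc m]))"
    using less.prems by (simp only: concat_map_upt)
  consider "i = n" "j = m" | "i = n" "j < m" | "i < n" using less.prems by linarith
  then show ?case
  proof cases
    case 1
    have "{a. (a, m) \<in> set [(n, m)]} = {n}" "{a. (n, a) \<in> set [(n, m)]} = {m}" by auto
    then show ?thesis unfolding grid_split_def using 1 ep
      by (intro exI[of _ "[(n, m)]"] exI[of _ "\<lambda>_. p"] exI[of _ "\<lambda>_. U n"] exI[of _ "\<lambda>_. V m"])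
         (auto intro: latt_end)
  next
    case 2
    obtain p1 p2 X1 X2 where s: "p = p1 @ p2" "U i @ concat (map U [Suc i..<Suc n]) = X1 @ X2" "edit_path p1 X1 (V j)"
      "edit_path p2 X2 (concat (map V [Suc j..<Suc m]))"
      using edit_path_split_right[OF ep] by blast
    show ?thesis by (rule col[OF 2(2) s(1,3), of X2]) (use s 2 in auto)
  next
    case 3
    obtain p1 p2 Y1 Y2 where s: "p = p1 @ p2" "V j @ concat (map V [Suc j..<Suc m]) = Y1 @ Y2" "edit_path p1 (U i) Y1"
      "edit_path p2 (concat (map U [Suc i..<Suc n])) Y2"
      using edit_path_split_left[OF ep] by blast
    \<comment> \<open>\<open>Z\<close> is what the path produces of later columns before
      \<open>U i\<close> ends; being nonempty, it rules out the last column.\<close>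
    from s(2) consider V' where "V j = Y1 @ V'" "Y2 = V' @ concat (map V [Suc j..<Suc m])"
      | Z where "Z \<noteq> []" "Y1 = V j @ Z" "concat (map V [Suc j..<Suc m]) = Z @ Y2"
      unfolding append_eq_append_conv2 by (metis append_Nil2 self_append_conv2)
    then show ?thesis
    proof cases
      case 1
      show ?thesis by (rule row[OF 3 s(1,3) 1(1)]) (use s(4) 1 in simp)
    next
      case 2
      have "j < m" using 2(1,3) less.prems(2) by (cases "j = m") auto
      obtain q1 q2 X1 X2 where q: "p1 = q1 @ q2" "U i = X1 @ X2" "edit_path q1 X1 (V j)" "edit_path q2 X2 Z"
        using edit_path_split_right[of p1 "U i" "V j" Z] s(3) 2 by auto
      show ?thesis
      proof (rule col[OF \<open>j < m\<close> _ q(3,2)])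
        show "p = q1 @ (q2 @ p2)" using s(1) q(1) by simp
        show "edit_path (q2 @ p2) (X2 @ concat (map U [Suc i..<Suc n])) (concat (map V [Suc j..<Suc m]))"
          using edit_path_append[OF q(4) s(4)] 2 by simp
      qed
    qed
  qed
qed

subsection \<open>From a feasible solution to an edit path\<close>

lemma wordof_eq: "wordof xs \<nu> = concat (map (\<lambda>i. pw (xs ! i) (\<nu> i)) [0..<length xs])"
  by (simp add: wordof_def)

lemma length_wordof: "length (wordof xs \<nu>) = (\<Sum>i<length xs. \<nu> i * length (xs ! i))"
proof -
  have "length (wordof xs \<nu>) = sum_list (map (\<lambda>i. \<nu> i * length (xs ! i)) [0..<length xs])"
    unfolding wordof_eq by (subst length_concat) (simp only: map_map comp_def length_pw)
  then show ?thesis by (simp add: interv_sum_list_conv_sum_set_nat atLeast0LessThan)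
qed

lemma wordof_cong: "(\<And>i. i < length xs \<Longrightarrow> \<nu> i = \<nu>' i) \<Longrightarrow> wordof xs \<nu> = wordof xs \<nu>'"
proof -
  assume "\<And>i. i < length xs \<Longrightarrow> \<nu> i = \<nu>' i"
  then have "map (\<lambda>i. pw (xs ! i) (\<nu> i)) [0..<length xs] = map (\<lambda>i. pw (xs ! i) (\<nu>' i)) [0..<length xs]" by simp
  then show ?thesis by (simp only: wordof_eq)
qed

lemma subseq_wordof:
  assumes "\<And>i. i < length xs \<Longrightarrow> \<nu>' i \<le> \<nu> i"
  shows "subseq (wordof xs \<nu>') (wordof xs \<nu>)"
proof -
  have *: "subseq (concat (map f is)) (concat (map g is))" if "\<And>i. i \<in> set is \<Longrightarrow> subseq (f i) (g i)"
    for f g :: "nat \<Rightarrow> 'a list" and "is"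
    using that by (induction "is") (auto intro: list_emb_append_mono)
  have "subseq (pw (xs ! i) (\<nu>' i)) (pw (xs ! i) (\<nu> i))" if "i < length xs" for i
  proof -
    have "pw (xs ! i) (\<nu> i) = pw (xs ! i) (\<nu>' i) @ pw (xs ! i) (\<nu> i - \<nu>' i)"
      unfolding pw_add[symmetric] using assms[OF that] by simp
    then show ?thesis unfolding \<open>pw (xs ! i) (\<nu> i) = _\<close> by (intro prefix_imp_subseq prefixI) (rule refl)
  qed
  then show ?thesis unfolding wordof_eq by (rule *) (simp only: set_upt atLeastLessThan_iff)
qed

lemma Interl_iff:
  assumes "0 < n" "0 < m"
  shows "\<pi> \<in> Interl n m \<longleftrightarrow> (\<exists>L. \<pi> = set L \<and> latt (n - 1) (m - 1) L \<and> hd L = (0, 0))"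
  unfolding Interl_def using lpath_iff_latt[OF assms] by auto

lemma Interl_subset: "0 < n \<Longrightarrow> 0 < m \<Longrightarrow> \<pi> \<in> Interl n m \<Longrightarrow> \<pi> \<subseteq> {..<n} \<times> {..<m}"
proof
  fix c assume nm: "0 < n" "0 < m" "\<pi> \<in> Interl n m" and c: "c \<in> \<pi>"
  then obtain L where L: "\<pi> = set L" "latt (n - 1) (m - 1) L" using Interl_iff by blast
  obtain i j where ij: "c = (i, j)" by (cases c)
  show "c \<in> {..<n} \<times> {..<m}" using latt_bounds(2,4)[OF L(2), of i j] c L(1) ij nm by auto
qed

lemma finite_Interl: "0 < n \<Longrightarrow> 0 < m \<Longrightarrow> finite (Interl n m)"
  by (rule finite_subset[of _ "Pow ({..<n} \<times> {..<m})"]) (use Interl_subset in auto)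

lemma wordof_latt:
  assumes "xs \<noteq> []" "ys \<noteq> []" "latt (length xs - 1) (length ys - 1) L" "hd L = (0, 0)"
  shows "concat (map (\<lambda>c. pw (xs ! fst c) (\<alpha> c)) L) = wordof xs (\<lambda>i. \<Sum>j\<in>{j. (i, j) \<in> set L}. \<alpha> (i, j))"
    and "concat (map (\<lambda>c. pw (ys ! snd c) (\<beta> c)) L) = wordof ys (\<lambda>j. \<Sum>i\<in>{i. (i, j) \<in> set L}. \<beta> (i, j))"
  using assms(1,2,4) latt_concat_rows[OF assms(3), where x = "(!) xs" and \<alpha> = \<alpha>]
    latt_concat_cols[OF assms(3), where y = "(!) ys" and \<beta> = \<beta>]
  by (simp_all add: wordof_eq del: upt_Suc)

lemma sum_rows:
  fixes n m :: nat
  assumes "\<pi> \<subseteq> {..<n} \<times> {..<m}"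
  shows "(\<Sum>i<n. \<Sum>j\<in>{j. (i, j) \<in> \<pi>}. F (i, j)) = (\<Sum>c\<in>\<pi>. F c)"
proof -
  have fin: "finite {j. (i, j) \<in> \<pi>}" for i
    by (rule finite_subset[of _ "{..<m}"]) (use assms in auto)
  have "\<pi> = (SIGMA i:{..<n}. {j. (i, j) \<in> \<pi>})" using assms by auto
  then show ?thesis using fin by (subst sum.Sigma) (auto intro!: sum.cong)
qed

lemma sum_cols:
  fixes n m :: nat
  assumes "\<pi> \<subseteq> {..<n} \<times> {..<m}"
  shows "(\<Sum>j<m. \<Sum>i\<in>{i. (i, j) \<in> \<pi>}. F (i, j)) = (\<Sum>c\<in>\<pi>. F c)"
proof -
  have "prod.swap ` \<pi> \<subseteq> {..<m} \<times> {..<n}" using assms by auto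
  from sum_rows[OF this, of "\<lambda>c. F (prod.swap c)"]
  have "(\<Sum>j<m. \<Sum>i\<in>{i. (j, i) \<in> prod.swap ` \<pi>}. F (i, j)) = (\<Sum>c\<in>prod.swap ` \<pi>. F (prod.swap c))" by simp
  also have "(\<Sum>c\<in>prod.swap ` \<pi>. F (prod.swap c)) = (\<Sum>c\<in>\<pi>. F c)"
    by (subst sum.reindex) (auto simp: inj_on_def)
  finally have *: "(\<Sum>j<m. \<Sum>i\<in>{i. (j, i) \<in> prod.swap ` \<pi>}. F (i, j)) = (\<Sum>c\<in>\<pi>. F c)" by simp
  have "{i. (j, i) \<in> prod.swap ` \<pi>} = {i. (i, j) \<in> \<pi>}" for j by force
  then show ?thesis using * by (simp only:)
qed

section \<open>The linear program cell by cell\<close>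

abbreviation cellsum :: "'a list list \<Rightarrow> 'a list list \<Rightarrow> (edge \<Rightarrow> real) \<Rightarrow> (nat \<times> nat \<Rightarrow> edge \<Rightarrow> real) \<Rightarrow> nat \<times> nat \<Rightarrow> real" where
  "cellsum xs ys h f c \<equiv> wsum (xs ! fst c) (ys ! snd c) h (f c)"

abbreviation cellcost :: "'a list list \<Rightarrow> 'a list list \<Rightarrow> (nat \<times> nat \<Rightarrow> edge \<Rightarrow> real) \<Rightarrow> nat \<times> nat \<Rightarrow> real" where
  "cellcost xs ys f c \<equiv> cellsum xs ys (ecost (xs ! fst c) (ys ! snd c)) f c"

lemma lp_feasible_iff:
  "lp_feasible xs ys r vs a \<pi> f \<tau> lam \<longleftrightarrow>
     (\<forall>c\<in>\<pi>. circ (xs ! fst c) (ys ! snd c) (f c)) \<and> (\<forall>s<r. 0 \<le> \<tau> s) \<and> 0 < lam \<and> lam \<le> 1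
   \<and> (\<Sum>c\<in>\<pi>. cellsum xs ys (\<lambda>_. 1) f c) = 1
   \<and> (\<forall>i<length xs. (\<Sum>j\<in>{j. (i, j) \<in> \<pi>}. cellsum xs ys indx f (i, j)) = real (length (xs ! i)) * a i * lam)
   \<and> (\<forall>j<length ys. (\<Sum>i\<in>{i. (i, j) \<in> \<pi>}. cellsum xs ys indy f (i, j))
        = real (length (ys ! j)) * (\<Sum>s<r. \<tau> s * real (vs s j)))"
proof -
  have 1: "(\<Sum>c\<in>\<pi>. cellsum xs ys (\<lambda>_. 1) f c) = (\<Sum>(i, j)\<in>\<pi>. \<Sum>e\<in>cedges (xs ! i) (ys ! j). f (i, j) e)"
    by (intro sum.cong) (auto simp: wsum_def)
  have 2: "(\<forall>c\<in>\<pi>. circ (xs ! fst c) (ys ! snd c) (f c)) \<longleftrightarrow>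
     (\<forall>(i, j)\<in>\<pi>. \<forall>e\<in>cedges (xs ! i) (ys ! j). 0 \<le> f (i, j) e)
   \<and> (\<forall>(i, j)\<in>\<pi>. \<forall>w\<in>cverts (xs ! i) (ys ! j).
        (\<Sum>e\<in>{e\<in>cedges (xs ! i) (ys ! j). esrc (xs ! i) (ys ! j) e = w}. f (i, j) e)
      = (\<Sum>e\<in>{e\<in>cedges (xs ! i) (ys ! j). etgt (xs ! i) (ys ! j) e = w}. f (i, j) e))"
    unfolding circ_def ball_conj_distrib by (simp add: case_prod_beta')
  show ?thesis unfolding lp_feasible_def 1 2 unfolding wsum_def fst_conv snd_conv by blast
qed

lemma lp_obj_eq: "lp_obj xs ys \<pi> f = (\<Sum>c\<in>\<pi>. cellcost xs ys f c)"
  unfolding lp_obj_def wsum_def by (intro sum.cong) auto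

lemma wsum_mono:
  assumes "circ u v g" "\<And>e. h e \<le> h' e"
  shows "wsum u v h g \<le> wsum u v h' g"
  using assms unfolding wsum_def circ_def by (intro sum_mono mult_left_mono) auto

lemma wsum_nonneg: "circ u v g \<Longrightarrow> (\<And>e. 0 \<le> h e) \<Longrightarrow> 0 \<le> wsum u v h g"
  unfolding wsum_def circ_def by (intro sum_nonneg mult_nonneg_nonneg) auto

lemma lp_obj_bounds:
  assumes "lp_feasible xs ys r vs a \<pi> f \<tau> lam"
  shows "0 \<le> lp_obj xs ys \<pi> f" "lp_obj xs ys \<pi> f \<le> 1"
proof -
  have c: "\<And>c. c\<in>\<pi> \<Longrightarrow> circ (xs ! fst c) (ys ! snd c) (f c)" and t: "(\<Sum>c\<in>\<pi>. cellsum xs ys (\<lambda>_. 1) f c) = 1"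
    using assms by (auto simp: lp_feasible_iff)
  show "0 \<le> lp_obj xs ys \<pi> f" unfolding lp_obj_eq
    by (intro sum_nonneg wsum_nonneg c ecost_bounds)
  have "lp_obj xs ys \<pi> f \<le> (\<Sum>c\<in>\<pi>. cellsum xs ys (\<lambda>_. 1) f c)" unfolding lp_obj_eq
    by (intro sum_mono wsum_mono c ecost_bounds)
  then show "lp_obj xs ys \<pi> f \<le> 1" using t by simp
qed

lemma OPT_le:
  assumes "lp_feasible xs ys r vs a \<pi> f \<tau> lam"
  shows "OPT xs ys r vs a \<pi> \<le> lp_obj xs ys \<pi> f"
  unfolding OPT_def
proof (rule cInf_lower)
  show "bdd_below {lp_obj xs ys \<pi> f | f \<tau> lam. lp_feasible xs ys r vs a \<pi> f \<tau> lam}"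
    by (rule bdd_belowI[of _ 0]) (use lp_obj_bounds(1) in blast)
qed (use assms in blast)

text \<open>One turn around the graph along \<open>u\<close>, at position 0 of
  \<open>v\<close>.\<close>

lemma deletion_cycle:
  assumes "u \<noteq> []" "v \<noteq> []"
  shows "\<exists>g. circ u v g \<and> wsum u v (\<lambda>_. 1) g = length u \<and> wsum u v indx g = length u \<and> wsum u v indy g = 0"
proof -
  have st: "(0, 0) \<in> cverts u v" using assms by (auto simp: cverts_def)
  have "factor_at u 0 u" "factor_at v 0 []" by (auto simp: factor_at_def)
  with twalk_exists[OF dels(1)[of u] _ _ st] obtain C where
    C: "twalk u v (0, 0) C (0, 0)" "map (eop u v) C = dels u" by auto
  have "sum_list (map indx C) = length u" "sum_list (map indy C) = 0"
    using length_lword_eop[of u v C] length_rword_eop[of u v C] dels(1)[of u] C(2)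
    by (simp_all add: edit_path_words_iff)
  moreover have "length C = length u" using arg_cong[OF C(2), of length] by (simp add: dels)
  ultimately show ?thesis using circ_closed_walk[OF C(1)] wsum_count[OF gwalk_set[OF C(1)]]
    by (intro exI[of _ "\<lambda>e. real (count_list C e)"]) (simp add: sum_list_triv)
qed

text \<open>Row \<open>i\<close> is deleted entirely in one chosen cell \<open>J i\<close>, with
  \<open>lam = 1\<close> and all \<open>\<tau>\<close> zero. Feasibility keeps the infimum in
  \<open>OPT\<close> away from the empty set and bounds it by 1.\<close>

lemma lp_feasible_deletions:
  assumes "xs \<noteq> []" "ys \<noteq> []" "\<forall>x\<in>set xs. x \<noteq> []" "\<forall>y\<in>set ys. y \<noteq> []"
    and \<pi>: "\<pi> \<in> Interl (length xs) (length ys)"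
    and a: "\<And>i. i < length xs \<Longrightarrow> 0 \<le> a i" "(\<Sum>i<length xs. a i * real (length (xs ! i))) = 1"
  shows "\<exists>f \<tau> lam. lp_feasible xs ys r vs a \<pi> f \<tau> lam"
proof -
  have nm: "0 < length xs" "0 < length ys" using assms by auto
  have sub: "\<pi> \<subseteq> {..<length xs} \<times> {..<length ys}" using Interl_subset[OF nm \<pi>] .
  have "\<forall>i<length xs. \<exists>j. (i, j) \<in> \<pi>"
    using \<pi> latt_row_nonempty nm unfolding Interl_iff[OF nm] by fastforce
  then obtain J where J: "\<And>i. i < length xs \<Longrightarrow> (i, J i) \<in> \<pi>" by metis
  have "\<exists>g. circ (xs ! fst c) (ys ! snd c) g \<and> wsum (xs ! fst c) (ys ! snd c) (\<lambda>_. 1) g = length (xs ! fst c)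
     \<and> wsum (xs ! fst c) (ys ! snd c) indx g = length (xs ! fst c) \<and> wsum (xs ! fst c) (ys ! snd c) indy g = 0"
    if "c \<in> \<pi>" for c
    by (rule deletion_cycle) (use that sub assms in auto)
  then obtain g where g: "\<And>c. c \<in> \<pi> \<Longrightarrow> circ (xs ! fst c) (ys ! snd c) (g c) \<and> cellsum xs ys (\<lambda>_. 1) g c = length (xs ! fst c)
     \<and> cellsum xs ys indx g c = length (xs ! fst c) \<and> cellsum xs ys indy g c = 0"
    by metis
  define f where "f c = (\<lambda>e. (if snd c = J (fst c) then a (fst c) else 0) * g c e)" for c
  have f: "cellsum xs ys h f c = (if snd c = J (fst c) then a (fst c) else 0) * cellsum xs ys h g c" for h c
    unfolding f_def wsum_scale ..
  have row: "(\<Sum>j\<in>{j. (i, j) \<in> \<pi>}. cellsum xs ys h f (i, j)) = real (length (xs ! i)) * a i"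
    if "i < length xs" "\<And>c. c \<in> \<pi> \<Longrightarrow> cellsum xs ys h g c = length (xs ! fst c)" for i h
  proof -
    have "finite {j. (i, j) \<in> \<pi>}" by (rule finite_subset[of _ "{..<length ys}"]) (use sub in auto)
    moreover have "(\<Sum>j\<in>{j. (i, j) \<in> \<pi>}. cellsum xs ys h f (i, j))
        = (\<Sum>j\<in>{j. (i, j) \<in> \<pi>}. if j = J i then real (length (xs ! i)) * a i else 0)"
      unfolding f using that(2) by (intro sum.cong) auto
    ultimately show ?thesis using J[OF that(1)] by simp
  qed
  have "(\<Sum>c\<in>\<pi>. cellsum xs ys (\<lambda>_. 1) f c) = (\<Sum>i<length xs. \<Sum>j\<in>{j. (i, j) \<in> \<pi>}. cellsum xs ys (\<lambda>_. 1) f (i, j))"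
    by (rule sum_rows[OF sub, symmetric])
  also have "\<dots> = (\<Sum>i<length xs. a i * real (length (xs ! i)))"
    using row g by (intro sum.cong) (auto simp: mult.commute)
  finally have "(\<Sum>c\<in>\<pi>. cellsum xs ys (\<lambda>_. 1) f c) = 1" using a by simp
  moreover have "\<forall>c\<in>\<pi>. circ (xs ! fst c) (ys ! snd c) (f c)"
    unfolding f_def using g a(1) sub by (intro ballI circ_scale) auto
  moreover have "(\<Sum>i\<in>{i. (i, j) \<in> \<pi>}. cellsum xs ys indy f (i, j)) = 0" for j
    unfolding f using g by (intro sum.neutral) auto
  ultimately show ?thesis using row g unfolding lp_feasible_iff
    by (intro exI[of _ f] exI[of _ "\<lambda>_. 0"] exI[of _ 1]) auto
qed

text \<open>Errors along an interleaving, a row or a column are bounded by one sum over the whole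
  grid, so that constants do not depend on \<open>\<pi>\<close>.\<close>

lemma sum_mono_cells:
  fixes K :: "nat \<times> nat \<Rightarrow> real"
  assumes "\<pi> \<subseteq> {..<n} \<times> {..<m}" "\<And>c. c \<in> {..<n} \<times> {..<m} \<Longrightarrow> 0 \<le> K c"
  shows "(\<Sum>c\<in>\<pi>. K c) \<le> (\<Sum>c\<in>{..<n} \<times> {..<m}. K c)"
    and "(\<Sum>j\<in>{j. (i, j) \<in> \<pi>}. K (i, j)) \<le> (\<Sum>c\<in>{..<n} \<times> {..<m}. K c)"
    and "(\<Sum>i\<in>{i. (i, j) \<in> \<pi>}. K (i, j)) \<le> (\<Sum>c\<in>{..<n} \<times> {..<m}. K c)"
proof -
  have *: "(\<Sum>c\<in>S. K c) \<le> (\<Sum>c\<in>{..<n} \<times> {..<m}. K c)" if "S \<subseteq> \<pi>" for S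
    using assms that by (intro sum_mono2) auto
  show "(\<Sum>c\<in>\<pi>. K c) \<le> (\<Sum>c\<in>{..<n} \<times> {..<m}. K c)" by (rule *) simp
  have "(\<Sum>j\<in>{j. (i, j) \<in> \<pi>}. K (i, j)) = (\<Sum>c\<in>Pair i ` {j. (i, j) \<in> \<pi>}. K c)"
    by (subst sum.reindex) (auto simp: inj_on_def)
  also have "\<dots> \<le> (\<Sum>c\<in>{..<n} \<times> {..<m}. K c)" by (rule *) auto
  finally show "(\<Sum>j\<in>{j. (i, j) \<in> \<pi>}. K (i, j)) \<le> (\<Sum>c\<in>{..<n} \<times> {..<m}. K c)" .
  have "(\<Sum>i\<in>{i. (i, j) \<in> \<pi>}. K (i, j)) = (\<Sum>c\<in>(\<lambda>i. (i, j)) ` {i. (i, j) \<in> \<pi>}. K c)"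
    by (subst sum.reindex) (auto simp: inj_on_def)
  also have "\<dots> \<le> (\<Sum>c\<in>{..<n} \<times> {..<m}. K c)" by (rule *) auto
  finally show "(\<Sum>i\<in>{i. (i, j) \<in> \<pi>}. K (i, j)) \<le> (\<Sum>c\<in>{..<n} \<times> {..<m}. K c)" .
qed

lemma length_latt_words:
  assumes "\<pi> \<subseteq> {..<length xs} \<times> {..<length ys}"
  shows "real (length (wordof xs (\<lambda>i. \<Sum>j\<in>{j. (i, j) \<in> \<pi>}. \<alpha> (i, j)))) = (\<Sum>c\<in>\<pi>. real (\<alpha> c * length (xs ! fst c)))"
    and "real (length (wordof ys (\<lambda>j. \<Sum>i\<in>{i. (i, j) \<in> \<pi>}. \<alpha> (i, j)))) = (\<Sum>c\<in>\<pi>. real (\<alpha> c * length (ys ! snd c)))"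
  unfolding length_wordof sum_distrib_right
  using sum_rows[OF assms, of "\<lambda>c. \<alpha> c * length (xs ! fst c)"] sum_cols[OF assms, of "\<lambda>c. \<alpha> c * length (ys ! snd c)"]
  by (simp_all flip: of_nat_sum of_nat_mult)

text \<open>The order of quantifiers is the point: \<open>K\<close> precedes the interleaving, the
  exponents and the solution, so the error vanishes uniformly over long words.\<close>

lemma ned_round_flow:
  fixes xs ys :: "'a list list"
  assumes "xs \<noteq> []" "ys \<noteq> []" "\<forall>x\<in>set xs. x \<noteq> []" "\<forall>y\<in>set ys. y \<noteq> []"
  shows "\<exists>K::real. 0 \<le> K \<and> (\<forall>\<pi>\<in>Interl (length xs) (length ys). \<forall>\<nu> f \<tau> lam.
     lp_feasible xs ys r vs (dirv xs \<nu>) \<pi> f \<tau> lam \<longrightarrow> K < length (wordof xs \<nu>) \<longrightarrow>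
     (\<exists>t::nat \<Rightarrow> nat. ned (wordof xs \<nu>) (wordof ys (\<lambda>j. \<Sum>s<r. t s * vs s j))
        \<le> lp_obj xs ys \<pi> f + 2 * K / (length (wordof xs \<nu>) - K)))"
proof -
  have nm: "0 < length xs" "0 < length ys" using assms by auto
  let ?R = "{..<length xs} \<times> {..<length ys}"
  have "\<forall>c\<in>?R. \<exists>K\<ge>0. \<forall>g. circ (xs ! fst c) (ys ! snd c) g \<longrightarrow> approx (xs ! fst c) (ys ! snd c) K g"
    using assms by (intro ballI circ_approx) auto
  then obtain Kc where Kc: "\<And>c. c \<in> ?R \<Longrightarrow> 0 \<le> Kc c"
    "\<And>c g. c \<in> ?R \<Longrightarrow> circ (xs ! fst c) (ys ! snd c) g \<Longrightarrow> approx (xs ! fst c) (ys ! snd c) (Kc c) g"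
    by metis
  \<comment> \<open>Bounds the length added to \<open>y\<close> when every period coefficient is
    raised to an integer.\<close>
  define K2 :: real where "K2 = (\<Sum>j<length ys. real (length (ys ! j)) * (\<Sum>s<r. real (vs s j)))"
  define K where "K = (\<Sum>c\<in>?R. Kc c) + K2"
  have K2: "0 \<le> K2" unfolding K2_def by (intro sum_nonneg mult_nonneg_nonneg) auto
  have K: "0 \<le> K" unfolding K_def using K2 Kc(1) by (intro add_nonneg_nonneg sum_nonneg) auto
  show ?thesis
  proof (intro exI[of _ K] conjI ballI allI impI K)
    fix \<pi> \<nu> f \<tau> lam
    assume \<pi>: "\<pi> \<in> Interl (length xs) (length ys)"
      and feas: "lp_feasible xs ys r vs (dirv xs \<nu>) \<pi> f \<tau> lam"
      and big: "K < length (wordof xs \<nu>)"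
    have sub: "\<pi> \<subseteq> ?R" using Interl_subset[OF nm \<pi>] .
    obtain L where L: "\<pi> = set L" "latt (length xs - 1) (length ys - 1) L" "hd L = (0, 0)"
      using \<pi> unfolding Interl_iff[OF nm] by blast
    have fs: "\<And>c. c \<in> \<pi> \<Longrightarrow> circ (xs ! fst c) (ys ! snd c) (f c)" "\<And>s. s < r \<Longrightarrow> 0 \<le> \<tau> s" "0 < lam" "lam \<le> 1"
      "(\<Sum>c\<in>\<pi>. cellsum xs ys (\<lambda>_. 1) f c) = 1"
      "\<And>i. i < length xs \<Longrightarrow> (\<Sum>j\<in>{j. (i, j) \<in> \<pi>}. cellsum xs ys indx f (i, j)) = real (length (xs ! i)) * dirv xs \<nu> i * lam"
      "\<And>j. j < length ys \<Longrightarrow> (\<Sum>i\<in>{i. (i, j) \<in> \<pi>}. cellsum xs ys indy f (i, j))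
        = real (length (ys ! j)) * (\<Sum>s<r. \<tau> s * real (vs s j))"
      using feas unfolding lp_feasible_iff by auto
    define N where "N = real (length (wordof xs \<nu>))"
    have N: "K < N" "0 < N" using big K by (auto simp: N_def)
    have Neq: "N = (\<Sum>i<length xs. real (\<nu> i) * real (length (xs ! i)))" by (simp add: N_def length_wordof)
    \<comment> \<open>With total flow \<open>N / lam\<close>, row \<open>i\<close> carries exactly
      \<open>\<nu> i\<close> copies of its word; \<open>lam \<le> 1\<close> gives
      \<open>N \<le> S\<close>.\<close>
    define S where "S = N / lam"
    have S: "N \<le> S" "0 < S" "S * lam = N" using fs(3,4) N by (auto simp: S_def field_simps mult_left_le)
    define g where "g c = (\<lambda>e. S * f c e)" for c
    have gs: "cellsum xs ys h g c = S * cellsum xs ys h f c" for h c unfolding g_def wsum_scale ..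
    have "\<forall>c\<in>\<pi>. approx (xs ! fst c) (ys ! snd c) (Kc c) (g c)"
      unfolding g_def using sub S fs(1) by (intro ballI Kc(2) circ_scale) auto
    then obtain \<alpha> \<beta> p where ap: "\<And>c. c \<in> \<pi> \<Longrightarrow> edit_path (p c) (pw (xs ! fst c) (\<alpha> c)) (pw (ys ! snd c) (\<beta> c))"
      "\<And>c. c \<in> \<pi> \<Longrightarrow> real (\<alpha> c * length (xs ! fst c)) \<le> cellsum xs ys indx g c"
      "\<And>c. c \<in> \<pi> \<Longrightarrow> real (\<beta> c * length (ys ! snd c)) \<le> cellsum xs ys indy g c"
      "\<And>c. c \<in> \<pi> \<Longrightarrow> wgt (p c) + (cellsum xs ys indx g c - real (\<alpha> c * length (xs ! fst c)))
           + (cellsum xs ys indy g c - real (\<beta> c * length (ys ! snd c))) \<le> cellcost xs ys g c + Kc c"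
      "\<And>c. c \<in> \<pi> \<Longrightarrow> cellsum xs ys (\<lambda>_. 1) g c \<le> length (p c) + (cellsum xs ys indx g c - real (\<alpha> c * length (xs ! fst c)))
           + (cellsum xs ys indy g c - real (\<beta> c * length (ys ! snd c))) + Kc c"
      unfolding approx_def by metis
    define \<alpha>r where "\<alpha>r i = (\<Sum>j\<in>{j. (i, j) \<in> \<pi>}. \<alpha> (i, j))" for i
    define \<beta>c where "\<beta>c j = (\<Sum>i\<in>{i. (i, j) \<in> \<pi>}. \<beta> (i, j))" for j
    \<comment> \<open>Rounding up makes every block of \<open>y\<close> at least as long as its
      flow, so the target is reached by insertions.\<close>
    define t where "t s = nat \<lceil>S * \<tau> s\<rceil>" for s
    define \<mu> where "\<mu> j = (\<Sum>s<r. t s * vs s j)" for j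
    define b where "b j = (\<Sum>s<r. \<tau> s * real (vs s j))" for j
    have rowg: "(\<Sum>j\<in>{j. (i, j) \<in> \<pi>}. cellsum xs ys indx g (i, j)) = real (\<nu> i * length (xs ! i))" if "i < length xs" for i
    proof -
      have "(\<Sum>j\<in>{j. (i, j) \<in> \<pi>}. cellsum xs ys indx g (i, j)) = S * (real (length (xs ! i)) * dirv xs \<nu> i * lam)"
        unfolding gs fs(6)[OF that, symmetric] by (rule sum_distrib_left[symmetric])
      also have "\<dots> = (S * lam) * (real (length (xs ! i)) * (real (\<nu> i) / N))" by (simp add: dirv_def Neq)
      finally show ?thesis using N S(3) by simp
    qed
    have colg: "(\<Sum>i\<in>{i. (i, j) \<in> \<pi>}. cellsum xs ys indy g (i, j)) = S * b j * length (ys ! j)" if "j < length ys" for j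
    proof -
      have "(\<Sum>i\<in>{i. (i, j) \<in> \<pi>}. cellsum xs ys indy g (i, j)) = S * (real (length (ys ! j)) * (\<Sum>s<r. \<tau> s * real (vs s j)))"
        unfolding gs fs(7)[OF that, symmetric] by (rule sum_distrib_left[symmetric])
      then show ?thesis by (simp add: b_def mult_ac)
    qed
    have ceil: "S * \<tau> s \<le> real (t s)" "real (t s) \<le> S * \<tau> s + 1" if "s < r" for s
      using fs(2)[OF that] S(2) unfolding t_def by (simp_all add: of_nat_ceiling)
    have \<mu>: "S * b j \<le> real (\<mu> j)" "real (\<mu> j) \<le> S * b j + (\<Sum>s<r. real (vs s j))" for j
    proof -
      have "S * b j = (\<Sum>s<r. (S * \<tau> s) * real (vs s j))" by (simp add: b_def sum_distrib_left mult.assoc)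
      also have "\<dots> \<le> (\<Sum>s<r. real (t s) * real (vs s j))" using ceil by (intro sum_mono mult_right_mono) auto
      finally show "S * b j \<le> real (\<mu> j)" by (simp add: \<mu>_def)
      have "real (\<mu> j) = (\<Sum>s<r. real (t s) * real (vs s j))" by (simp add: \<mu>_def)
      also have "\<dots> \<le> (\<Sum>s<r. (S * \<tau> s + 1) * real (vs s j))" using ceil by (intro sum_mono mult_right_mono) auto
      also have "\<dots> = S * b j + (\<Sum>s<r. real (vs s j))"
        by (simp add: b_def sum_distrib_left algebra_simps sum.distrib)
      finally show "real (\<mu> j) \<le> S * b j + (\<Sum>s<r. real (vs s j))" .
    qed
    have le\<alpha>: "\<alpha>r i \<le> \<nu> i" if i: "i < length xs" for i
    proof -
      have "real (\<alpha>r i * length (xs ! i)) = (\<Sum>j\<in>{j. (i, j) \<in> \<pi>}. real (\<alpha> (i, j) * length (xs ! fst (i, j))))"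
        by (simp add: \<alpha>r_def sum_distrib_right)
      also have "\<dots> \<le> (\<Sum>j\<in>{j. (i, j) \<in> \<pi>}. cellsum xs ys indx g (i, j))" by (intro sum_mono ap(2)) auto
      finally show ?thesis using rowg[OF i] assms(3) i by (simp flip: of_nat_mult)
    qed
    have le\<beta>: "\<beta>c j \<le> \<mu> j" if j: "j < length ys" for j
    proof -
      have "real (\<beta>c j) * length (ys ! j) = (\<Sum>i\<in>{i. (i, j) \<in> \<pi>}. real (\<beta> (i, j) * length (ys ! snd (i, j))))"
        by (simp add: \<beta>c_def sum_distrib_right)
      also have "\<dots> \<le> (\<Sum>i\<in>{i. (i, j) \<in> \<pi>}. cellsum xs ys indy g (i, j))" by (intro sum_mono ap(3)) auto
      also have "\<dots> = S * b j * length (ys ! j)" using colg[OF j] .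
      finally have "real (\<beta>c j) \<le> S * b j" using assms(4) j by simp
      then show ?thesis using \<mu>(1)[of j] by linarith
    qed
    define q0 where "q0 = concat (map p L)"
    have "edit_path q0 (concat (map (\<lambda>c. pw (xs ! fst c) (\<alpha> c)) L)) (concat (map (\<lambda>c. pw (ys ! snd c) (\<beta> c)) L))"
      unfolding q0_def using ap(1) L(1) by (intro edit_path_concat) auto
    then have q0: "edit_path q0 (wordof xs \<alpha>r) (wordof ys \<beta>c)"
      unfolding wordof_latt[OF assms(1,2) L(2,3)] \<alpha>r_def \<beta>c_def L(1) .
    obtain q where q: "edit_path q (wordof xs \<nu>) (wordof ys \<mu>)"
      "wgt q + length (wordof xs \<alpha>r) + length (wordof ys \<beta>c) = wgt q0 + length (wordof xs \<nu>) + length (wordof ys \<mu>)"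
      "length q + length (wordof xs \<alpha>r) + length (wordof ys \<beta>c) = length q0 + length (wordof xs \<nu>) + length (wordof ys \<mu>)"
      using edit_path_subseq[OF subseq_wordof[of xs \<alpha>r \<nu>] subseq_wordof[of ys \<beta>c \<mu>] q0] le\<alpha> le\<beta> by blast
    have wq0: "real (wgt q0) = (\<Sum>c\<in>\<pi>. real (wgt (p c)))" "real (length q0) = (\<Sum>c\<in>\<pi>. real (length (p c)))"
      unfolding q0_def wgt_concat length_concat map_map comp_def L(1)
      using latt_distinct[OF L(2)] by (simp_all add: sum_list_distinct_conv_sum_set)
    have lx: "real (length (wordof xs \<alpha>r)) = (\<Sum>c\<in>\<pi>. real (\<alpha> c * length (xs ! fst c)))"
      "real (length (wordof ys \<beta>c)) = (\<Sum>c\<in>\<pi>. real (\<beta> c * length (ys ! snd c)))"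
      unfolding \<alpha>r_def \<beta>c_def by (rule length_latt_words[OF sub])+
    have lX: "N = (\<Sum>c\<in>\<pi>. cellsum xs ys indx g c)"
      unfolding sum_rows[OF sub, symmetric] using rowg by (simp add: Neq)
    have lYeq: "(\<Sum>c\<in>\<pi>. cellsum xs ys indy g c) = (\<Sum>j<length ys. S * b j * length (ys ! j))"
      unfolding sum_cols[OF sub, symmetric] using colg by simp
    have "(\<Sum>j<length ys. S * b j * length (ys ! j)) \<le> (\<Sum>j<length ys. real (\<mu> j) * length (ys ! j))"
      using \<mu> by (intro sum_mono mult_right_mono) auto
    then have lY1: "(\<Sum>c\<in>\<pi>. cellsum xs ys indy g c) \<le> length (wordof ys \<mu>)" by (simp add: lYeq length_wordof)
    have "(\<Sum>j<length ys. real (\<mu> j) * length (ys ! j))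
       \<le> (\<Sum>j<length ys. (S * b j + (\<Sum>s<r. real (vs s j))) * length (ys ! j))"
      using \<mu> by (intro sum_mono mult_right_mono) auto
    also have "\<dots> = (\<Sum>j<length ys. S * b j * length (ys ! j)) + K2"
      by (simp add: K2_def algebra_simps sum.distrib)
    finally have lY2: "length (wordof ys \<mu>) \<le> (\<Sum>c\<in>\<pi>. cellsum xs ys indy g c) + K2" by (simp add: lYeq length_wordof)
    have Ksum: "(\<Sum>c\<in>\<pi>. Kc c) + K2 \<le> K"
      unfolding K_def using sum_mono_cells(1)[where K = Kc, OF sub Kc(1)] by simp
    \<comment> \<open>The filler is what \<open>q0\<close> leaves open in \<open>x\<close> and
      \<open>y\<close>. The cellwise estimate already charges it, except for the at most
      \<open>K2\<close> letters due to rounding up the periods.\<close>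
    have "(\<Sum>c\<in>\<pi>. wgt (p c) + (cellsum xs ys indx g c - real (\<alpha> c * length (xs ! fst c)))
           + (cellsum xs ys indy g c - real (\<beta> c * length (ys ! snd c)))) \<le> (\<Sum>c\<in>\<pi>. cellcost xs ys g c + Kc c)"
      by (intro sum_mono ap(4))
    also have "\<dots> = S * lp_obj xs ys \<pi> f + (\<Sum>c\<in>\<pi>. Kc c)"
      unfolding lp_obj_eq gs sum.distrib sum_distrib_left ..
    finally have w: "wgt q \<le> S * lp_obj xs ys \<pi> f + K"
      using q(2) wq0(1) lx lX lY2 Ksum N_def by (simp add: sum.distrib sum_subtractf del: of_nat_mult)
    have "(\<Sum>c\<in>\<pi>. cellsum xs ys (\<lambda>_. 1) g c) \<le> (\<Sum>c\<in>\<pi>. length (p c) + (cellsum xs ys indx g c - real (\<alpha> c * length (xs ! fst c)))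
           + (cellsum xs ys indy g c - real (\<beta> c * length (ys ! snd c))) + Kc c)"
      by (intro sum_mono ap(5))
    moreover have "(\<Sum>c\<in>\<pi>. cellsum xs ys (\<lambda>_. 1) g c) = S"
      unfolding gs using fs(5) by (simp flip: sum_distrib_left)
    ultimately have l: "S - K \<le> length q"
      using q(3) wq0(2) lx lX lY1 Ksum K2 N_def by (simp add: sum.distrib sum_subtractf del: of_nat_mult)
    let ?o = "lp_obj xs ys \<pi> f"
    have o: "0 \<le> ?o" "?o \<le> 1" using lp_obj_bounds[OF feas] by auto
    have pos: "0 < N - K" "N - K \<le> S - K" using N S by auto
    have "ned (wordof xs \<nu>) (wordof ys \<mu>) \<le> wgt q / length q" by (rule ned_le[OF q(1)])
    \<comment> \<open>\<open>K\<close> enters twice, as extra weight and as lost length; an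
      objective of at most 1 merges both into \<open>2 * K\<close>.\<close>
    also have "\<dots> \<le> (S * ?o + K) / (S - K)" using w l pos o S K by (intro frac_le) auto
    also have "\<dots> = ?o + (?o * K + K) / (S - K)" using pos by (simp add: field_simps)
    also have "\<dots> \<le> ?o + (2 * K) / (N - K)"
      using o K pos mult_right_mono[OF o(2) K] by (intro add_left_mono frac_le) auto
    finally show "\<exists>t::nat \<Rightarrow> nat. ned (wordof xs \<nu>) (wordof ys (\<lambda>j. \<Sum>s<r. t s * vs s j))
        \<le> lp_obj xs ys \<pi> f + 2 * K / (length (wordof xs \<nu>) - K)"
      unfolding \<mu>_def N_def by blast
  qed
qed

subsection \<open>From an edit path to a flow\<close>

lemma nth_pw: "t < a * length u \<Longrightarrow> pw u a ! t = u ! (t mod length u)"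
proof (induction a arbitrary: t)
  case (Suc a)
  then show ?case by (cases "t < length u") (auto simp: nth_append le_mod_geq)
qed simp

lemma factor_at_sublist:
  assumes "sublist X (pw u a)"
  shows "\<exists>l. factor_at u l X"
proof -
  obtain A B where AB: "pw u a = A @ X @ B" using assms by (auto simp: sublist_def)
  have "X ! t = u ! ((length A + t) mod length u)" if "t < length X" for t
  proof -
    have "length A + t < a * length u" using arg_cong[OF AB, of length] that by (simp add: length_pw)
    from nth_pw[OF this] show ?thesis using that by (simp add: AB nth_append)
  qed
  then show ?thesis unfolding factor_at_def by blast
qed

text \<open>Length is bounded below and cost above, since their quotient is to be bounded above; the
  row and column constraints need both directions.\<close>

definition flow_of_path :: "'a list list \<Rightarrow> 'a list list \<Rightarrow> real \<Rightarrow> (nat \<Rightarrow> nat) \<Rightarrow> (nat \<Rightarrow> nat)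
    \<Rightarrow> ('a option \<times> 'a option) list \<Rightarrow> (nat \<times> nat) set \<Rightarrow> (nat \<times> nat \<Rightarrow> edge \<Rightarrow> real) \<Rightarrow> bool" where
  "flow_of_path xs ys K \<nu> \<mu> p \<pi> g \<longleftrightarrow> (\<forall>c\<in>\<pi>. circ (xs ! fst c) (ys ! snd c) (g c))
       \<and> length p \<le> (\<Sum>c\<in>\<pi>. cellsum xs ys (\<lambda>_. 1) g c)
       \<and> (\<Sum>c\<in>\<pi>. cellcost xs ys g c) \<le> real (wgt p) + K
       \<and> (\<forall>i<length xs. \<bar>(\<Sum>j\<in>{j. (i, j) \<in> \<pi>}. cellsum xs ys indx g (i, j)) - real (\<nu> i * length (xs ! i))\<bar> \<le> K)
       \<and> (\<forall>j<length ys. \<bar>(\<Sum>i\<in>{i. (i, j) \<in> \<pi>}. cellsum xs ys indy g (i, j)) - real (\<mu> j * length (ys ! j))\<bar> \<le> K)"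

lemma edit_path_flow:
  fixes xs ys :: "'a list list"
  assumes "xs \<noteq> []" "ys \<noteq> []" "\<forall>x\<in>set xs. x \<noteq> []" "\<forall>y\<in>set ys. y \<noteq> []"
  shows "\<exists>K::real. 0 \<le> K \<and> (\<forall>\<nu> \<mu> p. edit_path p (wordof xs \<nu>) (wordof ys \<mu>) \<longrightarrow>
     (\<exists>\<pi>\<in>Interl (length xs) (length ys). \<exists>g. flow_of_path xs ys K \<nu> \<mu> p \<pi> g))"
proof -
  have nm: "0 < length xs" "0 < length ys" using assms by auto
  let ?R = "{..<length xs} \<times> {..<length ys}"
  define Kc where "Kc c = 2 * real (length (xs ! fst c)) + 2 * real (length (ys ! snd c))" for c
  define K where "K = (\<Sum>c\<in>?R. Kc c)"
  have Kc: "0 \<le> Kc c" for c by (simp add: Kc_def)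
  have K: "0 \<le> K" unfolding K_def using Kc by (intro sum_nonneg) auto
  show ?thesis
  proof (intro exI[of _ K] conjI allI impI K)
    fix \<nu> \<mu> p assume p: "edit_path p (wordof xs \<nu>) (wordof ys \<mu>)"
    define U V where "U i = pw (xs ! i) (\<nu> i)" and "V j = pw (ys ! j) (\<mu> j)" for i j
    have "edit_path p (concat (map U [0..<Suc (length xs - 1)])) (concat (map V [0..<Suc (length ys - 1)]))"
      using p nm by (simp add: wordof_eq U_def[abs_def] V_def[abs_def] del: upt_Suc)
    from grid_split_exists[OF _ _ this] have "grid_split (length xs - 1) (length ys - 1) 0 0 U V p" by simp
    then obtain L P X Y where L: "latt (length xs - 1) (length ys - 1) L" "hd L = (0, 0)"
     "\<And>c. c\<in>set L \<Longrightarrow> edit_path (P c) (X c) (Y c) \<and> sublist (X c) (U (fst c)) \<and> sublist (Y c) (V (snd c))"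
     "p = concat (map P L)"
     "\<forall>i'\<in>{0..length xs - 1}. (\<Sum>j'\<in>{j'. (i', j') \<in> set L}. length (X (i', j'))) = length (U i')"
     "\<forall>j'\<in>{0..length ys - 1}. (\<Sum>i'\<in>{i'. (i', j') \<in> set L}. length (Y (i', j'))) = length (V j')"
      unfolding grid_split_def by blast
    define \<pi> where "\<pi> = set L"
    have \<pi>: "\<pi> \<in> Interl (length xs) (length ys)" unfolding Interl_iff[OF nm] \<pi>_def using L by blast
    have sub: "\<pi> \<subseteq> ?R" using Interl_subset[OF nm \<pi>] .
    define Q where "Q c g \<longleftrightarrow> circ (xs ! fst c) (ys ! snd c) g
      \<and> length (P c) \<le> wsum (xs ! fst c) (ys ! snd c) (\<lambda>_. 1) g
      \<and> wsum (xs ! fst c) (ys ! snd c) (\<lambda>_. 1) g \<le> length (P c) + Kc c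
      \<and> wsum (xs ! fst c) (ys ! snd c) (ecost (xs ! fst c) (ys ! snd c)) g \<le> wgt (P c) + Kc c
      \<and> length (X c) \<le> wsum (xs ! fst c) (ys ! snd c) indx g \<and> wsum (xs ! fst c) (ys ! snd c) indx g \<le> length (X c) + Kc c
      \<and> length (Y c) \<le> wsum (xs ! fst c) (ys ! snd c) indy g \<and> wsum (xs ! fst c) (ys ! snd c) indy g \<le> length (Y c) + Kc c" for c g
    have "\<forall>c\<in>\<pi>. \<exists>g. Q c g"
    proof
      fix c assume c: "c \<in> \<pi>"
      obtain l k where "factor_at (xs ! fst c) l (X c)" "factor_at (ys ! snd c) k (Y c)"
        using L(3)[of c] c factor_at_sublist unfolding \<pi>_def U_def V_def by metis
      moreover have "xs ! fst c \<noteq> []" "ys ! snd c \<noteq> []" using c sub assms by auto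
      ultimately show "\<exists>g. Q c g" unfolding Q_def
        using edit_path_circ[OF _ _ _ _ _ Kc_def[of c]] L(3)[of c] c \<pi>_def by blast
    qed
    then obtain g where "\<And>c. c \<in> \<pi> \<Longrightarrow> Q c (g c)" by metis
    then have g: "\<And>c. c \<in> \<pi> \<Longrightarrow> circ (xs ! fst c) (ys ! snd c) (g c)"
      "\<And>c. c \<in> \<pi> \<Longrightarrow> length (P c) \<le> cellsum xs ys (\<lambda>_. 1) g c"
      "\<And>c. c \<in> \<pi> \<Longrightarrow> cellsum xs ys (\<lambda>_. 1) g c \<le> length (P c) + Kc c"
      "\<And>c. c \<in> \<pi> \<Longrightarrow> cellcost xs ys g c \<le> wgt (P c) + Kc c"
      "\<And>c. c \<in> \<pi> \<Longrightarrow> length (X c) \<le> cellsum xs ys indx g c"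
      "\<And>c. c \<in> \<pi> \<Longrightarrow> cellsum xs ys indx g c \<le> length (X c) + Kc c"
      "\<And>c. c \<in> \<pi> \<Longrightarrow> length (Y c) \<le> cellsum xs ys indy g c"
      "\<And>c. c \<in> \<pi> \<Longrightarrow> cellsum xs ys indy g c \<le> length (Y c) + Kc c"
      unfolding Q_def by blast+
    have wp: "real (wgt p) = (\<Sum>c\<in>\<pi>. real (wgt (P c)))" "real (length p) = (\<Sum>c\<in>\<pi>. real (length (P c)))"
      unfolding L(4) wgt_concat length_concat map_map comp_def \<pi>_def
      using latt_distinct[OF L(1)] by (simp_all add: sum_list_distinct_conv_sum_set)
    note Ks = sum_mono_cells[where K = Kc, OF sub Kc, folded K_def]
    show "\<exists>\<pi>\<in>Interl (length xs) (length ys). \<exists>g. flow_of_path xs ys K \<nu> \<mu> p \<pi> g"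
    proof (rule bexI[OF _ \<pi>], rule exI[of _ g], unfold flow_of_path_def, intro conjI ballI allI impI)
      show "circ (xs ! fst c) (ys ! snd c) (g c)" if "c \<in> \<pi>" for c using g(1)[OF that] .
      show "length p \<le> (\<Sum>c\<in>\<pi>. cellsum xs ys (\<lambda>_. 1) g c)"
        unfolding wp by (intro sum_mono g(2))
      have "(\<Sum>c\<in>\<pi>. cellcost xs ys g c) \<le> (\<Sum>c\<in>\<pi>. wgt (P c) + Kc c)" by (intro sum_mono g(4))
      then show "(\<Sum>c\<in>\<pi>. cellcost xs ys g c) \<le> wgt p + K"
        unfolding wp sum.distrib using Ks(1) by linarith
    next
      fix i assume i: "i < length xs"
      have "real (\<nu> i * length (xs ! i)) = (\<Sum>j\<in>{j. (i, j) \<in> \<pi>}. real (length (X (i, j))))"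
        using L(5) i by (auto simp: U_def length_pw \<pi>_def simp flip: of_nat_sum of_nat_mult)
      moreover have "(\<Sum>j\<in>{j. (i, j) \<in> \<pi>}. real (length (X (i, j)))) \<le> (\<Sum>j\<in>{j. (i, j) \<in> \<pi>}. cellsum xs ys indx g (i, j))"
        by (intro sum_mono g(5)) simp
      moreover have "(\<Sum>j\<in>{j. (i, j) \<in> \<pi>}. cellsum xs ys indx g (i, j)) \<le> (\<Sum>j\<in>{j. (i, j) \<in> \<pi>}. length (X (i, j)) + Kc (i, j))"
        by (intro sum_mono g(6)) simp
      ultimately show "\<bar>(\<Sum>j\<in>{j. (i, j) \<in> \<pi>}. cellsum xs ys indx g (i, j)) - real (\<nu> i * length (xs ! i))\<bar> \<le> K"
        using Ks(2)[of i] unfolding sum.distrib by linarith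
    next
      fix j assume j: "j < length ys"
      have "real (\<mu> j * length (ys ! j)) = (\<Sum>i\<in>{i. (i, j) \<in> \<pi>}. real (length (Y (i, j))))"
        using L(6) j by (auto simp: V_def length_pw \<pi>_def simp flip: of_nat_sum of_nat_mult)
      moreover have "(\<Sum>i\<in>{i. (i, j) \<in> \<pi>}. real (length (Y (i, j)))) \<le> (\<Sum>i\<in>{i. (i, j) \<in> \<pi>}. cellsum xs ys indy g (i, j))"
        by (intro sum_mono g(7)) simp
      moreover have "(\<Sum>i\<in>{i. (i, j) \<in> \<pi>}. cellsum xs ys indy g (i, j)) \<le> (\<Sum>i\<in>{i. (i, j) \<in> \<pi>}. length (Y (i, j)) + Kc (i, j))"
        by (intro sum_mono g(8)) simp
      ultimately show "\<bar>(\<Sum>i\<in>{i. (i, j) \<in> \<pi>}. cellsum xs ys indy g (i, j)) - real (\<mu> j * length (ys ! j))\<bar> \<le> K"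
        using Ks(3)[of j] unfolding sum.distrib by linarith
    qed
  qed
qed

subsection \<open>Limits of flows\<close>

lemma tendsto_wsum:
  assumes "\<And>e. e \<in> cedges u v \<Longrightarrow> (\<lambda>n. g n e) \<longlonglongrightarrow> l e"
  shows "(\<lambda>n. wsum u v h (g n)) \<longlonglongrightarrow> wsum u v h l"
  unfolding wsum_def using assms by (intro tendsto_sum tendsto_mult tendsto_const) auto

lemma circ_limit:
  assumes "\<And>e. e \<in> cedges u v \<Longrightarrow> (\<lambda>n. g n e) \<longlonglongrightarrow> l e" "\<And>n. circ u v (g n)"
  shows "circ u v l"
  unfolding circ_def
proof (intro conjI ballI)
  fix e assume e: "e \<in> cedges u v"
  show "0 \<le> l e" using assms(2) e by (intro LIMSEQ_le_const[OF assms(1)[OF e]]) (auto simp: circ_def)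
next
  fix w assume w: "w \<in> cverts u v"
  have "(\<lambda>n. \<Sum>e\<in>{e\<in>cedges u v. esrc u v e = w}. g n e) \<longlonglongrightarrow> (\<Sum>e\<in>{e\<in>cedges u v. esrc u v e = w}. l e)"
    using assms(1) by (intro tendsto_sum) auto
  moreover have "(\<lambda>n. \<Sum>e\<in>{e\<in>cedges u v. etgt u v e = w}. g n e) \<longlonglongrightarrow> (\<Sum>e\<in>{e\<in>cedges u v. etgt u v e = w}. l e)"
    using assms(1) by (intro tendsto_sum) auto
  moreover have "(\<Sum>e\<in>{e\<in>cedges u v. esrc u v e = w}. g n e) = (\<Sum>e\<in>{e\<in>cedges u v. etgt u v e = w}. g n e)" for n
    using assms(2)[of n] w by (auto simp: circ_def)
  ultimately show "(\<Sum>e\<in>{e\<in>cedges u v. esrc u v e = w}. l e) = (\<Sum>e\<in>{e\<in>cedges u v. etgt u v e = w}. l e)"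
    using LIMSEQ_unique by simp
qed

lemma dirv_nonneg: "0 \<le> dirv xs \<nu> i"
  unfolding dirv_def by (intro divide_nonneg_nonneg sum_nonneg) auto

lemma dirv_eq: "dirv xs \<nu> i = real (\<nu> i) / real (length (wordof xs \<nu>))"
  by (simp add: dirv_def length_wordof)

lemma sum_dirv:
  assumes "wordof xs \<nu> \<noteq> []"
  shows "(\<Sum>i<length xs. dirv xs \<nu> i * real (length (xs ! i))) = 1"
proof -
  have "(\<Sum>i<length xs. dirv xs \<nu> i * real (length (xs ! i)))
     = (\<Sum>i<length xs. real (\<nu> i * length (xs ! i))) / real (length (wordof xs \<nu>))"
    unfolding dirv_eq by (simp add: sum_divide_distrib)
  also have "(\<Sum>i<length xs. real (\<nu> i * length (xs ! i))) = real (length (wordof xs \<nu>))"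
    by (simp only: length_wordof of_nat_sum)
  also have "real (length (wordof xs \<nu>)) / real (length (wordof xs \<nu>)) = 1" using assms by simp
  finally show ?thesis .
qed

text \<open>There are finitely many interleavings and LP variables, and division by the total flow
  bounds the variables, so compactness applies. The errors of \<open>flow_of_path\<close> stay
  bounded while the total grows, hence the limit meets the equations exactly.\<close>

lemma OPT_le_of_edit_paths:
  fixes xs ys :: "'a list list" and vs :: "nat \<Rightarrow> nat \<Rightarrow> nat"
  assumes ne: "xs \<noteq> []" "ys \<noteq> []" "\<forall>x\<in>set xs. x \<noteq> []" "\<forall>y\<in>set ys. y \<noteq> []"
    and p: "\<And>k. edit_path (p k) (wordof xs (\<nu> k)) (wordof ys (\<lambda>j. \<Sum>s<r. t k s * vs s j))"
    and ratio: "\<And>k. real (wgt (p k)) / real (length (p k)) \<le> c + inverse (real (Suc k))"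
    and len: "\<And>k. Suc k \<le> length (wordof xs (\<nu> k))"
    and lim: "\<And>i. (\<lambda>k. dirv xs (\<nu> k) i) \<longlonglongrightarrow> a i"
  shows "\<exists>\<pi>\<in>Interl (length xs) (length ys). OPT xs ys r vs a \<pi> \<le> c"
proof -
  have nm: "0 < length xs" "0 < length ys" using ne by auto
  define \<mu> where "\<mu> k j = (\<Sum>s<r. t k s * vs s j)" for k j
  obtain K where K: "0 \<le> K" "\<And>\<nu> \<mu> p. edit_path p (wordof xs \<nu>) (wordof ys \<mu>) \<Longrightarrow>
     \<exists>\<pi>\<in>Interl (length xs) (length ys). \<exists>g. flow_of_path xs ys K \<nu> \<mu> p \<pi> g"
    using edit_path_flow[OF ne] by blast
  have "\<exists>\<pi> g. \<pi> \<in> Interl (length xs) (length ys) \<and> flow_of_path xs ys K (\<nu> k) (\<mu> k) (p k) \<pi> g" for k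
    using K(2)[OF p[of k]] unfolding \<mu>_def by blast
  then obtain \<pi> g where \<pi>: "\<And>k. \<pi> k \<in> Interl (length xs) (length ys)"
    and fl: "\<And>k. flow_of_path xs ys K (\<nu> k) (\<mu> k) (p k) (\<pi> k) (g k)"
    by metis
  have g: "\<And>k c. c \<in> \<pi> k \<Longrightarrow> circ (xs ! fst c) (ys ! snd c) (g k c)"
      "\<And>k. length (p k) \<le> (\<Sum>c\<in>\<pi> k. cellsum xs ys (\<lambda>_. 1) (g k) c)"
      "\<And>k. (\<Sum>c\<in>\<pi> k. cellcost xs ys (g k) c) \<le> wgt (p k) + K"
      "\<And>k i. i < length xs \<Longrightarrow> \<bar>(\<Sum>j\<in>{j. (i, j) \<in> \<pi> k}. cellsum xs ys indx (g k) (i, j)) - real (\<nu> k i * length (xs ! i))\<bar> \<le> K"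
      "\<And>k j. j < length ys \<Longrightarrow> \<bar>(\<Sum>i\<in>{i. (i, j) \<in> \<pi> k}. cellsum xs ys indy (g k) (i, j)) - real (\<mu> k j * length (ys ! j))\<bar> \<le> K"
    using fl unfolding flow_of_path_def by blast+
  have "finite (range \<pi>)" by (rule finite_subset[OF _ finite_Interl[OF nm]]) (use \<pi> in auto)
  \<comment> \<open>The interleaving must be constant along the sequence before the flows can be
    compared coordinatewise.\<close>
  from pigeonhole_infinite[OF infinite_UNIV_nat this]
  obtain k0 where "infinite {k \<in> UNIV. \<pi> k = \<pi> k0}" by blast
  from infinite_enumerate[OF this]
  obtain \<rho> :: "nat \<Rightarrow> nat" where \<rho>: "strict_mono \<rho>" "\<And>n. \<pi> (\<rho> n) = \<pi> k0" by blast
  define \<pi>0 where "\<pi>0 = \<pi> k0"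
  have \<pi>0: "\<pi>0 \<in> Interl (length xs) (length ys)" using \<pi> by (simp add: \<pi>0_def)
  have sub: "\<pi>0 \<subseteq> {..<length xs} \<times> {..<length ys}" using Interl_subset[OF nm \<pi>0] .
  then have fin: "finite \<pi>0" by (rule finite_subset) simp
  define G where "G k = (\<Sum>c\<in>\<pi>0. cellsum xs ys (\<lambda>_. 1) (g k) c)" for k
  define N where "N k = real (length (wordof xs (\<nu> k)))" for k
  define f where "f k c = (\<lambda>e. g k c e / G k)" for k c
  \<comment> \<open>A period that vanishes on all blocks leaves the word unchanged, so no length
    bounds its coefficient; the value 0 keeps the sequence bounded.\<close>
  define \<tau> where "\<tau> k s = (if \<forall>j<length ys. vs s j = 0 then 0 else real (t k s) / G k)" for k s
  have fsum: "cellsum xs ys h (f k) c = cellsum xs ys h (g k) c / G k" for h k c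
    unfolding f_def wsum_divide ..
  have Nk: "real (Suc k) \<le> N k" for k using len[of k] by (simp only: N_def of_nat_le_iff)
  \<comment> \<open>An edit path is at least as long as either word. This keeps
    \<open>N k / G k\<close>, which plays the role of \<open>lam\<close>, within the unit
    interval.\<close>
  have good: "N k \<le> G k \<and> real (length (wordof ys (\<mu> k))) \<le> G k \<and> length (p k) \<le> G k \<and> N k \<le> length (p k)"
    if "\<pi> k = \<pi>0" for k
    using g(2)[of k] edit_path_length_bounds[OF p[of k]] that unfolding G_def N_def \<mu>_def by auto
  have Gpos: "0 < G k" if "\<pi> k = \<pi>0" for k using good[OF that] Nk[of k] by linarith
  have fcirc: "circ (xs ! fst c) (ys ! snd c) (f k c)" if "\<pi> k = \<pi>0" "c \<in> \<pi>0" for k c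
    using circ_scale[OF g(1)[of c k], of "1 / G k"] that Gpos[of k] by (simp add: f_def)
  have f1: "(\<Sum>c\<in>\<pi>0. cellsum xs ys (\<lambda>_. 1) (f k) c) = 1" if "\<pi> k = \<pi>0" for k
    unfolding fsum using Gpos[OF that] by (simp flip: sum_divide_distrib add: G_def)
  have fbound: "0 \<le> f k c e \<and> f k c e \<le> 1" if "\<pi> k = \<pi>0" "c \<in> \<pi>0" "e \<in> cedges (xs ! fst c) (ys ! snd c)" for k c e
  proof -
    have nn: "0 \<le> f k c' e'" if "c' \<in> \<pi>0" "e' \<in> cedges (xs ! fst c') (ys ! snd c')" for c' e'
      using fcirc[OF \<open>\<pi> k = \<pi>0\<close> that(1)] that(2) by (auto simp: circ_def)
    have "f k c e \<le> (\<Sum>e\<in>cedges (xs ! fst c) (ys ! snd c). f k c e)"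
      using that nn by (intro member_le_sum finite_cedges) auto
    also have "\<dots> = cellsum xs ys (\<lambda>_. 1) (f k) c" by (simp add: wsum_def)
    also have "\<dots> \<le> (\<Sum>c\<in>\<pi>0. cellsum xs ys (\<lambda>_. 1) (f k) c)"
      using that fcirc fin by (intro member_le_sum wsum_nonneg) auto
    finally show ?thesis using f1[OF that(1)] nn that by auto
  qed
  have \<mu>len: "real (\<mu> k j) \<le> G k" if "\<pi> k = \<pi>0" "j < length ys" for k j
  proof -
    have "\<mu> k j \<le> \<mu> k j * length (ys ! j)" using ne(4) that(2) by (simp add: Suc_le_eq)
    also have "\<dots> \<le> length (wordof ys (\<mu> k))"
      unfolding length_wordof using that(2) by (intro member_le_sum) auto
    finally show ?thesis using good[OF that(1)] by linarith
  qed
  have \<tau>bound: "0 \<le> \<tau> k s \<and> \<tau> k s \<le> 1" if k: "\<pi> k = \<pi>0" and s: "s < r" for k s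
  proof (cases "\<forall>j<length ys. vs s j = 0")
    case False
    then obtain j where j: "j < length ys" "vs s j \<noteq> 0" by auto
    have "t k s \<le> t k s * vs s j" using j by simp
    also have "\<dots> \<le> \<mu> k j" unfolding \<mu>_def using s by (intro member_le_sum) auto
    finally have "real (t k s) \<le> G k" using \<mu>len[OF k j(1)] by linarith
    then show ?thesis using Gpos[OF k] by (simp add: \<tau>_def)
  qed (simp add: \<tau>_def)
  have \<tau>sum: "(\<Sum>s<r. \<tau> k s * real (vs s j)) = real (\<mu> k j) / G k" if "j < length ys" for k j
  proof -
    have "(\<Sum>s<r. \<tau> k s * real (vs s j)) = (\<Sum>s<r. real (t k s * vs s j) / G k)"
      using that by (intro sum.cong) (auto simp: \<tau>_def)
    then show ?thesis by (simp add: \<mu>_def sum_divide_distrib)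
  qed

  \<comment> \<open>All LP variables as one function, so that a single subsequence makes them
    converge: flow values on the left summand; on the right, \<open>lam\<close> at 0 and
    \<open>\<tau> s\<close> at \<open>Suc s\<close>.\<close>
  define H where "H k x = (case x of Inl ce \<Rightarrow> f k (fst ce) (snd ce) | Inr q \<Rightarrow> (case q of 0 \<Rightarrow> N k / G k | Suc s \<Rightarrow> \<tau> k s))"
    for k and x :: "((nat \<times> nat) \<times> edge) + nat"
  define S where "S = Inl ` (SIGMA c:\<pi>0. cedges (xs ! fst c) (ys ! snd c)) \<union> Inr ` {..r}"
  have "finite S" unfolding S_def using fin finite_cedges by auto
  then have "countable S" by (rule countable_finite)
  moreover have "norm (H (\<rho> n) x) \<le> 1" if x: "x \<in> S" for n x
  proof -
    have k: "\<pi> (\<rho> n) = \<pi>0" using \<rho> by (simp add: \<pi>0_def)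
    consider c e where "x = Inl (c, e)" "c \<in> \<pi>0" "e \<in> cedges (xs ! fst c) (ys ! snd c)"
      | "x = Inr 0" | s where "x = Inr (Suc s)" "s < r"
      using x unfolding S_def by (auto simp: less_eq_Suc_le) (metis not0_implies_Suc)
    then show ?thesis
    proof cases
      case 1
      then show ?thesis using fbound[OF k 1(2,3)] by (simp add: H_def)
    next
      case 2
      then show ?thesis using good[OF k] Gpos[OF k] Nk[of "\<rho> n"] by (simp add: H_def)
    next
      case 3
      then show ?thesis using \<tau>bound[OF k 3(2)] by (simp add: H_def)
    qed
  qed
  ultimately obtain \<kappa> where \<kappa>: "strict_mono \<kappa>" "\<And>x. x \<in> S \<Longrightarrow> \<exists>l. (\<lambda>n. H (\<rho> (\<kappa> n)) x) \<longlonglongrightarrow> l"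
    using function_convergent_subsequence[of S "\<lambda>n. H (\<rho> n)" 1] by metis
  then obtain l where l: "\<And>x. x \<in> S \<Longrightarrow> (\<lambda>n. H (\<rho> (\<kappa> n)) x) \<longlonglongrightarrow> l x" by metis
  define \<theta> where "\<theta> n = \<rho> (\<kappa> n)" for n
  have \<theta>mono: "strict_mono \<theta>" using \<rho>(1) \<kappa>(1) by (auto simp: strict_mono_def \<theta>_def)
  have \<theta>ge: "n \<le> \<theta> n" for n by (rule strict_mono_imp_increasing[OF \<theta>mono])
  have \<theta>: "\<pi> (\<theta> n) = \<pi>0" for n using \<rho> by (simp add: \<pi>0_def \<theta>_def)
  define fl where "fl c e = l (Inl (c, e))" for c e
  define \<Lambda> where "\<Lambda> = l (Inr 0)"
  define \<tau>l where "\<tau>l s = l (Inr (Suc s))" for s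
  have limf: "(\<lambda>n. f (\<theta> n) c e) \<longlonglongrightarrow> fl c e" if "c \<in> \<pi>0" "e \<in> cedges (xs ! fst c) (ys ! snd c)" for c e
    using l[of "Inl (c, e)"] that by (auto simp: S_def H_def fl_def \<theta>_def)
  have lim\<Lambda>: "(\<lambda>n. N (\<theta> n) / G (\<theta> n)) \<longlonglongrightarrow> \<Lambda>"
    using l[of "Inr 0"] by (auto simp: S_def H_def \<Lambda>_def \<theta>_def)
  have lim\<tau>: "(\<lambda>n. \<tau> (\<theta> n) s) \<longlonglongrightarrow> \<tau>l s" if "s < r" for s
    using l[of "Inr (Suc s)"] that by (auto simp: S_def H_def \<tau>l_def \<theta>_def)
  have limdir: "(\<lambda>n. dirv xs (\<nu> (\<theta> n)) i) \<longlonglongrightarrow> a i" for i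
    using LIMSEQ_subseq_LIMSEQ[OF lim[of i] \<theta>mono] by (simp add: comp_def)
  have limw: "(\<lambda>n. cellsum xs ys h (f (\<theta> n)) c) \<longlonglongrightarrow> cellsum xs ys h fl c" if "c \<in> \<pi>0" for c h
    using limf[OF that] by (rule tendsto_wsum)
  have Gge: "real (Suc n) \<le> G (\<theta> n)" for n
    using good[OF \<theta>[of n]] Nk[of "\<theta> n"] \<theta>ge[of n] by linarith
  have KG: "K / G (\<theta> n) \<le> K * inverse (real (Suc n))" for n
    using K(1) Gge[of n] by (simp add: divide_inverse mult_left_mono le_imp_inverse_le del: of_nat_Suc)
  have K0: "(\<lambda>n. K * inverse (real (Suc n))) \<longlonglongrightarrow> 0"
    using tendsto_mult[OF tendsto_const LIMSEQ_inverse_real_of_nat, of K] by simp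
  \<comment> \<open>The total flow exceeds all bounds, so the error \<open>K / G\<close> disappears;
    this turns the approximate row and column constraints into equations.\<close>
  have null: "x = y" if "X \<longlonglongrightarrow> x" "Y \<longlonglongrightarrow> y" "\<And>n. \<bar>X n - Y n\<bar> \<le> K / G (\<theta> n)" for X Y :: "nat \<Rightarrow> real" and x y
  proof -
    have "(\<lambda>n. X n - Y n) \<longlonglongrightarrow> 0"
    proof (rule Lim_null_comparison[OF _ K0], intro always_eventually allI)
      show "norm (X n - Y n) \<le> K * inverse (real (Suc n))" for n
        unfolding real_norm_def using that(3)[of n] KG[of n] by (rule order.trans)
    qed
    then show ?thesis using LIMSEQ_unique[OF tendsto_diff[OF that(1,2)]] by fastforce
  qed

  have circl: "circ (xs ! fst c) (ys ! snd c) (fl c)" if "c \<in> \<pi>0" for c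
    by (rule circ_limit[where g = "\<lambda>n. f (\<theta> n) c"]) (rule limf[OF that] fcirc[OF \<theta> that]; assumption?)+
  have total: "(\<Sum>c\<in>\<pi>0. cellsum xs ys (\<lambda>_. 1) fl c) = 1"
  proof -
    have "(\<lambda>n. \<Sum>c\<in>\<pi>0. cellsum xs ys (\<lambda>_. 1) (f (\<theta> n)) c) \<longlonglongrightarrow> (\<Sum>c\<in>\<pi>0. cellsum xs ys (\<lambda>_. 1) fl c)"
      by (intro tendsto_sum limw)
    then show ?thesis unfolding f1[OF \<theta>] using LIMSEQ_unique tendsto_const by blast
  qed
  have rows: "(\<Sum>j\<in>{j. (i, j) \<in> \<pi>0}. cellsum xs ys indx fl (i, j)) = real (length (xs ! i)) * a i * \<Lambda>"
    if i: "i < length xs" for i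
  proof (rule null)
    show "(\<lambda>n. \<Sum>j\<in>{j. (i, j) \<in> \<pi>0}. cellsum xs ys indx (f (\<theta> n)) (i, j)) \<longlonglongrightarrow> (\<Sum>j\<in>{j. (i, j) \<in> \<pi>0}. cellsum xs ys indx fl (i, j))"
      by (intro tendsto_sum limw) simp
    show "(\<lambda>n. real (length (xs ! i)) * dirv xs (\<nu> (\<theta> n)) i * (N (\<theta> n) / G (\<theta> n))) \<longlonglongrightarrow> real (length (xs ! i)) * a i * \<Lambda>"
      by (intro tendsto_mult tendsto_const limdir lim\<Lambda>)
    fix n
    \<comment> \<open>The normalising length inside \<open>dirv\<close> cancels against the
      numerator of \<open>N / G\<close>.\<close>
    have "real (length (xs ! i)) * dirv xs (\<nu> (\<theta> n)) i * (N (\<theta> n) / G (\<theta> n)) = real (\<nu> (\<theta> n) i * length (xs ! i)) / G (\<theta> n)"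
      using Nk[of "\<theta> n"] by (simp add: dirv_eq flip: N_def)
    moreover have "(\<Sum>j\<in>{j. (i, j) \<in> \<pi>0}. cellsum xs ys indx (f (\<theta> n)) (i, j)) = (\<Sum>j\<in>{j. (i, j) \<in> \<pi>0}. cellsum xs ys indx (g (\<theta> n)) (i, j)) / G (\<theta> n)"
      unfolding fsum by (rule sum_divide_distrib[symmetric])
    ultimately show "\<bar>(\<Sum>j\<in>{j. (i, j) \<in> \<pi>0}. cellsum xs ys indx (f (\<theta> n)) (i, j)) - real (length (xs ! i)) * dirv xs (\<nu> (\<theta> n)) i * (N (\<theta> n) / G (\<theta> n))\<bar> \<le> K / G (\<theta> n)"
      using g(4)[OF i, of "\<theta> n"] Gpos[OF \<theta>[of n]] unfolding \<theta>
      by (simp only: diff_divide_distrib[symmetric] abs_divide) (simp add: divide_right_mono)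
  qed
  have cols: "(\<Sum>i\<in>{i. (i, j) \<in> \<pi>0}. cellsum xs ys indy fl (i, j)) = real (length (ys ! j)) * (\<Sum>s<r. \<tau>l s * real (vs s j))"
    if j: "j < length ys" for j
  proof (rule null)
    show "(\<lambda>n. \<Sum>i\<in>{i. (i, j) \<in> \<pi>0}. cellsum xs ys indy (f (\<theta> n)) (i, j)) \<longlonglongrightarrow> (\<Sum>i\<in>{i. (i, j) \<in> \<pi>0}. cellsum xs ys indy fl (i, j))"
      by (intro tendsto_sum limw) simp
    show "(\<lambda>n. real (length (ys ! j)) * (\<Sum>s<r. \<tau> (\<theta> n) s * real (vs s j))) \<longlonglongrightarrow> real (length (ys ! j)) * (\<Sum>s<r. \<tau>l s * real (vs s j))"
      by (intro tendsto_mult tendsto_const tendsto_sum lim\<tau>) simp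
    fix n
    have "real (length (ys ! j)) * (\<Sum>s<r. \<tau> (\<theta> n) s * real (vs s j)) = real (\<mu> (\<theta> n) j * length (ys ! j)) / G (\<theta> n)"
      unfolding \<tau>sum[OF j] by simp
    moreover have "(\<Sum>i\<in>{i. (i, j) \<in> \<pi>0}. cellsum xs ys indy (f (\<theta> n)) (i, j)) = (\<Sum>i\<in>{i. (i, j) \<in> \<pi>0}. cellsum xs ys indy (g (\<theta> n)) (i, j)) / G (\<theta> n)"
      unfolding fsum by (rule sum_divide_distrib[symmetric])
    ultimately show "\<bar>(\<Sum>i\<in>{i. (i, j) \<in> \<pi>0}. cellsum xs ys indy (f (\<theta> n)) (i, j)) - real (length (ys ! j)) * (\<Sum>s<r. \<tau> (\<theta> n) s * real (vs s j))\<bar> \<le> K / G (\<theta> n)"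
      using g(5)[OF j, of "\<theta> n"] Gpos[OF \<theta>[of n]] unfolding \<theta>
      by (simp only: diff_divide_distrib[symmetric] abs_divide) (simp add: divide_right_mono)
  qed
  have cost: "lp_obj xs ys \<pi>0 fl \<le> c"
  proof (rule LIMSEQ_le)
    show "(\<lambda>n. \<Sum>x\<in>\<pi>0. cellcost xs ys (f (\<theta> n)) x) \<longlonglongrightarrow> lp_obj xs ys \<pi>0 fl"
      unfolding lp_obj_eq by (intro tendsto_sum limw)
    show "(\<lambda>n. c + inverse (real (Suc n)) + K * inverse (real (Suc n))) \<longlonglongrightarrow> c"
      using tendsto_add[OF tendsto_add[OF tendsto_const LIMSEQ_inverse_real_of_nat] K0, of c] by simp
    have "(\<Sum>x\<in>\<pi>0. cellcost xs ys (f (\<theta> n)) x) \<le> c + inverse (real (Suc n)) + K * inverse (real (Suc n))" for n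
    proof -
      let ?k = "\<theta> n"
      have lp: "0 < real (length (p ?k))" "real (length (p ?k)) \<le> G ?k"
        using good[OF \<theta>[of n]] Nk[of ?k] by linarith+
      have "(\<Sum>x\<in>\<pi>0. cellcost xs ys (f ?k) x) = (\<Sum>x\<in>\<pi>0. cellcost xs ys (g ?k) x) / G ?k"
        unfolding fsum by (rule sum_divide_distrib[symmetric])
      also have "\<dots> \<le> (wgt (p ?k) + K) / G ?k"
        using g(3)[of ?k] Gpos[OF \<theta>[of n]] unfolding \<theta> by (intro divide_right_mono) auto
      also have "\<dots> = wgt (p ?k) / G ?k + K / G ?k" by (rule add_divide_distrib)
      \<comment> \<open>The total flow is at least the path length, so normalising by it can only
        lower the ratio.\<close>
      also have "\<dots> \<le> wgt (p ?k) / length (p ?k) + K * inverse (real (Suc n))"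
        using lp KG[of n] Gpos[OF \<theta>[of n]] by (intro add_mono divide_left_mono mult_pos_pos) auto
      also have "\<dots> \<le> c + inverse (real (Suc ?k)) + K * inverse (real (Suc n))" using ratio[of ?k] by linarith
      also have "inverse (real (Suc ?k)) \<le> inverse (real (Suc n))"
        using \<theta>ge[of n] by (intro le_imp_inverse_le) auto
      finally show ?thesis by simp
    qed
    then show "\<exists>N. \<forall>n\<ge>N. (\<Sum>x\<in>\<pi>0. cellcost xs ys (f (\<theta> n)) x) \<le> c + inverse (real (Suc n)) + K * inverse (real (Suc n))"
      by blast
  qed
  have "0 \<le> N (\<theta> n) / G (\<theta> n) \<and> N (\<theta> n) / G (\<theta> n) \<le> 1" for n
    using good[OF \<theta>[of n]] Gpos[OF \<theta>[of n]] Nk[of "\<theta> n"] by simp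
  then have \<Lambda>1: "0 \<le> \<Lambda>" "\<Lambda> \<le> 1"
    using LIMSEQ_le_const[OF lim\<Lambda>, of 0] LIMSEQ_le_const2[OF lim\<Lambda>, of 1] by blast+
  have \<tau>l0: "0 \<le> \<tau>l s" if "s < r" for s
    using \<tau>bound[OF \<theta> that] by (intro LIMSEQ_le_const[OF lim\<tau>[OF that]]) auto
  have a0: "0 \<le> a i" for i
    using dirv_nonneg by (intro LIMSEQ_le_const[OF limdir[of i]]) auto
  have a1: "(\<Sum>i<length xs. a i * real (length (xs ! i))) = 1"
  proof -
    have "(\<lambda>n. \<Sum>i<length xs. dirv xs (\<nu> n) i * real (length (xs ! i))) \<longlonglongrightarrow> (\<Sum>i<length xs. a i * real (length (xs ! i)))"
      by (intro tendsto_sum tendsto_mult tendsto_const lim)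
    moreover have "(\<Sum>i<length xs. dirv xs (\<nu> n) i * real (length (xs ! i))) = 1" for n
      by (rule sum_dirv) (use len[of n] in auto)
    ultimately have "(\<lambda>n::nat. 1::real) \<longlonglongrightarrow> (\<Sum>i<length xs. a i * real (length (xs ! i)))" by simp
    then show ?thesis using LIMSEQ_unique[OF _ tendsto_const] by blast
  qed
  have "OPT xs ys r vs a \<pi>0 \<le> c"
  proof (cases "\<Lambda> = 0")
    case False
    then have "lp_feasible xs ys r vs a \<pi>0 fl \<tau>l \<Lambda>"
      unfolding lp_feasible_iff using circl total rows cols \<Lambda>1 \<tau>l0 by auto
    from OPT_le[OF this] show ?thesis using cost by linarith
  next
    case True
    \<comment> \<open>The limit flow consumes no letter of \<open>X\<close>, so it consists of insertions and costs \<open>1\<close>,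
      which the pure deletion flow attains as well.\<close>
    have "(\<Sum>x\<in>\<pi>0. cellsum xs ys indx fl x) = 0"
      unfolding sum_rows[OF sub, symmetric] using rows True by (intro sum.neutral) auto
    moreover have "(\<Sum>x\<in>\<pi>0. cellsum xs ys (\<lambda>_. 1) fl x) \<le> (\<Sum>x\<in>\<pi>0. cellcost xs ys fl x + cellsum xs ys indx fl x)"
    proof (rule sum_mono)
      fix x assume x: "x \<in> \<pi>0"
      have b: "1 \<le> ecost (xs ! fst x) (ys ! snd x) e + indx e" for e
        using ecost_bounds(3)[where u = "xs ! fst x" and v = "ys ! snd x" and e = e] by linarith
      have "cellsum xs ys (\<lambda>_. 1) fl x \<le> wsum (xs ! fst x) (ys ! snd x) (\<lambda>e. ecost (xs ! fst x) (ys ! snd x) e + indx e) (fl x)"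
        by (intro wsum_mono circl[OF x] b)
      also have "\<dots> = cellcost xs ys fl x + cellsum xs ys indx fl x"
        by (simp add: wsum_def algebra_simps sum.distrib)
      finally show "cellsum xs ys (\<lambda>_. 1) fl x \<le> cellcost xs ys fl x + cellsum xs ys indx fl x" .
    qed
    ultimately have "1 \<le> c" using total cost by (simp add: sum.distrib lp_obj_eq)
    moreover obtain f' \<tau>' lam where feas: "lp_feasible xs ys r vs a \<pi>0 f' \<tau>' lam"
      using lp_feasible_deletions[OF ne \<pi>0 a0 a1] by blast
    ultimately show ?thesis using OPT_le[OF feas] lp_obj_bounds(2)[OF feas] by linarith
  qed
  then show ?thesis using \<pi>0 by blast
qed

subsection \<open>The asymmetric Hausdorff distance\<close>

lemma sup0_upper:
  assumes "x \<in> A" "A \<subseteq> {0..1}"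
  shows "x \<le> sup0 A"
proof -
  have "bdd_above A" using bdd_above_mono[OF bdd_above_Icc assms(2)] .
  then have "x \<le> Sup A" by (rule cSup_upper[OF assms(1)])
  moreover have "A \<noteq> {}" using assms(1) by blast
  ultimately show ?thesis by (simp only: sup0_def if_False)
qed

lemma sup0_least:
  assumes "0 \<le> M" "\<And>x. x \<in> A \<Longrightarrow> x \<le> M"
  shows "sup0 A \<le> M"
proof (cases "A = {}")
  case False
  then show ?thesis using cSup_least[OF False assms(2)] by (simp only: sup0_def if_False)
qed (simp add: sup0_def assms(1))

lemma sup0_nonneg:
  assumes "A \<subseteq> {0..1}"
  shows "0 \<le> sup0 A"
proof (cases "A = {}")
  case False
  then obtain x where x: "x \<in> A" by blast
  then have "0 \<le> x" using assms by auto
  then show ?thesis using sup0_upper[OF x assms] by (rule order.trans)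
qed (simp add: sup0_def)

section \<open>Linear sets, exponent vectors and limit directions\<close>

lemma linset_combination: "(\<lambda>i. \<Sum>q<k. t q * us q i) \<in> linset k us"
  by (auto simp: linset_def)

lemma linset_scale:
  assumes "\<nu> \<in> linset k us"
  shows "(\<lambda>i. c * \<nu> i) \<in> linset k us"
proof -
  obtain t where "\<nu> = (\<lambda>i. \<Sum>q<k. t q * us q i)" using assms by (auto simp: linset_def)
  then have "(\<lambda>i. c * \<nu> i) = (\<lambda>i. \<Sum>q<k. (c * t q) * us q i)" by (simp add: sum_distrib_left mult.assoc)
  then show ?thesis using linset_combination by simp
qed

text \<open>A vector from the range of \<open>wordof\<close> may be nonzero beyond
  \<open>length xs\<close>; cutting it off there keeps the word and meets
  \<open>Svec\<close>.\<close>

lemma Svec_representation: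
  assumes "X \<subseteq> range (wordof xs)" "x \<in> X"
  shows "\<exists>\<nu>\<in>Svec xs X. x = wordof xs \<nu>"
proof -
  obtain \<nu> where \<nu>: "x = wordof xs \<nu>" using assms by auto
  define \<nu>' where "\<nu>' i = (if i < length xs then \<nu> i else 0)" for i
  have "x = wordof xs \<nu>'" unfolding \<nu> by (rule wordof_cong) (simp add: \<nu>'_def)
  then show ?thesis using assms(2) by (intro bexI[of _ \<nu>']) (auto simp: Svec_def \<nu>'_def)
qed

lemma length_wordof_scale: "length (wordof xs (\<lambda>i. c * \<nu> i)) = c * length (wordof xs \<nu>)"
  by (simp add: length_wordof sum_distrib_left mult.assoc)

lemma dirv_scale: "0 < c \<Longrightarrow> dirv xs (\<lambda>i. c * \<nu> i) = dirv xs \<nu>"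
  unfolding dirv_eq length_wordof_scale by (intro ext) simp

lemma wordof_nonempty:
  assumes "\<forall>x\<in>set xs. x \<noteq> []" "\<nu> \<in> Svec xs X" "\<nu> \<noteq> (\<lambda>_. 0)"
  shows "wordof xs \<nu> \<noteq> []"
proof -
  obtain i where i: "\<nu> i \<noteq> 0" using assms(3) by auto
  then have il: "i < length xs" using assms(2) unfolding Svec_def by (metis (mono_tags, lifting) mem_Collect_eq not_le)
  have "0 < \<nu> i * length (xs ! i)" using i il assms(1) by simp
  also have "\<dots> \<le> length (wordof xs \<nu>)" unfolding length_wordof using il by (intro member_le_sum) auto
  finally show ?thesis by auto
qed

text \<open>Closure points in this product topology are sequential limits, and the coordinate
  projections are continuous.\<close>

lemma Dset_sequence:
  assumes "a \<in> Dset xs X"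
  obtains \<nu> where "\<And>n. \<nu> n \<in> Svec xs X" "\<And>n. \<nu> n \<noteq> (\<lambda>_. 0)" "\<And>i. (\<lambda>n. dirv xs (\<nu> n) i) \<longlonglongrightarrow> a i"
proof -
  obtain z :: "nat \<Rightarrow> nat \<Rightarrow> real" where z: "\<forall>n. z n \<in> dirv xs ` (Svec xs X - {\<lambda>_. 0})" "z \<longlonglongrightarrow> a"
    using assms unfolding Dset_def closure_sequential by (elim exE conjE)
  from z(1) have "\<forall>n. \<exists>\<nu>. \<nu> \<in> Svec xs X - {\<lambda>_. 0} \<and> z n = dirv xs \<nu>" by (simp only: image_iff) blast
  from choice[OF this] obtain \<nu> where \<nu>: "\<And>n. \<nu> n \<in> Svec xs X - {\<lambda>_. 0}" "\<And>n. z n = dirv xs (\<nu> n)"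
    by blast
  have "(\<lambda>n. z n i) \<longlonglongrightarrow> a i" for i
  proof -
    have "continuous_on UNIV (\<lambda>x::nat \<Rightarrow> real. x i)" by (rule continuous_on_product_coordinates)
    then have "isCont (\<lambda>x::nat \<Rightarrow> real. x i) a"
      using continuous_on_eq_continuous_at[OF open_UNIV] UNIV_I by blast
    from isCont_tendsto_compose[OF this z(2)] show ?thesis .
  qed
  then show ?thesis using \<nu>(1) unfolding \<nu>(2) by (intro that) blast+
qed

lemma Dset_simplex:
  assumes "\<forall>x\<in>set xs. x \<noteq> []" "a \<in> Dset xs X"
  shows "0 \<le> a i" "(\<Sum>i<length xs. a i * real (length (xs ! i))) = 1"
proof -
  obtain \<nu> where \<nu>: "\<And>n. \<nu> n \<in> Svec xs X" "\<And>n. \<nu> n \<noteq> (\<lambda>_. 0)" "\<And>i. (\<lambda>n. dirv xs (\<nu> n) i) \<longlonglongrightarrow> a i"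
    using Dset_sequence[OF assms(2)] by blast
  show "0 \<le> a i" by (rule LIMSEQ_le_const[OF \<nu>(3)[of i]]) (intro exI[of _ 0] allI impI dirv_nonneg)
  have "(\<lambda>n. \<Sum>i<length xs. dirv xs (\<nu> n) i * real (length (xs ! i))) \<longlonglongrightarrow> (\<Sum>i<length xs. a i * real (length (xs ! i)))"
    by (intro tendsto_sum tendsto_mult tendsto_const \<nu>)
  then have "(\<lambda>n::nat. 1::real) \<longlonglongrightarrow> (\<Sum>i<length xs. a i * real (length (xs ! i)))"
    using sum_dirv[OF wordof_nonempty[OF assms(1) \<nu>(1,2)]] by simp
  then show "(\<Sum>i<length xs. a i * real (length (xs ! i))) = 1"
    using LIMSEQ_unique[OF _ tendsto_const] by blast
qed

theorem mainTheorem18: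
  fixes xs ys :: "'a list list" and X Y :: "'a list set"
    and k r :: nat and us vs :: "nat \<Rightarrow> nat \<Rightarrow> nat"
  assumes "xs \<noteq> []" and "ys \<noteq> []"
    and "\<forall>x\<in>set xs. x \<noteq> []" and "\<forall>y\<in>set ys. y \<noteq> []"
    and "is_cfl X" and "is_cfl Y"
    and "X \<subseteq> range (wordof xs)" and "Y \<subseteq> range (wordof ys)"
    and "\<forall>q<k. \<forall>i\<ge>length xs. us q i = 0" and "\<forall>s<r. \<forall>j\<ge>length ys. vs s j = 0"
    and "Svec xs X = linset k us" and "Svec ys Y = linset r vs"
  shows "AH_ned X Y = sup0 ((\<lambda>a. Min ((\<lambda>\<pi>. OPT xs ys r vs a \<pi>) ` Interl (length xs) (length ys)))
                              ` Dset xs X)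
       \<and> AH_ned X Y = sup0 (Ffun xs ys r vs ` Dset xs X)"
proof -
  note ne = assms(1-4)
  have nm: "0 < length xs" "0 < length ys" using ne by auto
  let ?I = "Interl (length xs) (length ys)"
  have fin: "finite ?I" by (rule finite_Interl[OF nm])
  \<comment> \<open>Any edit path, here between empty words, is split along some interleaving, so
    one exists.\<close>
  have Ine: "?I \<noteq> {}"
  proof -
    obtain p where "edit_path p (wordof xs (\<lambda>_. 0)) (wordof ys (\<lambda>_. 0))" using edit_path_exists by blast
    moreover obtain K :: real where "\<forall>\<nu> \<mu> p. edit_path p (wordof xs \<nu>) (wordof ys \<mu>) \<longrightarrow>
       (\<exists>\<pi>\<in>?I. \<exists>g. flow_of_path xs ys K \<nu> \<mu> p \<pi> g)"
      using edit_path_flow[OF ne] by (elim exE conjE)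
    ultimately show ?thesis by (metis empty_iff)
  qed
  define F where "F = Ffun xs ys r vs"
  define d where "d x = (INF y\<in>Y. ned x y)" for x
  define S where "S k = sup0 (d ` {x \<in> X. k \<le> length x})" for k
  \<comment> \<open>If the zero vector is the only one in \<open>Svec xs X\<close>, there are no
    directions and the default value 0 is taken.\<close>
  define M where "M = sup0 (F ` Dset xs X)"
  \<comment> \<open>With zero constant vector every choice of coefficients gives a word of
    \<open>Y\<close>; in particular \<open>Y\<close> is nonempty and the infima over it are
    proper.\<close>
  have Ymem: "wordof ys (\<lambda>j. \<Sum>s<r. t s * vs s j) \<in> Y" for t
    using linset_combination[where k = r and t = t and us = vs] unfolding assms(12)[symmetric] by (simp add: Svec_def)
  have Yrep: "\<exists>t. y = wordof ys (\<lambda>j. \<Sum>s<r. t s * vs s j)" if "y \<in> Y" for y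
    using Svec_representation[OF assms(8) that] unfolding assms(12) by (auto simp: linset_def)
  have bdd: "bdd_below (ned x ` Y)" for x by (rule bdd_belowI[of _ 0]) (use ned_nonneg in blast)
  have dle: "d x \<le> ned x y" if "y \<in> Y" for x y unfolding d_def using bdd that by (rule cINF_lower)
  have d0: "0 \<le> d x" for x unfolding d_def using Ymem by (intro cINF_greatest ned_nonneg) blast
  have d1: "d x \<le> 1" for x using dle[OF Ymem[of "\<lambda>_. 0"]] ned_le_1 by (rule order.trans)
  have dset: "d ` A \<subseteq> {0..1}" for A using d0 d1 by auto

  have OPT01: "0 \<le> OPT xs ys r vs a \<pi> \<and> OPT xs ys r vs a \<pi> \<le> 1
      \<and> {lp_obj xs ys \<pi> f | f \<tau> lam. lp_feasible xs ys r vs a \<pi> f \<tau> lam} \<noteq> {}"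
    if a: "a \<in> Dset xs X" and \<pi>: "\<pi> \<in> ?I" for a \<pi>
  proof -
    obtain f \<tau> lam where feas: "lp_feasible xs ys r vs a \<pi> f \<tau> lam"
      using lp_feasible_deletions[OF ne \<pi> Dset_simplex[OF ne(3) a]] by blast
    then have non: "{lp_obj xs ys \<pi> f | f \<tau> lam. lp_feasible xs ys r vs a \<pi> f \<tau> lam} \<noteq> {}" by blast
    then have "0 \<le> OPT xs ys r vs a \<pi>" unfolding OPT_def
      by (rule cInf_greatest) (use lp_obj_bounds(1) in blast)
    then show ?thesis using OPT_le[OF feas] lp_obj_bounds(2)[OF feas] non by linarith
  qed
  have Fmin: "\<exists>\<pi>\<in>?I. F a = OPT xs ys r vs a \<pi>" for a
  proof -
    have "F a \<in> (\<lambda>\<pi>. OPT xs ys r vs a \<pi>) ` ?I"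
      unfolding F_def Ffun_def using fin Ine by (intro Min_in) auto
    then show ?thesis by blast
  qed
  have Fle: "F a \<le> OPT xs ys r vs a \<pi>" if "\<pi> \<in> ?I" for a \<pi>
    unfolding F_def Ffun_def using fin that by (intro Min_le) auto
  have Fset: "F ` Dset xs X \<subseteq> {0..1}"
  proof
    fix z assume "z \<in> F ` Dset xs X"
    then obtain a where "a \<in> Dset xs X" "z = F a" by blast
    then show "z \<in> {0..1}" using Fmin[of a] OPT01[of a] by auto
  qed

  \<comment> \<open>Monotonicity and the bound 0 make \<open>S\<close> converge, so the
    \<open>lim\<close> in \<open>AH_ned\<close> denotes an actual limit.\<close>
  have "decseq S" unfolding decseq_def
  proof (intro allI impI)
    fix k k' :: nat assume "k \<le> k'"
    then show "S k' \<le> S k" unfolding S_def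
      by (intro sup0_least sup0_nonneg[OF dset] sup0_upper[OF _ dset]) auto
  qed
  moreover have S0: "0 \<le> S k" for k unfolding S_def by (rule sup0_nonneg[OF dset])
  ultimately obtain L where L: "S \<longlonglongrightarrow> L" "\<forall>k. L \<le> S k" using decseq_convergent[of S 0] by blast
  have AH: "AH_ned X Y = L"
    using limI[OF L(1)] unfolding AH_ned_def S_def[abs_def] d_def[abs_def] .
  have L0: "0 \<le> L" using LIMSEQ_le_const[OF L(1), of 0] S0 by blast

  \<comment> \<open>Proved at every threshold \<open>h\<close>, so that it passes to the limit of
    \<open>S\<close>.\<close>
  have lower: "F a \<le> S h" if a: "a \<in> Dset xs X" for a h
  proof -
    obtain \<nu>0 where \<nu>0: "\<And>n. \<nu>0 n \<in> Svec xs X" "\<And>n. \<nu>0 n \<noteq> (\<lambda>_. 0)" "\<And>i. (\<lambda>n. dirv xs (\<nu>0 n) i) \<longlonglongrightarrow> a i"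
      using Dset_sequence[OF a] by blast
    \<comment> \<open>The factor keeps the direction; \<open>h\<close> pushes the words beyond the
      threshold and \<open>Suc n\<close> makes their lengths grow.\<close>
    define \<nu> where "\<nu> n = (\<lambda>i. (Suc n + h) * \<nu>0 n i)" for n
    have \<nu>S: "\<nu> n \<in> Svec xs X" for n
      using \<nu>0(1)[of n] unfolding assms(11) \<nu>_def by (rule linset_scale)
    have len: "Suc n + h \<le> length (wordof xs (\<nu> n))" for n
      unfolding \<nu>_def length_wordof_scale using wordof_nonempty[OF ne(3) \<nu>0(1,2)[of n]]
      by (metis One_nat_def Suc_leI length_greater_0_conv mult.right_neutral mult_le_mono2)
    have "\<exists>t p. edit_path p (wordof xs (\<nu> n)) (wordof ys (\<lambda>j. \<Sum>s<r. t s * vs s j))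
        \<and> real (wgt p) / real (length p) \<le> S h + inverse (real (Suc n))" for n
    proof -
      have "d (wordof xs (\<nu> n)) \<in> d ` {x \<in> X. h \<le> length x}"
        using \<nu>S[of n] len[of n] unfolding Svec_def by (intro imageI) simp
      then have "d (wordof xs (\<nu> n)) \<le> S h" unfolding S_def by (rule sup0_upper[OF _ dset])
      \<comment> \<open>Strict slack, because both the distance to \<open>Y\<close> and
        \<open>ned\<close> are infima; it vanishes as \<open>n\<close> grows.\<close>
      also have "S h < S h + inverse (real (Suc n))" by simp
      finally obtain y where y: "y \<in> Y" "ned (wordof xs (\<nu> n)) y < S h + inverse (real (Suc n))"
        unfolding d_def by (subst (asm) cINF_less_iff[OF _ bdd]) (use Ymem in blast)+
      obtain t where t: "y = wordof ys (\<lambda>j. \<Sum>s<r. t s * vs s j)" using Yrep[OF y(1)] by blast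
      have "wordof xs (\<nu> n) \<noteq> []" using len[of n] by auto
      from ned_approx[OF y(2) this] obtain p where "edit_path p (wordof xs (\<nu> n)) y" "real (wgt p) / real (length p) < S h + inverse (real (Suc n))" .
      then show ?thesis unfolding t by (intro exI[of _ t] exI[of _ p] conjI less_imp_le)
    qed
    then obtain t p where tp: "\<And>n. edit_path (p n) (wordof xs (\<nu> n)) (wordof ys (\<lambda>j. \<Sum>s<r. t n s * vs s j))"
        "\<And>n. real (wgt (p n)) / real (length (p n)) \<le> S h + inverse (real (Suc n))"
      by metis
    have "(\<lambda>n. dirv xs (\<nu> n) i) \<longlonglongrightarrow> a i" for i
      unfolding \<nu>_def using \<nu>0(3)[of i] by (subst dirv_scale) simp_all
    moreover have "Suc n \<le> length (wordof xs (\<nu> n))" for n using len[of n] by linarith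
    ultimately have "\<exists>\<pi>\<in>?I. OPT xs ys r vs a \<pi> \<le> S h"
      by (intro OPT_le_of_edit_paths[OF ne tp])
    then obtain \<pi> where "\<pi> \<in> ?I" "OPT xs ys r vs a \<pi> \<le> S h" by blast
    then show ?thesis using Fle[of \<pi> a] by linarith
  qed

  define R where "R K \<longleftrightarrow> (\<forall>\<pi>\<in>?I. \<forall>\<nu> f \<tau> lam.
     lp_feasible xs ys r vs (dirv xs \<nu>) \<pi> f \<tau> lam \<longrightarrow> K < real (length (wordof xs \<nu>)) \<longrightarrow>
     (\<exists>t::nat \<Rightarrow> nat. ned (wordof xs \<nu>) (wordof ys (\<lambda>j. \<Sum>s<r. t s * vs s j))
        \<le> lp_obj xs ys \<pi> f + 2 * K / (real (length (wordof xs \<nu>)) - K)))" for K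
  have "\<exists>K. 0 \<le> K \<and> R K" unfolding R_def by (rule ned_round_flow[OF ne])
  then obtain K where K: "0 \<le> K" and RK: "R K" by blast
  note round = RK[unfolded R_def]
  have dM: "d x \<le> M + 2 * K / (length x - K)" if x: "x \<in> X" "K < length x" for x
  \<comment> \<open>The slack \<open>e\<close> allows a near-optimal solution in place of an optimal
    one.\<close>
  proof (rule field_le_epsilon)
    fix e :: real assume e: "0 < e"
    obtain \<nu> where \<nu>: "\<nu> \<in> Svec xs X" "x = wordof xs \<nu>" using Svec_representation[OF assms(7) x(1)] by blast
    have "\<nu> \<noteq> (\<lambda>_. 0)"
    proof
      assume "\<nu> = (\<lambda>_. 0)"
      then have "length x = 0" unfolding \<nu>(2) length_wordof by simp
      then show False using x(2) K by simp
    qed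
    \<comment> \<open>Only directions of actual words occur here; no limit point of the closure is
      involved.\<close>
    then have a: "dirv xs \<nu> \<in> Dset xs X"
      unfolding Dset_def using \<nu>(1) by (intro subsetD[OF closure_subset] imageI) simp
    obtain \<pi> where \<pi>: "\<pi> \<in> ?I" "F (dirv xs \<nu>) = OPT xs ys r vs (dirv xs \<nu>) \<pi>" using Fmin by blast
    have "F (dirv xs \<nu>) \<le> M" unfolding M_def using a by (intro sup0_upper[OF _ Fset] imageI)
    then have "OPT xs ys r vs (dirv xs \<nu>) \<pi> < M + e" using e \<pi>(2) by linarith
    then have "Inf {lp_obj xs ys \<pi> f | f \<tau> lam. lp_feasible xs ys r vs (dirv xs \<nu>) \<pi> f \<tau> lam} < M + e"
      by (simp only: OPT_def)
    from cInf_lessD[OF _ this] OPT01[OF a \<pi>(1)]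
    have "\<exists>z\<in>{lp_obj xs ys \<pi> f | f \<tau> lam. lp_feasible xs ys r vs (dirv xs \<nu>) \<pi> f \<tau> lam}. z < M + e" by blast
    then obtain f \<tau> lam where f: "lp_feasible xs ys r vs (dirv xs \<nu>) \<pi> f \<tau> lam" "lp_obj xs ys \<pi> f < M + e"
      by blast
    from round[rule_format, OF \<pi>(1) f(1)] x(2)
    obtain t :: "nat \<Rightarrow> nat" where "ned x (wordof ys (\<lambda>j. \<Sum>s<r. t s * vs s j))
        \<le> lp_obj xs ys \<pi> f + 2 * K / (length x - K)"
      unfolding \<nu>(2) by blast
    then show "d x \<le> M + 2 * K / (length x - K) + e"
      using dle[OF Ymem, of x t] f(2) by linarith
  qed
  have M0: "0 \<le> M" unfolding M_def by (rule sup0_nonneg[OF Fset])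
  have SM: "S h \<le> M + 2 * K / (real h - K)" if h: "K < real h" for h
    unfolding S_def
  proof (rule sup0_least)
    show "0 \<le> M + 2 * K / (real h - K)" using M0 K h by simp
    fix z assume "z \<in> d ` {x \<in> X. h \<le> length x}"
    then obtain x where x: "x \<in> X" "h \<le> length x" "z = d x" by blast
    have "2 * K / (length x - K) \<le> 2 * K / (real h - K)"
      using K h x(2) by (intro divide_left_mono mult_pos_pos) auto
    then show "z \<le> M + 2 * K / (real h - K)" using dM[OF x(1)] x(2,3) h by simp
  qed
  have "L \<le> M"
  proof (rule LIMSEQ_le[OF L(1)])
    have "filterlim (\<lambda>h. real h - K) at_top sequentially"
      using filterlim_tendsto_add_at_top[OF tendsto_const[of "- K"] filterlim_real_sequentially] by simp
    then have "(\<lambda>h. 2 * K / (real h - K)) \<longlonglongrightarrow> 0"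
      by (intro tendsto_divide_0[OF tendsto_const] filterlim_at_top_imp_at_infinity)
    from tendsto_add[OF tendsto_const this, of M]
    show "(\<lambda>h. M + 2 * K / (real h - K)) \<longlonglongrightarrow> M" by simp
    obtain h0 :: nat where "K < real h0" using reals_Archimedean2 by blast
    then show "\<exists>h0. \<forall>h\<ge>h0. S h \<le> M + 2 * K / (real h - K)"
      using SM by (intro exI[of _ h0]) (auto intro!: SM)
  qed
  moreover have "M \<le> L" unfolding M_def
    by (rule sup0_least[OF L0]) (use lower LIMSEQ_le_const[OF L(1)] in blast)
  ultimately have "AH_ned X Y = M" using AH by simp
  then show ?thesis unfolding M_def F_def Ffun_def by blast
qed

end
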